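(* Consider the exit-time differential game described in the context, with data $\Omega_X,\Omega_Y,A,B,\lambda,f,g,\ell,\psi_X,\psi_Y,\psi_{XY}$ satisfying the regularity hypotheses listed there. Suppose that Assumption 1 (controllability on the boundaries) and Assumption 2 (existence of suitable constrained non-anticipating tunings and strategies), both stated in the context, hold, and that $$\psi_Y(x,y)\le\psi_{XY}(x,y)\le\psi_X(x,y)\qquad\forall (x,y)\in\partial\Omega_X\times\partial\Omega_Y .$$ Then the lower value function $\underline V$ and the upper value function $\overline V$ are continuous in $\overline\Omega_X\times\overline\Omega_Y$.
   Context: **Regularity hypotheses.** $\Omega_X\subseteq\mathbb{R}^n$ and $\Omega_Y\subseteq\mathbb{R}^m$ are open sets with $C^2$ boundary; $A\subset\mathbb{R}^{n'}$, $B\subset\mathbb{R}^{m'}$ are compact; $\lambda>0$; $\mathcal{A}$ (resp. $\mathcal{B}$) is the set of measurable functions $\alpha:[0,+\infty[\to A$ (resp. $\beta:[0,+\infty[\to B$). The functions $f:\mathbb{R}^n\times A\to\mathbb{R}^n$, $g:\mathbb{R}^m\times B\to\mathbb{R}^m$, $\ell:\mathbb{R}^n\times\mathbb{R}^m\times A\times B\to[0,+\infty[$, $\psi_X:\partial\Omega_X\times\overline\Omega_Y\to[0,+\infty[$, $\psi_Y:\overline\Omega_X\times\partial\Omega_Y\to[0,+\infty[$, $\psi_{XY}:\partial\Omega_X\times\partial\Omega_Y\to[0,+\infty[$ are continuous and bounded (by a common constant $M$), and there is $L>0$ such that $\|f(x_1,a)-f(x_2,a)\|\le L\|x_1-x_2\|$,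 $\|g(y_1,b)-g(y_2,b)\|\le L\|y_1-y_2\|$, $|\ell(x_1,y_1,a,b)-\ell(x_2,y_2,a,b)|\le L\|(x_1,y_1)-(x_2,y_2)\|$ for all arguments. **Dynamics and exit times.** For $x\in\overline\Omega_X$, $\alpha\in\mathcal{A}$, $X(\cdot;x,\alpha)$ is the solution of $X'(t)=f(X(t),\alpha(t))$, $t>0$, $X(0)=x$; for $y\in\overline\Omega_Y$, $\beta\in\mathcal{B}$, $Y(\cdot;y,\beta)$ is the solution of $Y'(t)=g(Y(t),\beta(t))$, $t>0$, $Y(0)=y$. Set $\tau_X(x,\alpha)=\inf\{t\ge0: X(t;x,\alpha)\notin\overline\Omega_X\}$, $\tau_Y(y,\beta)=\inf\{t\ge0: Y(t;y,\beta)\notin\overline\Omega_Y\}$, with $\inf\emptyset=+\infty$. **Cost.** With $\tau=\min\{\tau_X(x,\alpha),\tau_Y(y,\beta)\}$, $$J(x,y,\alpha,\beta)=\int_0^\tau e^{-\lambda t}\ell(X(t;x,\alpha),Y(t;y,\beta),\alpha(t),\beta(t))\,dt+e^{-\lambda\tau}\psi(X(\tau;x,\alpha),Y(\tau;y,\beta)),$$ where $\psi=\psi_X$ if $\tau_X(x,\alpha)<\tau_Y(y,\beta)$, $\psi=\psi_Y$ if $\tau_Y(y,\beta)<\tau_X(x,\alpha)$, $\psi=\psi_{XY}$ if $\tau_X(x,\alpha)=\tau_Y(y,\beta)<+\infty$, and the last term is $0$ if $\tau=+\infty$. For $0\le\sigma<+\infty$, $J_\sigma(x,y,\alpha,\beta)$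 denotes only the integral $\int_0^\sigma e^{-\lambda t}\ell(X(t;x,\alpha),Y(t;y,\beta),\alpha(t),\beta(t))\,dt$. **Non-anticipating maps and values.** A map $u\mapsto\tilde u$ between sets of measurable functions on $[0,+\infty[$ is a non-anticipating tuning if for all $t\ge0$: $u_1=u_2$ a.e. in $[0,t]$ implies $\tilde u_1=\tilde u_2$ a.e. in $[0,t]$. $\Gamma$ is the set of non-anticipating tunings $\gamma:\mathcal{B}\to\mathcal{A}$, $\beta\mapsto\gamma[\beta]$ (non-anticipating strategies for $X$); $\chi$ is the set of non-anticipating tunings $\xi:\mathcal{A}\to\mathcal{B}$, $\alpha\mapsto\xi[\alpha]$ (non-anticipating strategies for $Y$). The values are, for $(x,y)\in\overline\Omega_X\times\overline\Omega_Y$, $$\underline V(x,y)=\inf_{\gamma\in\Gamma}\sup_{\beta\in\mathcal{B}}J(x,y,\gamma[\beta],\beta),\qquad \overline V(x,y)=\sup_{\xi\in\chi}\inf_{\alpha\in\mathcal{A}}J(x,y,\alpha,\xi[\alpha]).$$ **Assumption 1.** Let $\eta_X,\eta_Y$ be the outer unit normals to $\Omega_X,\Omega_Y$. For every $x\in\partial\Omega_X$ there are $a_1,a_2\in A$ with $f(x,a_1)\cdot\eta_X(x)<0$ and $f(x,a_2)\cdot\eta_X(x)>0$; for every $y\in\partial\Omega_Y$ there are $b_1,b_2\in B$ with $g(y,b_1)\cdot\eta_Y(y)<0$ and $g(y,b_2)\cdot\eta_Y(y)>0$. **Assumption 2.** A modulus of continuity is an increasing continuous function $\omega:[0,+\infty[\to[0,+\infty[$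 with $\omega(0)=0$. For every $T>0$ and every compact $K\subseteq\overline\Omega_X\times\overline\Omega_Y$ there exists a modulus of continuity $\mathcal{O}_{T,K}$ such that: (I) for every $(x_1,y_1),(x_2,y_2)\in K$ there exist a non-anticipating tuning $\beta\mapsto\tilde\beta$ from $\mathcal{B}$ to itself and a way to associate to any $\gamma\in\Gamma$ some $\tilde\gamma\in\Gamma$ such that for every $\beta\in\mathcal{B}$, $\gamma\in\Gamma$, with $\tilde\tau=\min\{\tau_X(x_2,\gamma[\tilde\beta]),\tau_Y(y_1,\beta),T\}$: - $\tau_X(x_1,\tilde\gamma[\beta])\ge\tau_X(x_2,\gamma[\beta])$; - $\tau_Y(y_2,\tilde\beta)\ge\tau_Y(y_1,\beta)$; - $\|X(\tilde\tau;x_1,\tilde\gamma[\beta])-X(\tilde\tau;x_2,\gamma[\beta])\|\le\mathcal{O}_{T,K}(\|x_1-x_2\|)$; - $\|Y(\tilde\tau;y_1,\beta)-Y(\tilde\tau;y_2,\tilde\beta)\|\le\mathcal{O}_{T,K}(\|y_1-y_2\|)$; - $|J_{\tilde\tau}(x_1,y_1,\tilde\gamma[\tilde\beta],\beta)-J_{\tilde\tau}(x_2,y_2,\gamma[\tilde\beta],\tilde\beta)|\le\mathcal{O}_{T,K}(\|(x_1,y_1)-(x_2,y_2)\|)$. (II) The same with the roles of the players reversed: for every $(x_1,y_1),(x_2,y_2)\in K$ there exist a non-anticipating tuning $\alpha\mapsto\tilde\alpha$ from $\mathcal{A}$ to itself and a way to associate to any $\xi\in\chi$ some $\tilde\xi\in\chi$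 such that for every $\alpha\in\mathcal{A}$, $\xi\in\chi$, with $\tilde\tau=\min\{\tau_Y(y_2,\xi[\tilde\alpha]),\tau_X(x_1,\alpha),T\}$: $\tau_Y(y_1,\tilde\xi[\alpha])\ge\tau_Y(y_2,\xi[\alpha])$; $\tau_X(x_2,\tilde\alpha)\ge\tau_X(x_1,\alpha)$; $\|Y(\tilde\tau;y_1,\tilde\xi[\alpha])-Y(\tilde\tau;y_2,\xi[\alpha])\|\le\mathcal{O}_{T,K}(\|y_1-y_2\|)$; $\|X(\tilde\tau;x_1,\alpha)-X(\tilde\tau;x_2,\tilde\alpha)\|\le\mathcal{O}_{T,K}(\|x_1-x_2\|)$; $|J_{\tilde\tau}(x_1,y_1,\alpha,\tilde\xi[\tilde\alpha])-J_{\tilde\tau}(x_2,y_2,\tilde\alpha,\xi[\tilde\alpha])|\le\mathcal{O}_{T,K}(\|(x_1,y_1)-(x_2,y_2)\|)$. *)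

theory Defs
  imports "HOL-Analysis.Analysis"
begin

text \<open>On the open set \<open>U\<close>, \<open>\<phi>\<close> is \<open>C\<^sup>2\<close> with nowhere vanishing gradient \<open>G\<close>, and \<open>\<Omega>\<close> is the
  sublevel set \<open>{\<phi> < 0}\<close>. For open \<open>\<Omega>\<close> this forces \<open>frontier \<Omega> \<inter> U = {z \<in> U. \<phi> z = 0}\<close>, so that
  \<open>\<Omega>\<close> lies locally on one side of its boundary and \<open>G\<close> points out of \<open>\<Omega>\<close>.\<close>

definition C2_defining_function ::
    "'a::euclidean_space set \<Rightarrow> 'a set \<Rightarrow> ('a \<Rightarrow> real) \<Rightarrow> ('a \<Rightarrow> 'a) \<Rightarrow> bool" where
  "C2_defining_function \<Omega> U \<phi> G \<longleftrightarrow>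
     open U \<and>
     (\<forall>z\<in>U. GDERIV \<phi> z :> G z \<and> G z \<noteq> 0) \<and>
     (\<exists>H :: 'a \<Rightarrow> 'a \<Rightarrow>\<^sub>L 'a.
        (\<forall>z\<in>U. (G has_derivative blinfun_apply (H z)) (at z)) \<and> continuous_on U H) \<and>
     \<Omega> \<inter> U = {z \<in> U. \<phi> z < 0}"

definition C2_boundary :: "'a::euclidean_space set \<Rightarrow> bool" where
  "C2_boundary \<Omega> \<longleftrightarrow> (\<forall>x \<in> frontier \<Omega>. \<exists>U \<phi> G. x \<in> U \<and> C2_defining_function \<Omega> U \<phi> G)"

text \<open>The normalised gradient does not depend on the choice of the defining function.\<close>

definition outer_normal :: "'a::euclidean_space set \<Rightarrow> 'a \<Rightarrow> 'a" where
  "outer_normal \<Omega> x =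
     (THE \<nu>. \<exists>U \<phi> G. x \<in> U \<and> C2_defining_function \<Omega> U \<phi> G \<and> \<nu> = G x /\<^sub>R norm (G x))"

text \<open>Functions on \<open>[0,\<infinity>[\<close> are represented by their extensional representatives, i.e. they are
  \<open>undefined\<close> at negative times.\<close>

definition controls :: "'c::euclidean_space set \<Rightarrow> (real \<Rightarrow> 'c) set" where
  "controls C = {u \<in> {0..} \<rightarrow>\<^sub>E C. u \<in> borel_measurable (lebesgue_on {0..})}"

definition ae_eq_upto :: "real \<Rightarrow> (real \<Rightarrow> 'c) \<Rightarrow> (real \<Rightarrow> 'c) \<Rightarrow> bool" where
  "ae_eq_upto t u v \<longleftrightarrow> (AE s in lebesgue. s \<in> {0..t} \<longrightarrow> u s = v s)"

definition tunings ::
    "(real \<Rightarrow> 'c) set \<Rightarrow> (real \<Rightarrow> 'd) set \<Rightarrow> ((real \<Rightarrow> 'c) \<Rightarrow> (real \<Rightarrow> 'd)) set" where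
  "tunings \<U> \<V> = {\<theta> \<in> \<U> \<rightarrow>\<^sub>E \<V>.
     \<forall>u1\<in>\<U>. \<forall>u2\<in>\<U>. \<forall>t\<ge>0. ae_eq_upto t u1 u2 \<longrightarrow> ae_eq_upto t (\<theta> u1) (\<theta> u2)}"

text \<open>Solutions of \<open>z' = h z (u t)\<close>, \<open>z 0 = z0\<close> are understood in the Caratheodory sense, since the
  control is merely measurable.\<close>

definition solves_controlled_ode ::
    "('a::euclidean_space \<Rightarrow> 'c \<Rightarrow> 'a) \<Rightarrow> 'a \<Rightarrow> (real \<Rightarrow> 'c) \<Rightarrow> (real \<Rightarrow> 'a) \<Rightarrow> bool" where
  "solves_controlled_ode h z0 u Z \<longleftrightarrow>
     continuous_on {0..} Z \<and>
     (\<forall>t\<ge>0. set_integrable lebesgue {0..t} (\<lambda>s. h (Z s) (u s)) \<and>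
            Z t = z0 + (LINT s:{0..t}|lebesgue. h (Z s) (u s)))"

text \<open>Under the Lipschitz and boundedness hypotheses below the solution exists and is unique on
  \<open>[0,\<infinity>[\<close>; its values at negative times are never used.\<close>

definition trajectory ::
    "('a::euclidean_space \<Rightarrow> 'c \<Rightarrow> 'a) \<Rightarrow> 'a \<Rightarrow> (real \<Rightarrow> 'c) \<Rightarrow> real \<Rightarrow> 'a" where
  "trajectory h z0 u = (SOME Z. solves_controlled_ode h z0 u Z)"

text \<open>In \<open>ereal\<close> the infimum of the empty set is \<open>\<infinity>\<close>.\<close>

definition exit_time :: "'a::euclidean_space set \<Rightarrow> (real \<Rightarrow> 'a) \<Rightarrow> ereal" where
  "exit_time \<Omega> Z = Inf (ereal ` {t. 0 \<le> t \<and> Z t \<notin> closure \<Omega>})"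

record ('x, 'y, 'a, 'b) exit_game =
  domX :: "'x set"
  domY :: "'y set"
  ctrlX :: "'a set"
  ctrlY :: "'b set"
  discount :: real
  dynX :: "'x \<Rightarrow> 'a \<Rightarrow> 'x"
  dynY :: "'y \<Rightarrow> 'b \<Rightarrow> 'y"
  running :: "'x \<Rightarrow> 'y \<Rightarrow> 'a \<Rightarrow> 'b \<Rightarrow> real"
  psiX :: "'x \<Rightarrow> 'y \<Rightarrow> real"
  psiY :: "'x \<Rightarrow> 'y \<Rightarrow> real"
  psiXY :: "'x \<Rightarrow> 'y \<Rightarrow> real"

definition regular_game ::
    "('x::euclidean_space, 'y::euclidean_space, 'a::euclidean_space, 'b::euclidean_space) exit_game
      \<Rightarrow> bool" where
  "regular_game G \<longleftrightarrow>
     open (domX G) \<and> C2_boundary (domX G) \<and>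
     open (domY G) \<and> C2_boundary (domY G) \<and>
     compact (ctrlX G) \<and> compact (ctrlY G) \<and>
     discount G > 0 \<and>
     continuous_on (UNIV \<times> ctrlX G) (\<lambda>(x, a). dynX G x a) \<and>
     continuous_on (UNIV \<times> ctrlY G) (\<lambda>(y, b). dynY G y b) \<and>
     continuous_on (UNIV \<times> UNIV \<times> ctrlX G \<times> ctrlY G) (\<lambda>(x, y, a, b). running G x y a b) \<and>
     continuous_on (frontier (domX G) \<times> closure (domY G)) (\<lambda>(x, y). psiX G x y) \<and>
     continuous_on (closure (domX G) \<times> frontier (domY G)) (\<lambda>(x, y). psiY G x y) \<and>
     continuous_on (frontier (domX G) \<times> frontier (domY G)) (\<lambda>(x, y). psiXY G x y) \<and>
     (\<forall>x y. \<forall>a \<in> ctrlX G. \<forall>b \<in> ctrlY G. 0 \<le> running G x y a b) \<and>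
     (\<forall>x \<in> frontier (domX G). \<forall>y \<in> closure (domY G). 0 \<le> psiX G x y) \<and>
     (\<forall>x \<in> closure (domX G). \<forall>y \<in> frontier (domY G). 0 \<le> psiY G x y) \<and>
     (\<forall>x \<in> frontier (domX G). \<forall>y \<in> frontier (domY G). 0 \<le> psiXY G x y) \<and>
     (\<exists>M.
        (\<forall>x. \<forall>a \<in> ctrlX G. norm (dynX G x a) \<le> M) \<and>
        (\<forall>y. \<forall>b \<in> ctrlY G. norm (dynY G y b) \<le> M) \<and>
        (\<forall>x y. \<forall>a \<in> ctrlX G. \<forall>b \<in> ctrlY G. running G x y a b \<le> M) \<and>
        (\<forall>x \<in> frontier (domX G). \<forall>y \<in> closure (domY G). psiX G x y \<le> M) \<and>
        (\<forall>x \<in> closure (domX G). \<forall>y \<in> frontier (domY G). psiY G x y \<le> M) \<and>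
        (\<forall>x \<in> frontier (domX G). \<forall>y \<in> frontier (domY G). psiXY G x y \<le> M)) \<and>
     (\<exists>L>0.
        (\<forall>x1 x2. \<forall>a \<in> ctrlX G. norm (dynX G x1 a - dynX G x2 a) \<le> L * norm (x1 - x2)) \<and>
        (\<forall>y1 y2. \<forall>b \<in> ctrlY G. norm (dynY G y1 b - dynY G y2 b) \<le> L * norm (y1 - y2)) \<and>
        (\<forall>x1 x2 y1 y2. \<forall>a \<in> ctrlX G. \<forall>b \<in> ctrlY G.
           \<bar>running G x1 y1 a b - running G x2 y2 a b\<bar> \<le> L * norm ((x1, y1) - (x2, y2))))"

definition controlsX ::
    "('x, 'y, 'a::euclidean_space, 'b) exit_game \<Rightarrow> (real \<Rightarrow> 'a) set" where
  "controlsX G = controls (ctrlX G)"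

definition controlsY ::
    "('x, 'y, 'a, 'b::euclidean_space) exit_game \<Rightarrow> (real \<Rightarrow> 'b) set" where
  "controlsY G = controls (ctrlY G)"

definition strategiesX ::
    "('x, 'y, 'a::euclidean_space, 'b::euclidean_space) exit_game
      \<Rightarrow> ((real \<Rightarrow> 'b) \<Rightarrow> (real \<Rightarrow> 'a)) set" where
  "strategiesX G = tunings (controlsY G) (controlsX G)"

definition strategiesY ::
    "('x, 'y, 'a::euclidean_space, 'b::euclidean_space) exit_game
      \<Rightarrow> ((real \<Rightarrow> 'a) \<Rightarrow> (real \<Rightarrow> 'b)) set" where
  "strategiesY G = tunings (controlsX G) (controlsY G)"

definition trajX ::
    "('x::euclidean_space, 'y, 'a, 'b) exit_game \<Rightarrow> 'x \<Rightarrow> (real \<Rightarrow> 'a) \<Rightarrow> real \<Rightarrow> 'x" where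
  "trajX G x \<alpha> = trajectory (dynX G) x \<alpha>"

definition trajY ::
    "('x, 'y::euclidean_space, 'a, 'b) exit_game \<Rightarrow> 'y \<Rightarrow> (real \<Rightarrow> 'b) \<Rightarrow> real \<Rightarrow> 'y" where
  "trajY G y \<beta> = trajectory (dynY G) y \<beta>"

definition exitX ::
    "('x::euclidean_space, 'y, 'a, 'b) exit_game \<Rightarrow> 'x \<Rightarrow> (real \<Rightarrow> 'a) \<Rightarrow> ereal" where
  "exitX G x \<alpha> = exit_time (domX G) (trajX G x \<alpha>)"

definition exitY ::
    "('x, 'y::euclidean_space, 'a, 'b) exit_game \<Rightarrow> 'y \<Rightarrow> (real \<Rightarrow> 'b) \<Rightarrow> ereal" where
  "exitY G y \<beta> = exit_time (domY G) (trajY G y \<beta>)"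

definition running_cost ::
    "('x::euclidean_space, 'y::euclidean_space, 'a, 'b) exit_game
      \<Rightarrow> ereal \<Rightarrow> 'x \<Rightarrow> 'y \<Rightarrow> (real \<Rightarrow> 'a) \<Rightarrow> (real \<Rightarrow> 'b) \<Rightarrow> real" where
  "running_cost G \<sigma> x y \<alpha> \<beta> =
     (LINT t:{t. 0 \<le> t \<and> ereal t \<le> \<sigma>}|lebesgue.
        exp (- discount G * t) * running G (trajX G x \<alpha> t) (trajY G y \<beta> t) (\<alpha> t) (\<beta> t))"

definition cost ::
    "('x::euclidean_space, 'y::euclidean_space, 'a, 'b) exit_game
      \<Rightarrow> 'x \<Rightarrow> 'y \<Rightarrow> (real \<Rightarrow> 'a) \<Rightarrow> (real \<Rightarrow> 'b) \<Rightarrow> real" where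
  "cost G x y \<alpha> \<beta> =
     (let \<tau>X = exitX G x \<alpha>; \<tau>Y = exitY G y \<beta>; \<tau> = min \<tau>X \<tau>Y; T = real_of_ereal \<tau>;
          \<psi> = (if \<tau>X < \<tau>Y then psiX G else if \<tau>Y < \<tau>X then psiY G else psiXY G)
      in running_cost G \<tau> x y \<alpha> \<beta> +
         (if \<tau> = \<infinity> then 0
          else exp (- discount G * T) * \<psi> (trajX G x \<alpha> T) (trajY G y \<beta> T)))"

text \<open>For a regular game the cost lies in a bounded interval, so the real-valued infima and suprema
  are the genuine ones as soon as both control sets are nonempty; otherwise the sets over which they
  are taken do not depend on the initial point, and the values are constant.\<close>

definition lower_value ::
    "('x::euclidean_space, 'y::euclidean_space, 'a::euclidean_space, 'b::euclidean_space) exit_game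
      \<Rightarrow> 'x \<Rightarrow> 'y \<Rightarrow> real" where
  "lower_value G x y = (INF \<gamma> \<in> strategiesX G. SUP \<beta> \<in> controlsY G. cost G x y (\<gamma> \<beta>) \<beta>)"

definition upper_value ::
    "('x::euclidean_space, 'y::euclidean_space, 'a::euclidean_space, 'b::euclidean_space) exit_game
      \<Rightarrow> 'x \<Rightarrow> 'y \<Rightarrow> real" where
  "upper_value G x y = (SUP \<xi> \<in> strategiesY G. INF \<alpha> \<in> controlsX G. cost G x y \<alpha> (\<xi> \<alpha>))"

definition boundary_controllable ::
    "('x::euclidean_space, 'y::euclidean_space, 'a, 'b) exit_game \<Rightarrow> bool" where
  "boundary_controllable G \<longleftrightarrow>
     (\<forall>x \<in> frontier (domX G). \<exists>a1 \<in> ctrlX G. \<exists>a2 \<in> ctrlX G.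
        dynX G x a1 \<bullet> outer_normal (domX G) x < 0 \<and> dynX G x a2 \<bullet> outer_normal (domX G) x > 0) \<and>
     (\<forall>y \<in> frontier (domY G). \<exists>b1 \<in> ctrlY G. \<exists>b2 \<in> ctrlY G.
        dynY G y b1 \<bullet> outer_normal (domY G) y < 0 \<and> dynY G y b2 \<bullet> outer_normal (domY G) y > 0)"

definition modulus :: "(real \<Rightarrow> real) \<Rightarrow> bool" where
  "modulus \<omega> \<longleftrightarrow>
     mono_on {0..} \<omega> \<and> continuous_on {0..} \<omega> \<and> (\<forall>r\<ge>0. 0 \<le> \<omega> r) \<and> \<omega> 0 = 0"

text \<open>\<open>\<rho>\<close> is the tuning of the opponent's control and \<open>\<Theta>\<close> associates a strategy with a strategy.
  The time \<open>\<tau>\<close> is finite, being at most \<open>T\<close>. Pitfall: the strategies receive the untuned control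
  in the estimates for their own exit times and states, but the tuned control in \<open>\<tau>\<close> and in the
  running costs.\<close>

definition tuningX ::
    "('x::euclidean_space, 'y::euclidean_space, 'a::euclidean_space, 'b::euclidean_space) exit_game
      \<Rightarrow> (real \<Rightarrow> real) \<Rightarrow> real \<Rightarrow> 'x \<Rightarrow> 'y \<Rightarrow> 'x \<Rightarrow> 'y \<Rightarrow> bool" where
  "tuningX G \<omega> T x1 y1 x2 y2 \<longleftrightarrow>
     (\<exists>\<rho> \<in> tunings (controlsY G) (controlsY G). \<exists>\<Theta> \<in> strategiesX G \<rightarrow> strategiesX G.
        \<forall>\<beta> \<in> controlsY G. \<forall>\<gamma> \<in> strategiesX G.
          (let \<tau> = real_of_ereal (min (min (exitX G x2 (\<gamma> (\<rho> \<beta>))) (exitY G y1 \<beta>)) (ereal T)) in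
             exitX G x1 (\<Theta> \<gamma> \<beta>) \<ge> exitX G x2 (\<gamma> \<beta>) \<and>
             exitY G y2 (\<rho> \<beta>) \<ge> exitY G y1 \<beta> \<and>
             norm (trajX G x1 (\<Theta> \<gamma> \<beta>) \<tau> - trajX G x2 (\<gamma> \<beta>) \<tau>) \<le> \<omega> (norm (x1 - x2)) \<and>
             norm (trajY G y1 \<beta> \<tau> - trajY G y2 (\<rho> \<beta>) \<tau>) \<le> \<omega> (norm (y1 - y2)) \<and>
             \<bar>running_cost G \<tau> x1 y1 (\<Theta> \<gamma> (\<rho> \<beta>)) \<beta> - running_cost G \<tau> x2 y2 (\<gamma> (\<rho> \<beta>)) (\<rho> \<beta>)\<bar>
               \<le> \<omega> (norm ((x1, y1) - (x2, y2)))))"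

definition tuningY ::
    "('x::euclidean_space, 'y::euclidean_space, 'a::euclidean_space, 'b::euclidean_space) exit_game
      \<Rightarrow> (real \<Rightarrow> real) \<Rightarrow> real \<Rightarrow> 'x \<Rightarrow> 'y \<Rightarrow> 'x \<Rightarrow> 'y \<Rightarrow> bool" where
  "tuningY G \<omega> T x1 y1 x2 y2 \<longleftrightarrow>
     (\<exists>\<rho> \<in> tunings (controlsX G) (controlsX G). \<exists>\<Theta> \<in> strategiesY G \<rightarrow> strategiesY G.
        \<forall>\<alpha> \<in> controlsX G. \<forall>\<xi> \<in> strategiesY G.
          (let \<tau> = real_of_ereal (min (min (exitY G y2 (\<xi> (\<rho> \<alpha>))) (exitX G x1 \<alpha>)) (ereal T)) in
             exitY G y1 (\<Theta> \<xi> \<alpha>) \<ge> exitY G y2 (\<xi> \<alpha>) \<and>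
             exitX G x2 (\<rho> \<alpha>) \<ge> exitX G x1 \<alpha> \<and>
             norm (trajY G y1 (\<Theta> \<xi> \<alpha>) \<tau> - trajY G y2 (\<xi> \<alpha>) \<tau>) \<le> \<omega> (norm (y1 - y2)) \<and>
             norm (trajX G x1 \<alpha> \<tau> - trajX G x2 (\<rho> \<alpha>) \<tau>) \<le> \<omega> (norm (x1 - x2)) \<and>
             \<bar>running_cost G \<tau> x1 y1 \<alpha> (\<Theta> \<xi> (\<rho> \<alpha>)) - running_cost G \<tau> x2 y2 (\<rho> \<alpha>) (\<xi> (\<rho> \<alpha>))\<bar>
               \<le> \<omega> (norm ((x1, y1) - (x2, y2)))))"

definition constrained_tunings ::
    "('x::euclidean_space, 'y::euclidean_space, 'a::euclidean_space, 'b::euclidean_space) exit_game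
      \<Rightarrow> bool" where
  "constrained_tunings G \<longleftrightarrow>
     (\<forall>T>0. \<forall>K. compact K \<and> K \<subseteq> closure (domX G) \<times> closure (domY G) \<longrightarrow>
        (\<exists>\<omega>. modulus \<omega> \<and>
           (\<forall>(x1, y1) \<in> K. \<forall>(x2, y2) \<in> K.
              tuningX G \<omega> T x1 y1 x2 y2 \<and> tuningY G \<omega> T x1 y1 x2 y2)))"

end

theory Submission
  imports Defs
begin

text \<open>To follow a trajectory from \<open>x2\<close> driven by \<open>\<alpha>\<close> with a trajectory starting from a nearby \<open>x1\<close>, use \<open>\<alpha>\<close> itself,
  except that in each step of a fixed time grid, near the boundary, \<open>\<alpha>\<close> is replaced by an inward pointing control at the
  first times when it does not point inwards itself, for a total duration proportional to the distance of
  the two trajectories. This keeps the new trajectory inside as long as the old one is; the distance grows by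
  a constant factor per step, and the two controls differ only on a set of small measure, which makes the running
  costs close although they depend on the controls. When the old trajectory exits, an outward pointing
  control makes the new one exit shortly afterwards.

  Given a strategy \<open>\<gamma>\<close> at \<open>(x2, y2)\<close>, such tunings \<open>P\<close> from \<open>x2\<close> to \<open>x1\<close> and \<open>Q\<close> from \<open>y1\<close> to \<open>y2\<close> provide the strategy
  \<open>\<beta> \<mapsto> P (\<gamma> (Q \<beta>))\<close> at \<open>(x1, y1)\<close>. Here \<open>X\<close> exits later from \<open>x1\<close> than from \<open>x2\<close>, and \<open>Y\<close> earlier from \<open>y1\<close> than from \<open>y2\<close>,
  so that by the order of the terminal costs the new cost is at most slightly larger. The upper value is the
  negative of the lower value of the game with the players exchanged and the costs negated.\<close>

section \<open>Caratheodory solutions\<close>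

text \<open>The running cost depends on the controls, so a follower may not simply use a delayed
  copy of \<open>\<alpha>\<close>, which can differ from \<open>\<alpha>\<close> at most times.
  Replacing controls that already push inwards need not gain anything; hence only the other times
  are charged to the budget, and each unit of it gains at least 3/2 c in the normal direction. With
  budget (4 / e) D at distance D there are two cases in a step: either the budget is not exhausted,
  and then every control in use points inwards, or the gain beats D together with all errors. Charts
  are frozen at grid points. This keeps the construction causal, and measurable although charts are
  picked by arbitrary choice. The radius e, which also bounds c from below, is uniform on compact
  sets, and the step length depends only on e, M and L. So the number of steps before
  \<open>T\<close> is known before the initial distance is chosen, and the accumulated growth factor
  is harmless. The leaders, \<open>X\<close> from \<open>x2\<close> and \<open>Y\<close> from
  \<open>y1\<close>, belong to different pairs. Costs are therefore compared up to the first exit of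
  a leader, the last time at which both trajectories are still controlled; afterwards both games
  stop almost at once, or discounting takes over.\<close>

lemma measurable_continuous_compose:
  assumes "continuous_on A f" "g \<in> borel_measurable M" "\<And>w. w \<in> space M \<Longrightarrow> g w \<in> A"
  shows "(\<lambda>w. f (g w)) \<in> borel_measurable M"
proof -
  have "g \<in> M \<rightarrow>\<^sub>M restrict_space borel A"
    using assms(2,3) by (intro measurable_restrict_space2) auto
  from measurable_compose[OF this borel_measurable_continuous_on_restrict[OF assms(1)]]
  show ?thesis .
qed

section \<open>Integral bounds with an exceptional set\<close>

lemma set_integrable_bounded_interval:
  fixes f :: "real \<Rightarrow> 'a::euclidean_space"
  assumes f: "f \<in> borel_measurable (lebesgue_on {0..})" and "0 \<le> a"
    and B: "\<And>s. a \<le> s \<Longrightarrow> s \<le> b \<Longrightarrow> norm (f s) \<le> B"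
  shows "set_integrable lebesgue {a..b} f"
proof (rule measurable_bounded_by_integrable_imp_absolutely_integrable[where g = "\<lambda>_. B"])
  show "f \<in> borel_measurable (lebesgue_on {a..b})"
    by (rule measurable_restrict_mono[OF f]) (use \<open>0 \<le> a\<close> in auto)
qed (use B in auto)

text \<open>The common form of the later estimates: \<open>p\<close> is the rate off
  \<open>E\<close>, and \<open>E\<close> collects the times at which a control has been replaced.
  The sign of \<open>q\<close> is free; a negative \<open>q\<close> records the gain from pushing
  inwards. Endpoints are left out because formulas for the controls hold only inside a step, and
  they are null sets.\<close>

lemma integral_le_affine_indicator:
  fixes f :: "real \<Rightarrow> real"
  assumes f: "set_integrable lebesgue {a..t} f" and "a \<le> t"
    and E: "E \<in> sets lebesgue" "E \<subseteq> {a..t}"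
    and le: "\<And>s. a < s \<Longrightarrow> s < t \<Longrightarrow> f s \<le> p + q * indicator E s"
  shows "integral {a..t} f \<le> p * (t - a) + q * measure lebesgue E"
proof -
  have finE: "E \<in> lmeasurable"
    using E by (meson bounded_closed_interval bounded_set_imp_lmeasurable bounded_subset)
  have i1: "integrable lebesgue (\<lambda>s. q * indicator E s :: real)"
    using finE by (intro integrable_mult_right integrable_real_indicator) (auto simp: fmeasurable_def)
  have i2: "integrable lebesgue (\<lambda>s. p * indicator {a..t} s :: real)"
    by (intro integrable_mult_right integrable_real_indicator) (auto simp: emeasure_lborel_Icc_eq)
  have ae: "AE s in lebesgue. s \<noteq> r" for r :: real
    by (intro AE_completion AE_lborel_singleton)
  have "integral {a..t} f = (LINT s:{a..t}|lebesgue. f s)"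
    using set_lebesgue_integral_eq_integral(2)[OF f] by simp
  also have "\<dots> = (LINT s|lebesgue. indicator {a..t} s *\<^sub>R f s)"
    by (simp add: set_lebesgue_integral_def)
  also have "\<dots> \<le> (LINT s|lebesgue. p * indicator {a..t} s + q * indicator E s)"
  proof (rule integral_mono_AE)
    show "integrable lebesgue (\<lambda>s. indicator {a..t} s *\<^sub>R f s)"
      using f by (simp add: set_integrable_def)
    show "integrable lebesgue (\<lambda>s. p * indicator {a..t} s + q * indicator E s)"
      using i1 i2 by auto
    show "AE s in lebesgue. indicator {a..t} s *\<^sub>R f s \<le> p * indicator {a..t} s + q * indicator E s"
      using ae[of a] ae[of t]
    proof eventually_elim
      case (elim s)
      show ?case
        using le[of s] elim E(2) by (auto simp: indicator_def split: if_splits)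
    qed
  qed
  also have "\<dots> = p * (t - a) + q * measure lebesgue E"
    using i1 i2 finE \<open>a \<le> t\<close> by (subst Bochner_Integration.integral_add) auto
  finally show ?thesis .
qed

lemma norm_integral_le_affine_indicator:
  fixes f :: "real \<Rightarrow> 'a::euclidean_space"
  assumes f: "set_integrable lebesgue {a..t} f" and "a \<le> t"
    and E: "E \<in> sets lebesgue" "E \<subseteq> {a..t}"
    and le: "\<And>s. a < s \<Longrightarrow> s < t \<Longrightarrow> norm (f s) \<le> p + q * indicator E s"
  shows "norm (integral {a..t} f) \<le> p * (t - a) + q * measure lebesgue E"
proof -
  have n: "set_integrable lebesgue {a..t} (\<lambda>s. norm (f s))"
    using f by (rule absolutely_integrable_norm[unfolded comp_def])
  have "norm (integral {a..t} f) \<le> integral {a..t} (\<lambda>s. norm (f s))"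
    using f n by (intro integral_norm_bound_integral set_lebesgue_integral_eq_integral) auto
  also have "\<dots> \<le> p * (t - a) + q * measure lebesgue E"
    by (rule integral_le_affine_indicator[OF n assms(2) E le])
  finally show ?thesis .
qed

lemma norm_integral_le_const:
  fixes f :: "real \<Rightarrow> 'a::euclidean_space"
  assumes "set_integrable lebesgue {a..t} f" "a \<le> t" "\<And>s. a < s \<Longrightarrow> s < t \<Longrightarrow> norm (f s) \<le> p"
  shows "norm (integral {a..t} f) \<le> p * (t - a)"
  using norm_integral_le_affine_indicator[OF assms(1,2), of "{}" p 0] assms(3) by simp

lemma inner_integral_le_affine_indicator:
  fixes f :: "real \<Rightarrow> 'a::euclidean_space"
  assumes f: "set_integrable lebesgue {a..t} f" and "a \<le> t"
    and E: "E \<in> sets lebesgue" "E \<subseteq> {a..t}"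
    and le: "\<And>s. a < s \<Longrightarrow> s < t \<Longrightarrow> v \<bullet> f s \<le> p + q * indicator E s"
  shows "v \<bullet> integral {a..t} f \<le> p * (t - a) + q * measure lebesgue E"
proof -
  have "v \<bullet> integral {a..t} f = integral {a..t} ((\<lambda>w. v \<bullet> w) \<circ> f)"
    by (rule integral_linear[OF set_lebesgue_integral_eq_integral(1)[OF f] bounded_linear_inner_right, symmetric])
  also have "\<dots> \<le> p * (t - a) + q * measure lebesgue E"
    using le by (intro integral_le_affine_indicator[OF absolutely_integrable_linear[OF f bounded_linear_inner_right] assms(2) E]) auto
  finally show ?thesis .
qed

lemma inner_integral_le_const:
  fixes f :: "real \<Rightarrow> 'a::euclidean_space"
  assumes "set_integrable lebesgue {a..t} f" "a \<le> t" "\<And>s. a < s \<Longrightarrow> s < t \<Longrightarrow> v \<bullet> f s \<le> p"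
  shows "v \<bullet> integral {a..t} f \<le> p * (t - a)"
  using inner_integral_le_affine_indicator[OF assms(1,2), of "{}" v p 0] assms(3) by simp

section \<open>Existence, stability and causality of the trajectories of one player\<close>

locale controlled_system =
  fixes C :: "'c::euclidean_space set" and h :: "'x::euclidean_space \<Rightarrow> 'c \<Rightarrow> 'x" and M L :: real
  assumes cont: "continuous_on (UNIV \<times> C) (\<lambda>(x, a). h x a)"
    and M_pos: "M > 0" and h_bound: "\<And>x a. a \<in> C \<Longrightarrow> norm (h x a) \<le> M"
    and L_pos: "L > 0" and h_lip: "\<And>x y a. a \<in> C \<Longrightarrow> norm (h x a - h y a) \<le> L * norm (x - y)"
begin

lemma controls_in: "u \<in> controls C \<Longrightarrow> 0 \<le> s \<Longrightarrow> u s \<in> C"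
  by (auto simp: controls_def PiE_def Pi_def)

lemma rhs_measurable:
  assumes u: "u \<in> controls C" and Z: "Z \<in> borel_measurable (lebesgue_on {0..})"
  shows "(\<lambda>s. h (Z s) (u s)) \<in> borel_measurable (lebesgue_on {0..})"
proof -
  have "(\<lambda>s. (case (Z s, u s) of (x, a) \<Rightarrow> h x a)) \<in> borel_measurable (lebesgue_on {0..})"
  proof (rule measurable_continuous_compose[OF cont])
    show "(\<lambda>s. (Z s, u s)) \<in> borel_measurable (lebesgue_on {0..})"
      using u Z by (auto simp: controls_def intro!: borel_measurable_Pair)
  qed (use controls_in[OF u] in auto)
  then show ?thesis by simp
qed

lemma rhs_integrable:
  assumes "u \<in> controls C" "Z \<in> borel_measurable (lebesgue_on {0..})" "0 \<le> a"
  shows "set_integrable lebesgue {a..b} (\<lambda>s. h (Z s) (u s))"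
  by (rule set_integrable_bounded_interval[OF rhs_measurable[OF assms(1,2)] assms(3), of _ M])
    (use assms h_bound controls_in in auto)

lemma continuous_lebesgue_measurable:
  fixes Z :: "real \<Rightarrow> 'z::euclidean_space"
  shows "continuous_on {0..} Z \<Longrightarrow> Z \<in> borel_measurable (lebesgue_on {0..})"
  by (rule continuous_imp_measurable_on_sets_lebesgue) auto

text \<open>The conjugation with \<open>exp (2 * L * t)\<close> makes the integral operator of the differential equation
  a contraction for the supremum norm on the whole half-line.\<close>

definition picard :: "'x \<Rightarrow> (real \<Rightarrow> 'c) \<Rightarrow> (real \<Rightarrow> 'x) \<Rightarrow> real \<Rightarrow> 'x" where
  "picard z u w t = exp (- 2 * L * max 0 t) *\<^sub>R
     integral {0..max 0 t} (\<lambda>s. h (z + exp (2 * L * s) *\<^sub>R w s) (u s))"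

lemma picard_bcontfun:
  assumes u: "u \<in> controls C" and w: "continuous_on UNIV w"
  shows "picard z u w \<in> bcontfun"
proof (rule bcontfun_normI[where b = "M / (2 * L)"])
  let ?f = "\<lambda>s. h (z + exp (2 * L * s) *\<^sub>R w s) (u s)"
  have mw: "(\<lambda>s. z + exp (2 * L * s) *\<^sub>R w s) \<in> borel_measurable (lebesgue_on {0..})"
    by (intro continuous_lebesgue_measurable continuous_intros continuous_on_subset[OF w]) auto
  have int: "set_integrable lebesgue {0..b} ?f" for b
    by (rule rhs_integrable[OF u mw]) simp
  show "norm (picard z u w t) \<le> M / (2 * L)" for t
  proof -
    define r where "r = max 0 t"
    have r: "r \<ge> 0" by (simp add: r_def)
    have "norm (integral {0..r} ?f) \<le> M * (r - 0)"
      by (rule norm_integral_le_const[OF int]) (use r u h_bound controls_in in auto)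
    then have "norm (picard z u w t) \<le> exp (- 2 * L * r) * (M * r)"
      by (auto simp: picard_def r_def[symmetric] intro!: mult_left_mono)
    \<comment> \<open>This isolates w * exp (- w) with w = 2 L r, which is at most 1.\<close>
    also have "\<dots> = M / (2 * L) * (2 * L * r * exp (- (2 * L * r)))"
      using L_pos by (simp add: field_simps)
    also have "\<dots> \<le> M / (2 * L) * 1"
    proof (rule mult_left_mono)
      have "2 * L * r \<le> exp (2 * L * r)"
        using exp_ge_add_one_self[of "2 * L * r"] by linarith
      then show "2 * L * r * exp (- (2 * L * r)) \<le> 1"
        by (simp add: exp_minus divide_simps)
    qed (use M_pos L_pos in auto)
    finally show ?thesis by simp
  qed
  have F: "continuous_on {0..} (\<lambda>r. integral {0..r} ?f)"
  proof -
    have c: "continuous_on {0..b} (\<lambda>r. integral {0..r} ?f)" for b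
      by (rule indefinite_integral_continuous_1) (rule set_lebesgue_integral_eq_integral[OF int])
    have "continuous_on {0..<b} (\<lambda>r. integral {0..r} ?f)" for b
      by (rule continuous_on_subset[OF c[of b]]) auto
    then have *: "continuous (at r within {0..}) (\<lambda>r. integral {0..r} ?f)" if "r \<ge> 0" for r
    proof -
      have "continuous (at r within {0..<r+1}) (\<lambda>r. integral {0..r} ?f)"
        using \<open>continuous_on {0..<r+1} _\<close> that by (auto simp: continuous_on_eq_continuous_within)
      moreover have "at r within {0..<r+1} = at r within {0..}"
        by (rule at_within_nhd[of _ "{..<r+1}"]) auto
      ultimately show ?thesis by simp
    qed
    then show ?thesis by (auto simp: continuous_on_eq_continuous_within)
  qed
  have "continuous_on UNIV (\<lambda>t. integral {0..max 0 t} ?f)"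
    by (rule continuous_on_compose2[OF F, of _ "\<lambda>t. max 0 t"]) (auto intro!: continuous_intros)
  then show "continuous_on UNIV (picard z u w)"
    unfolding picard_def by (intro continuous_intros) 
qed

text \<open>The integrands differ by at most L d exp (2 L s), whose integral is below d exp (2 L r)
  / 2, and the prefactor of \<open>picard\<close> cancels the exponential. The exponent 2 L instead
  of L produces the factor 1/2.\<close>

lemma picard_contraction:
  assumes u: "u \<in> controls C" and w: "continuous_on UNIV w1" "continuous_on UNIV w2"
    and d: "\<And>s. norm (w1 s - w2 s) \<le> d"
  shows "norm (picard z u w1 t - picard z u w2 t) \<le> d / 2"
proof -
  define f where "f w s = h (z + exp (2 * L * s) *\<^sub>R w s) (u s)" for w s
  define r where "r = max 0 t"
  have r: "r \<ge> 0" by (simp add: r_def)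
  have d0: "d \<ge> 0" using d[of 0] norm_ge_zero order_trans by blast
  have int: "set_integrable lebesgue {0..b} (f w)" if "continuous_on UNIV w" for b w
    unfolding f_def
    by (rule rhs_integrable[OF u])
      (auto intro!: continuous_lebesgue_measurable continuous_intros continuous_on_subset[OF that])
  have hi: "((\<lambda>s. L * d * exp (2 * L * s)) has_integral (d / 2 * exp (2 * L * r) - d / 2 * exp (2 * L * 0))) {0..r}"
    using r L_pos by (intro fundamental_theorem_of_calculus)
      (auto intro!: derivative_eq_intros simp: has_real_derivative_iff_has_vector_derivative[symmetric])
  have "norm (integral {0..r} (f w1) - integral {0..r} (f w2)) = norm (integral {0..r} (\<lambda>s. f w1 s - f w2 s))"
    using int w by (subst Henstock_Kurzweil_Integration.integral_diff) (auto intro: set_lebesgue_integral_eq_integral)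
  also have "\<dots> \<le> integral {0..r} (\<lambda>s. L * d * exp (2 * L * s))"
  proof (rule integral_norm_bound_integral)
    show "(\<lambda>s. f w1 s - f w2 s) integrable_on {0..r}"
      using int w by (intro integrable_diff set_lebesgue_integral_eq_integral) auto
    show "(\<lambda>s. L * d * exp (2 * L * s)) integrable_on {0..r}" using hi by blast
    fix s assume s: "s \<in> {0..r}"
    have "norm (f w1 s - f w2 s) \<le> L * norm ((z + exp (2 * L * s) *\<^sub>R w1 s) - (z + exp (2 * L * s) *\<^sub>R w2 s))"
      unfolding f_def using s u by (intro h_lip controls_in) auto
    also have "\<dots> = L * (exp (2 * L * s) * norm (w1 s - w2 s))"
      by (simp add: scaleR_diff_right[symmetric])
    also have "\<dots> \<le> L * (exp (2 * L * s) * d)"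
      using L_pos d by (intro mult_left_mono) auto
    finally show "norm (f w1 s - f w2 s) \<le> L * d * exp (2 * L * s)" by (simp add: mult_ac)
  qed
  also have "\<dots> = d / 2 * exp (2 * L * r) - d / 2"
    using integral_unique[OF hi] by simp
  finally have *: "norm (integral {0..r} (f w1) - integral {0..r} (f w2)) \<le> d / 2 * exp (2 * L * r)"
    using d0 by linarith
  have "picard z u w1 t - picard z u w2 t =
      exp (- 2 * L * r) *\<^sub>R (integral {0..r} (f w1) - integral {0..r} (f w2))"
    by (simp add: picard_def r_def f_def[abs_def] scaleR_diff_right)
  then have "norm (picard z u w1 t - picard z u w2 t) \<le> exp (- 2 * L * r) * (d / 2 * exp (2 * L * r))"
    using * by (auto intro!: mult_left_mono)
  also have "\<dots> = d / 2" by (simp add: exp_minus)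
  finally show ?thesis .
qed

lemma ex_solution:
  assumes u: "u \<in> controls C"
  shows "\<exists>Z. solves_controlled_ode h z u Z"
proof -
  define \<Phi> :: "(real \<Rightarrow>\<^sub>C 'x) \<Rightarrow> (real \<Rightarrow>\<^sub>C 'x)" where "\<Phi> w = Bcontfun (picard z u (apply_bcontfun w))" for w
  have \<Phi>: "apply_bcontfun (\<Phi> w) = picard z u (apply_bcontfun w)" for w
    unfolding \<Phi>_def by (intro Bcontfun_inverse picard_bcontfun[OF u]) auto
  have "dist (\<Phi> v) (\<Phi> w) \<le> 1/2 * dist v w" for v w
  proof (rule dist_bound)
    fix t
    have "norm (picard z u (apply_bcontfun v) t - picard z u (apply_bcontfun w) t) \<le> dist v w / 2"
      by (rule picard_contraction[OF u]) (auto simp: dist_norm[symmetric] dist_bounded)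
    then show "dist (apply_bcontfun (\<Phi> v) t) (apply_bcontfun (\<Phi> w) t) \<le> 1/2 * dist v w"
      by (simp add: \<Phi> dist_norm)
  qed
  then obtain w where w: "\<Phi> w = w"
    using banach_fix_type[of "1/2" \<Phi>] by auto
  define W where "W = apply_bcontfun w"
  have W: "picard z u W = W" using \<Phi>[of w] w by (simp add: W_def)
  have cW: "continuous_on S W" for S by (simp add: W_def)
  \<comment> \<open>Undoing the conjugation turns the fixed point into a solution.\<close>
  define Z where "Z s = z + exp (2 * L * s) *\<^sub>R W s" for s
  have cZ: "continuous_on {0..} Z"
    unfolding Z_def by (intro continuous_intros cW)
  have "set_integrable lebesgue {0..t} (\<lambda>s. h (Z s) (u s)) \<and>
      Z t = z + (LINT s:{0..t}|lebesgue. h (Z s) (u s))" if "t \<ge> 0" for t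
  proof
    show int: "set_integrable lebesgue {0..t} (\<lambda>s. h (Z s) (u s))"
      by (rule rhs_integrable[OF u continuous_lebesgue_measurable[OF cZ]]) simp
    have "W t = exp (- 2 * L * t) *\<^sub>R integral {0..t} (\<lambda>s. h (Z s) (u s))"
      using fun_cong[OF W, of t] that by (simp add: picard_def Z_def)
    then have "exp (2 * L * t) *\<^sub>R W t = integral {0..t} (\<lambda>s. h (Z s) (u s))"
      by (simp add: exp_minus)
    then show "Z t = z + (LINT s:{0..t}|lebesgue. h (Z s) (u s))"
      using set_lebesgue_integral_eq_integral(2)[OF int] by (simp add: Z_def[of t])
  qed
  then show ?thesis using cZ by (auto simp: solves_controlled_ode_def)
qed

lemma trajectory_solves:
  "u \<in> controls C \<Longrightarrow> solves_controlled_ode h z u (trajectory h z u)"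
  unfolding trajectory_def by (rule someI_ex[OF ex_solution])

lemma trajectory_cont: "u \<in> controls C \<Longrightarrow> continuous_on {0..} (trajectory h z u)"
  using trajectory_solves by (auto simp: solves_controlled_ode_def)

lemma trajectory_measurable:
  "u \<in> controls C \<Longrightarrow> trajectory h z u \<in> borel_measurable (lebesgue_on {0..})"
  by (intro continuous_lebesgue_measurable trajectory_cont)

lemma trajectory_integrable:
  "u \<in> controls C \<Longrightarrow> 0 \<le> a \<Longrightarrow> set_integrable lebesgue {a..b} (\<lambda>s. h (trajectory h z u s) (u s))"
  by (intro rhs_integrable trajectory_measurable)

lemma trajectory_0: "u \<in> controls C \<Longrightarrow> trajectory h z u 0 = z"
proof -
  assume u: "u \<in> controls C"
  have "trajectory h z u 0 = z + (LINT s:{0..0}|lebesgue. h (trajectory h z u s) (u s))"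
    using trajectory_solves[OF u, of z] unfolding solves_controlled_ode_def by auto
  also have "\<dots> = z"
    using set_lebesgue_integral_eq_integral(2)[OF trajectory_integrable[OF u, where a=0 and b=0 and z=z]] by simp
  finally show ?thesis .
qed

lemma trajectory_increment:
  assumes u: "u \<in> controls C" and "0 \<le> a" "a \<le> t"
  shows "trajectory h z u t - trajectory h z u a = integral {a..t} (\<lambda>s. h (trajectory h z u s) (u s))"
proof -
  let ?f = "\<lambda>s. h (trajectory h z u s) (u s)"
  have eq: "trajectory h z u r = z + integral {0..r} ?f" if "r \<ge> 0" for r
  proof -
    have "trajectory h z u r = z + (LINT s:{0..r}|lebesgue. ?f s)"
      using trajectory_solves[OF u, of z] that unfolding solves_controlled_ode_def by blast
    then show ?thesis
      by (simp only: set_lebesgue_integral_eq_integral(2)[OF trajectory_integrable[OF u order_refl]])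
  qed
  have "integral {0..a} ?f + integral {a..t} ?f = integral {0..t} ?f"
    using assms set_lebesgue_integral_eq_integral(1)[OF trajectory_integrable[OF u, where a=0 and b=t and z=z]]
    by (intro Henstock_Kurzweil_Integration.integral_combine) auto
  then show ?thesis using eq[of t] eq[of a] assms by (simp add: algebra_simps)
qed

lemma trajectory_lip:
  assumes u: "u \<in> controls C" and "0 \<le> a" "a \<le> t"
  shows "norm (trajectory h z u t - trajectory h z u a) \<le> M * (t - a)"
proof -
  have "norm (integral {a..t} (\<lambda>s. h (trajectory h z u s) (u s))) \<le> M * (t - a)"
    using assms h_bound controls_in
    by (intro norm_integral_le_const[OF trajectory_integrable[OF u]]) auto
  then show ?thesis using trajectory_increment[OF assms] by simp
qed

lemma trajectory_diff_increment:
  assumes u: "u1 \<in> controls C" "u2 \<in> controls C" and "0 \<le> a" "a \<le> t"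
  shows "(trajectory h z1 u1 t - trajectory h z2 u2 t) - (trajectory h z1 u1 a - trajectory h z2 u2 a)
    = integral {a..t} (\<lambda>s. h (trajectory h z1 u1 s) (u1 s) - h (trajectory h z2 u2 s) (u2 s))"
proof -
  note i1 = set_lebesgue_integral_eq_integral(1)[OF trajectory_integrable[OF u(1) assms(3), where b = t and z = z1]]
  note i2 = set_lebesgue_integral_eq_integral(1)[OF trajectory_integrable[OF u(2) assms(3), where b = t and z = z2]]
  show ?thesis
    unfolding Henstock_Kurzweil_Integration.integral_diff[OF i1 i2]
      trajectory_increment[OF u(1) assms(3,4), symmetric] trajectory_increment[OF u(2) assms(3,4), symmetric]
    by (simp add: algebra_simps)
qed

lemma trajectory_diff_integrable:
  assumes u: "u1 \<in> controls C" "u2 \<in> controls C" and "0 \<le> a"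
  shows "set_integrable lebesgue {a..t} (\<lambda>s. h (trajectory h z1 u1 s) (u1 s) - h (trajectory h z2 u2 s) (u2 s))"
  by (intro set_integral_diff trajectory_integrable assms)

text \<open>This replaces Gronwall's inequality: let m be the largest distance on the interval. On
  so short an interval the Lipschitz term contributes at most m / 2 to it and is absorbed on the
  left. Controls that differ contribute at most 2 M per unit of measure.\<close>

lemma trajectory_deviation:
  assumes u: "u1 \<in> controls C" "u2 \<in> controls C" and at: "0 \<le> a" "a \<le> t" "L * (t - a) \<le> 1 / 2"
    and E: "E \<in> sets lebesgue" "E \<subseteq> {a..t}" "\<And>s. a \<le> s \<Longrightarrow> s < t \<Longrightarrow> s \<notin> E \<Longrightarrow> u1 s = u2 s"
    and s: "a \<le> s" "s \<le> t"
  shows "norm (trajectory h z1 u1 s - trajectory h z2 u2 s) \<le>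
     2 * (norm (trajectory h z1 u1 a - trajectory h z2 u2 a) + 2 * M * measure lebesgue E)"
proof -
  define Z1 where "Z1 = trajectory h z1 u1"
  define Z2 where "Z2 = trajectory h z2 u2"
  have c: "continuous_on {a..t} (\<lambda>s. norm (Z1 s - Z2 s))"
    unfolding Z1_def Z2_def
    by (intro continuous_intros continuous_on_subset[OF trajectory_cont] u) (use at in auto)
  obtain r where r: "r \<in> {a..t}" and rmax: "\<And>s. s \<in> {a..t} \<Longrightarrow> norm (Z1 s - Z2 s) \<le> norm (Z1 r - Z2 r)"
    using continuous_attains_sup[OF _ _ c] at by auto
  define m where "m = norm (Z1 r - Z2 r)"
  define F where "F = E \<inter> {a..r}"
  have fE: "E \<in> lmeasurable"
    using E(1,2) by (meson bounded_closed_interval bounded_set_imp_lmeasurable bounded_subset)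
  have F: "F \<in> sets lebesgue" "F \<subseteq> {a..r}" "measure lebesgue F \<le> measure lebesgue E"
    unfolding F_def using E fE by (auto intro!: measure_mono_fmeasurable)
  have m0: "m \<ge> 0" by (simp add: m_def)
  have "norm ((Z1 r - Z2 r) - (Z1 a - Z2 a)) \<le> (L * m) * (r - a) + (2 * M) * measure lebesgue F"
    unfolding Z1_def Z2_def
  proof (subst trajectory_diff_increment[OF u at(1)], use r in simp,
      rule norm_integral_le_affine_indicator[OF trajectory_diff_integrable[OF u at(1)] _ F(1,2)])
    fix s assume s: "a < s" "s < r"
    note us = controls_in[OF u(1), of s] controls_in[OF u(2), of s]
    show "norm (h (trajectory h z1 u1 s) (u1 s) - h (trajectory h z2 u2 s) (u2 s))
      \<le> L * m + 2 * M * indicator F s"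
    proof (cases "s \<in> F")
      case True
      have "norm (h (trajectory h z1 u1 s) (u1 s) - h (trajectory h z2 u2 s) (u2 s)) \<le> M + M"
        by (rule order_trans[OF norm_triangle_ineq4 add_mono])
          (use us s at in \<open>auto intro!: h_bound\<close>)
      then show ?thesis using True mult_nonneg_nonneg[OF less_imp_le[OF L_pos] m0] by simp
    next
      case False
      then have "u1 s = u2 s" using E(3)[of s] s r by (auto simp: F_def)
      then have "norm (h (trajectory h z1 u1 s) (u1 s) - h (trajectory h z2 u2 s) (u2 s))
        \<le> L * norm (Z1 s - Z2 s)"
        using us s at h_lip by (auto simp: Z1_def Z2_def)
      also have "\<dots> \<le> L * m"
        using rmax[of s] s r L_pos by (intro mult_left_mono) (auto simp: m_def)
      finally show ?thesis using False by simp
    qed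
  qed (use r in auto)
  also have "\<dots> \<le> 1/2 * m + 2 * M * measure lebesgue E"
  proof (rule add_mono)
    have "L * (r - a) \<le> 1/2" using r at(3) L_pos
      by (smt (verit) atLeastAtMost_iff mult_left_mono)
    from mult_right_mono[OF this m0] show "L * m * (r - a) \<le> 1/2 * m"
      by (simp add: mult_ac)
  qed (use F(3) M_pos in auto)
  finally have "m - norm (Z1 a - Z2 a) \<le> 1/2 * m + 2 * M * measure lebesgue E"
    using norm_triangle_ineq2[of "Z1 r - Z2 r" "Z1 a - Z2 a"] by (simp add: m_def)
  then have "m \<le> 2 * (norm (Z1 a - Z2 a) + 2 * M * measure lebesgue E)" by simp
  then show ?thesis using rmax[of s] s by (simp add: m_def Z1_def Z2_def)
qed

text \<open>Uniqueness and causality at once: each step of length 1 / (2 L) is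
  \<open>trajectory_deviation\<close> with a null exceptional set. As \<open>trajectory\<close>
  picks a solution separately for each control, this is what makes quantities computed from
  trajectories non-anticipating.\<close>

lemma trajectory_cong:
  assumes u: "u1 \<in> controls C" "u2 \<in> controls C" and eq: "ae_eq_upto T u1 u2"
    and s: "0 \<le> s" "s \<le> T"
  shows "trajectory h z u1 s = trajectory h z u2 s"
proof -
  obtain N where N: "\<And>s. s \<in> space lebesgue - N \<Longrightarrow> s \<in> {0..T} \<longrightarrow> u1 s = u2 s" "N \<in> null_sets lebesgue"
    using AE_E3[OF eq[unfolded ae_eq_upto_def]] by blast
  define r where "r = 1 / (2 * L)"
  have r: "r > 0" "L * r = 1/2" using L_pos by (auto simp: r_def)
  have "\<forall>s. 0 \<le> s \<longrightarrow> s \<le> T \<longrightarrow> s \<le> real n * r \<longrightarrow> trajectory h z u1 s = trajectory h z u2 s" for n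
  proof (induction n)
    case 0
    then show ?case using trajectory_0[OF u(1)] trajectory_0[OF u(2)] by force
  next
    case (Suc n)
    show ?case
    proof (intro allI impI)
      fix s assume s: "0 \<le> s" "s \<le> T" "s \<le> real (Suc n) * r"
      define a where "a = min s (real n * r)"
      have a: "0 \<le> a" "a \<le> s" "a \<le> T" "a \<le> real n * r" "s - a \<le> r"
        using s r by (auto simp: a_def algebra_simps min_def)
      have null: "N \<inter> {a..s} \<in> null_sets lebesgue"
        by (rule null_set_Int2[OF N(2)]) auto
      have "norm (trajectory h z u1 s - trajectory h z u2 s) \<le>
        2 * (norm (trajectory h z u1 a - trajectory h z u2 a) + 2 * M * measure lebesgue (N \<inter> {a..s}))"
      proof (rule trajectory_deviation[OF u a(1,2)])
        show "L * (s - a) \<le> 1/2"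
          using mult_left_mono[OF a(5), of L] L_pos r by simp
        show "\<And>r. a \<le> r \<Longrightarrow> r < s \<Longrightarrow> r \<notin> N \<inter> {a..s} \<Longrightarrow> u1 r = u2 r"
          using N(1) a s by auto
      qed (use null a in auto)
      moreover have "trajectory h z u1 a = trajectory h z u2 a"
        using Suc a by auto
      moreover have "measure lebesgue (N \<inter> {a..s}) = 0"
        using null by (simp add: measure_eq_0_null_sets)
      ultimately show "trajectory h z u1 s = trajectory h z u2 s" by simp
    qed
  qed
  moreover obtain n :: nat where "s / r \<le> real n" using real_arch_simple by blast
  then have "s \<le> real n * r" using r by (simp add: divide_le_eq)
  ultimately show ?thesis using s by blast
qed

end

section \<open>Boundary charts\<close>

text \<open>The part of \<open>U\<close> where \<phi> is positive is open and misses \<Omega>, hence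
  it misses the closure too.\<close>

lemma defining_function_closure_nonpos:
  assumes d: "C2_defining_function \<Omega> U \<phi> G" and x: "x \<in> closure \<Omega>" "x \<in> U"
  shows "\<phi> x \<le> 0"
proof (rule ccontr)
  assume "\<not> \<phi> x \<le> 0"
  have U: "open U" "\<Omega> \<inter> U = {z \<in> U. \<phi> z < 0}"
    and g: "\<And>z. z \<in> U \<Longrightarrow> GDERIV \<phi> z :> G z"
    using d by (auto simp: C2_defining_function_def)
  have "continuous_on U \<phi>"
    using g by (intro continuous_at_imp_continuous_on) (auto intro!: has_derivative_continuous simp: gderiv_def)
  then have "open {z \<in> U. 0 < \<phi> z}"
    using continuous_open_preimage[of U \<phi> "{0<..}"] U by (auto simp: vimage_def Collect_conj_eq)
  moreover have "{z \<in> U. 0 < \<phi> z} \<inter> \<Omega> = {}"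
    using U by force
  ultimately have "{z \<in> U. 0 < \<phi> z} \<inter> closure \<Omega> = {}"
    by (simp add: open_Int_closure_eq_empty)
  then show False using x \<open>\<not> \<phi> x \<le> 0\<close> by auto
qed

lemma defining_function_directional:
  assumes "C2_defining_function \<Omega> U \<phi> G" "x \<in> U"
  shows "((\<lambda>t::real. \<phi> (x + t *\<^sub>R v)) has_real_derivative (v \<bullet> G x)) (at 0)"
proof -
  have "(\<phi> has_derivative (\<lambda>d. d \<bullet> G x)) (at x)"
    using assms by (auto simp: C2_defining_function_def gderiv_def)
  then have "(\<phi> has_derivative (\<lambda>d. d \<bullet> G x)) (at (x + (0::real) *\<^sub>R v))" by simp
  moreover have "((\<lambda>t::real. x + t *\<^sub>R v) has_derivative (\<lambda>t. t *\<^sub>R v)) (at 0)"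
    by (auto intro!: derivative_eq_intros)
  ultimately have "(\<phi> \<circ> (\<lambda>t::real. x + t *\<^sub>R v) has_derivative (\<lambda>d. d \<bullet> G x) \<circ> (\<lambda>t. t *\<^sub>R v)) (at 0)"
    by (intro diff_chain_at) auto
  then show ?thesis
    by (simp add: has_field_derivative_def o_def mult.commute[of _ "v \<bullet> G x"])
qed

text \<open>Were the normalised gradients different, moving along their difference would decrease one
  defining function and increase the other.\<close>

lemma defining_function_unique_normal:
  assumes "open \<Omega>" and x: "x \<in> frontier \<Omega>"
    and d1: "C2_defining_function \<Omega> U1 \<phi>1 G1" "x \<in> U1"
    and d2: "C2_defining_function \<Omega> U2 \<phi>2 G2" "x \<in> U2"
  shows "G1 x /\<^sub>R norm (G1 x) = G2 x /\<^sub>R norm (G2 x)"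
proof (rule ccontr)
  assume ne: "\<not> ?thesis"
  define n1 where "n1 = G1 x /\<^sub>R norm (G1 x)"
  define n2 where "n2 = G2 x /\<^sub>R norm (G2 x)"
  define v where "v = n2 - n1"
  have G0: "G1 x \<noteq> 0" "G2 x \<noteq> 0" using d1 d2 by (auto simp: C2_defining_function_def)
  have n: "norm n1 = 1" "norm n2 = 1" using G0 by (auto simp: n1_def n2_def)
  have G: "G1 x = norm (G1 x) *\<^sub>R n1" "G2 x = norm (G2 x) *\<^sub>R n2" using G0 by (auto simp: n1_def n2_def)
  have "n1 \<noteq> n2" using ne by (simp add: n1_def n2_def)
  \<comment> \<open>Different unit vectors have inner product below 1; this fixes the sign of both
    slopes along \<open>v\<close>.\<close>
  then have "0 < norm (n2 - n1) ^ 2" by simp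
  also have "norm (n2 - n1) ^ 2 = 2 - 2 * (n1 \<bullet> n2)"
    using n unfolding power2_norm_eq_inner
    by (simp add: inner_diff inner_commute[of n2 n1] norm_eq_1)
  finally have lt: "n1 \<bullet> n2 < 1" by linarith
  have "v \<bullet> G1 x = norm (G1 x) * (n1 \<bullet> n2 - 1)"
    by (subst G(1)) (use n in \<open>simp add: v_def inner_diff_left inner_commute[of n2 n1] norm_eq_1\<close>)
  then have neg: "v \<bullet> G1 x < 0" using G0 lt by (simp add: mult_pos_neg)
  have "v \<bullet> G2 x = norm (G2 x) * (1 - n1 \<bullet> n2)"
    by (subst G(2)) (use n in \<open>simp add: v_def inner_diff_left inner_commute[of n2 n1] norm_eq_1\<close>)
  then have pos: "v \<bullet> G2 x > 0" using G0 lt by simp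
  obtain e1 where e1: "e1 > 0" "\<And>t. 0 < t \<Longrightarrow> t < e1 \<Longrightarrow> \<phi>1 (x + t *\<^sub>R v) < \<phi>1 x"
    using DERIV_neg_dec_right[OF defining_function_directional[OF d1] neg] by auto
  obtain e2 where e2: "e2 > 0" "\<And>t. 0 < t \<Longrightarrow> t < e2 \<Longrightarrow> \<phi>2 (x + t *\<^sub>R v) > \<phi>2 x"
    using DERIV_pos_inc_right[OF defining_function_directional[OF d2] pos] by auto
  have "open (U1 \<inter> U2)" "x \<in> U1 \<inter> U2" using d1 d2 by (auto simp: C2_defining_function_def)
  then obtain r where r: "r > 0" "ball x r \<subseteq> U1 \<inter> U2" by (meson open_contains_ball)
  define q where "q = r / (norm v + 1)"
  have q: "q > 0" using r(1) by (simp add: q_def add_nonneg_pos)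
  define t where "t = min (min e1 e2) q / 2"
  have t: "0 < t" "t < e1" "t < e2" and tr: "t < r / (norm v + 1)"
    using e1(1) e2(1) q by (auto simp: t_def min_def q_def[symmetric])
  have "t * norm v < r"
  proof -
    have "t * norm v \<le> t * (norm v + 1)" using t by (simp add: algebra_simps)
    also have "\<dots> < r" using tr by (simp add: pos_less_divide_eq add_nonneg_pos)
    finally show ?thesis .
  qed
  then have "x + t *\<^sub>R v \<in> ball x r" using t by (simp add: dist_norm)
  then have inU: "x + t *\<^sub>R v \<in> U1" "x + t *\<^sub>R v \<in> U2" using r by auto
  have xcl: "x \<in> closure \<Omega>" and "x \<notin> \<Omega>"
    using x \<open>open \<Omega>\<close> by (auto simp: frontier_def interior_open)
  then have "\<phi>2 x \<ge> 0" using d2 by (force simp: C2_defining_function_def)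
  moreover have "\<phi>1 x \<le> 0" using defining_function_closure_nonpos[OF d1(1) xcl d1(2)] .
  ultimately have "\<phi>1 (x + t *\<^sub>R v) < 0" "\<not> \<phi>2 (x + t *\<^sub>R v) < 0"
    using e1(2)[OF t(1,2)] e2(2)[OF t(1,3)] by linarith+
  moreover have "x + t *\<^sub>R v \<in> \<Omega>" using calculation(1) inU d1(1) unfolding C2_defining_function_def by blast
  ultimately show False using inU d2(1) unfolding C2_defining_function_def by blast
qed

lemma outer_normal_eq:
  assumes "open \<Omega>" "x \<in> frontier \<Omega>" "C2_defining_function \<Omega> U \<phi> G" "x \<in> U"
  shows "outer_normal \<Omega> x = G x /\<^sub>R norm (G x)"
  unfolding outer_normal_def
proof (rule the_equality)
  fix \<nu> assume "\<exists>U \<phi> G. x \<in> U \<and> C2_defining_function \<Omega> U \<phi> G \<and> \<nu> = G x /\<^sub>R norm (G x)"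
  then show "\<nu> = G x /\<^sub>R norm (G x)"
    using defining_function_unique_normal[OF assms(1,2) _ _ assms(3,4)] by auto
qed (use assms in auto)

context controlled_system
begin

text \<open>Near a boundary point, \<open>\<Omega>\<close> is the sublevel set of a function \<open>\<phi>\<close> that is almost linear with
  slope \<open>v\<close>, the control \<open>a1\<close> pushes inwards and \<open>a2\<close> outwards, both with speed at least \<open>3 * c\<close>.\<close>

definition chart :: "'x set \<Rightarrow> 'x \<Rightarrow> real \<Rightarrow> 'x \<Rightarrow> ('x \<Rightarrow> real) \<Rightarrow> 'c \<Rightarrow> 'c \<Rightarrow> real \<Rightarrow> bool" where
  "chart \<Omega> x e v \<phi> a1 a2 c \<longleftrightarrow> a1 \<in> C \<and> a2 \<in> C \<and> norm v = 1 \<and> e \<le> c \<and> 2 * L * e \<le> c \<and>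
     (\<forall>y\<in>ball x e. \<forall>y'\<in>ball x e. \<bar>\<phi> y - \<phi> y' - v \<bullet> (y - y')\<bar> \<le> c / (16 * M) * norm (y - y')) \<and>
     (\<forall>y\<in>ball x e. y \<in> \<Omega> \<longleftrightarrow> \<phi> y < 0) \<and> (\<forall>y\<in>ball x e. y \<in> closure \<Omega> \<longrightarrow> \<phi> y \<le> 0) \<and>
     v \<bullet> h x a1 \<le> - (7 / 2 * c) \<and> 7 / 2 * c \<le> v \<bullet> h x a2"

lemma chart_mono: "chart \<Omega> x e v \<phi> a1 a2 c \<Longrightarrow> e' \<le> e \<Longrightarrow> chart \<Omega> x e' v \<phi> a1 a2 c"
proof -
  assume a: "chart \<Omega> x e v \<phi> a1 a2 c" "e' \<le> e"
  have "2 * L * e' \<le> 2 * L * e" using a(2) L_pos by simp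
  then show ?thesis using a subset_ball[OF a(2), of x] unfolding chart_def
    by (meson order_trans subsetD)
qed

text \<open>The condition 2 L e <= c of \<open>chart\<close> is made for this. Across the ball the
  margin 7/2 c at the centre shrinks to 3 c, and the threshold - c for bad controls moves by at most
  c / 2 either way.\<close>

lemma chart_speed:
  assumes c: "chart \<Omega> x e v \<phi> a1 a2 c" and "y \<in> ball x e" "a \<in> C"
  shows "\<bar>v \<bullet> h y a - v \<bullet> h x a\<bar> \<le> c / 2"
proof -
  have "\<bar>v \<bullet> (h y a - h x a)\<bar> \<le> norm v * norm (h y a - h x a)" by (rule Cauchy_Schwarz_ineq2)
  also have "\<dots> \<le> 1 * (L * norm (y - x))" using c assms(3) h_lip by (auto simp: chart_def)
  also have "\<dots> \<le> L * e" using assms(2) L_pos by (auto simp: dist_norm norm_minus_commute)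
  also have "\<dots> \<le> c / 2" using c by (simp add: chart_def)
  finally show ?thesis by (simp add: inner_diff_right)
qed

text \<open>All these charts share the function, the direction and the controls found at
  \<open>z\<close>; only the centre moves. The same \<open>r\<close> is the size of the
  neighbourhood and the chart radius, the form in which compactness can be applied.\<close>

lemma ex_chart_near:
  assumes "open \<Omega>" "C2_boundary \<Omega>" and z: "z \<in> frontier \<Omega>"
    and ctr: "a1 \<in> C" "a2 \<in> C" "h z a1 \<bullet> outer_normal \<Omega> z < 0" "h z a2 \<bullet> outer_normal \<Omega> z > 0"
  shows "\<exists>r>0. \<forall>x\<in>ball z r. \<exists>v \<phi> a1 a2 c. chart \<Omega> x r v \<phi> a1 a2 c"
proof -
  obtain U \<phi>0 G where zU: "z \<in> U" and d: "C2_defining_function \<Omega> U \<phi>0 G"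
    using assms(2) z unfolding C2_boundary_def by blast
  have U: "open U" "\<Omega> \<inter> U = {z \<in> U. \<phi>0 z < 0}"
    and g: "\<And>z. z \<in> U \<Longrightarrow> GDERIV \<phi>0 z :> G z" and n0: "G z \<noteq> 0"
    using d zU by (auto simp: C2_defining_function_def)
  have "continuous (at z) G"
    using d zU unfolding C2_defining_function_def by (auto intro: has_derivative_continuous)
  define n where "n = norm (G z)"
  have n: "n > 0" using n0 by (simp add: n_def)
  define v where "v = G z /\<^sub>R n"
  have v: "norm v = 1" using n by (simp add: v_def n_def)
  have on: "outer_normal \<Omega> z = v"
    using outer_normal_eq[OF assms(1) z d zU] by (simp add: v_def n_def)
  \<comment> \<open>Speed 4 c at \<open>z\<close> leaves 7/2 c at the centre \<open>x\<close> of a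
    nearby chart.\<close>
  define c where "c = min (- (v \<bullet> h z a1)) (v \<bullet> h z a2) / 4"
  have c: "c > 0" "v \<bullet> h z a1 \<le> - (4 * c)" "4 * c \<le> v \<bullet> h z a2"
    using ctr on by (auto simp: c_def inner_commute min_def)
  \<comment> \<open>Admissible oscillation of the normalised gradient; the mean value inequality
    turns it into the nonlinearity bound of \<open>chart\<close>.\<close>
  define \<eta> where "\<eta> = c / (16 * M)"
  have \<eta>: "\<eta> > 0" using c M_pos by (simp add: \<eta>_def)
  obtain \<rho>1 where \<rho>1: "\<rho>1 > 0" "\<And>y. dist y z < \<rho>1 \<Longrightarrow> dist (G y) (G z) < \<eta> * n"
    using \<open>continuous (at z) G\<close> \<eta> n unfolding continuous_at_eps_delta by (meson mult_pos_pos)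
  obtain \<rho>2 where \<rho>2: "\<rho>2 > 0" "ball z \<rho>2 \<subseteq> U" using U(1) zU by (meson open_contains_ball)
  define \<rho> where "\<rho> = min \<rho>1 \<rho>2"
  have \<rho>: "\<rho> > 0" "ball z \<rho> \<subseteq> U" "\<And>y. y \<in> ball z \<rho> \<Longrightarrow> norm (G y - G z) \<le> \<eta> * n"
    using \<rho>1 \<rho>2 by (auto simp: \<rho>_def dist_norm[symmetric] dist_commute less_imp_le subset_iff)
  define \<phi> where "\<phi> y = \<phi>0 y / n" for y
  have lin: "\<bar>\<phi> y - \<phi> y' - v \<bullet> (y - y')\<bar> \<le> \<eta> * norm (y - y')" if "y \<in> ball z \<rho>" "y' \<in> ball z \<rho>" for y y'
  proof -
    have "norm ((\<phi> y - v \<bullet> y) - (\<phi> y' - v \<bullet> y')) \<le> \<eta> * norm (y - y')"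
    proof (rule differentiable_bound[OF convex_ball _ _ that, where f' = "\<lambda>w d. d \<bullet> (G w /\<^sub>R n - v)"])
      fix w assume w: "w \<in> ball z \<rho>"
      have "(\<phi>0 has_derivative (\<lambda>d. d \<bullet> G w)) (at w within ball z \<rho>)"
        using g[of w] w \<rho>(2) unfolding gderiv_def by (blast intro: has_derivative_at_withinI)
      then show "((\<lambda>a. \<phi> a - v \<bullet> a) has_derivative (\<lambda>d. d \<bullet> (G w /\<^sub>R n - v))) (at w within ball z \<rho>)"
        unfolding \<phi>_def
        by (auto intro!: derivative_eq_intros simp: inner_diff_right inner_commute divide_inverse mult.commute)
      have "norm (d \<bullet> (G w /\<^sub>R n - v)) \<le> \<eta> * norm d" for d
      proof -
        have "G w /\<^sub>R n - v = (G w - G z) /\<^sub>R n" by (simp add: v_def scaleR_diff_right)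
        then have "norm (G w /\<^sub>R n - v) \<le> \<eta>"
          using \<rho>(3)[OF w] n by (simp add: divide_simps mult.commute)
        then have "norm d * norm (G w /\<^sub>R n - v) \<le> norm d * \<eta>"
          by (intro mult_left_mono) auto
        then show ?thesis
          using Cauchy_Schwarz_ineq2[of d "G w /\<^sub>R n - v"] by (simp add: mult.commute)
      qed
      then show "onorm (\<lambda>d. d \<bullet> (G w /\<^sub>R n - v)) \<le> \<eta>" using \<eta> by (intro onorm_bound) auto
    qed
    then show ?thesis by (simp add: inner_diff_right algebra_simps)
  qed
  define r where "r = min (\<rho> / 2) (min c (c / (2 * L)))"
  have r: "r > 0" "2 * r \<le> \<rho>" "r \<le> c" "2 * L * r \<le> c"
  proof -
    show "r > 0" "2 * r \<le> \<rho>" "r \<le> c" using \<rho> c L_pos by (auto simp: r_def)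
    have "r \<le> c / (2 * L)" by (simp add: r_def)
    then show "2 * L * r \<le> c" using L_pos by (simp add: pos_le_divide_eq mult.commute)
  qed
  have "chart \<Omega> x r v \<phi> a1 a2 c" if x: "x \<in> ball z r" for x
  proof -
    have sub: "y \<in> ball z \<rho>" if "y \<in> ball x r" for y
      using that x r(2) dist_triangle[of z y x] by auto
    have "\<bar>v \<bullet> (h x a - h z a)\<bar> \<le> c / 2" if "a \<in> C" for a
    proof -
      have "\<bar>v \<bullet> (h x a - h z a)\<bar> \<le> norm v * norm (h x a - h z a)" by (rule Cauchy_Schwarz_ineq2)
      also have "\<dots> \<le> L * norm (x - z)" using v that h_lip by auto
      also have "\<dots> \<le> L * r" using x L_pos by (auto simp: dist_norm norm_minus_commute)
      finally show ?thesis using r(4) by simp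
    qed
    from this[OF ctr(1)] this[OF ctr(2)] c(2,3)
    have "v \<bullet> h x a1 \<le> - (7 / 2 * c) \<and> 7 / 2 * c \<le> v \<bullet> h x a2"
      unfolding inner_diff_right by linarith
    moreover have "y \<in> \<Omega> \<longleftrightarrow> \<phi> y < 0" "y \<in> closure \<Omega> \<longrightarrow> \<phi> y \<le> 0" if "y \<in> ball x r" for y
    proof -
      have yU: "y \<in> U" using sub[OF that] \<rho>(2) by auto
      then show "y \<in> \<Omega> \<longleftrightarrow> \<phi> y < 0" using U(2) n by (auto simp: \<phi>_def divide_less_0_iff)
      show "y \<in> closure \<Omega> \<longrightarrow> \<phi> y \<le> 0"
        using defining_function_closure_nonpos[OF d _ yU] n by (auto simp: \<phi>_def divide_le_0_iff)
    qed
    ultimately show ?thesis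
      unfolding chart_def using ctr(1,2) v r(3,4) lin[OF sub sub] unfolding \<eta>_def by blast
  qed
  then show ?thesis using r(1) by blast
qed

text \<open>A Lebesgue number argument: the alternative is inherited by smaller radii, and near each
  point of \<open>K\<close> one radius works. The chart data vary with the point, but e does not,
  and through e <= c it is also a uniform lower bound for the pushing speed.\<close>

lemma uniform_charts:
  assumes "open \<Omega>" "C2_boundary \<Omega>" "compact K" "K \<subseteq> closure \<Omega>"
    and ctr: "\<And>z. z \<in> frontier \<Omega> \<Longrightarrow> \<exists>a1\<in>C. \<exists>a2\<in>C. h z a1 \<bullet> outer_normal \<Omega> z < 0 \<and> h z a2 \<bullet> outer_normal \<Omega> z > 0"
  shows "\<exists>e>0. \<forall>x\<in>K. ball x e \<subseteq> \<Omega> \<or> (\<exists>v \<phi> a1 a2 c. chart \<Omega> x e v \<phi> a1 a2 c)"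
proof -
  define Q where "Q x e \<longleftrightarrow> ball x e \<subseteq> \<Omega> \<or> (\<exists>v \<phi> a1 a2 c. chart \<Omega> x e v \<phi> a1 a2 c)" for x e
  have Qmono: "Q x e'" if "Q x e" "e' \<le> e" for x e e'
    using that chart_mono subset_ball[OF that(2), of x] unfolding Q_def by blast
  have "\<exists>r>0. \<forall>x\<in>ball z r. Q x r" if z: "z \<in> K" for z
  proof (cases "z \<in> \<Omega>")
    case True
    then obtain r where r: "r > 0" "ball z r \<subseteq> \<Omega>" using assms(1) by (meson open_contains_ball)
    have "ball x (r/2) \<subseteq> \<Omega>" if "x \<in> ball z (r/2)" for x
    proof
      fix y assume "y \<in> ball x (r/2)"
      then have "y \<in> ball z r" using that dist_triangle[of z y x] by auto
      then show "y \<in> \<Omega>" using r by auto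
    qed
    then show ?thesis using r(1) by (intro exI[of _ "r/2"]) (auto simp: Q_def)
  next
    case False
    then have "z \<in> frontier \<Omega>" using z assms by (auto simp: frontier_def interior_open)
    with ctr[OF this] show ?thesis using ex_chart_near[OF assms(1,2)] unfolding Q_def by meson
  qed
  then have "\<forall>z\<in>K. \<exists>r. r > 0 \<and> (\<forall>x\<in>ball z r. Q x r)" by blast
  from bchoice[OF this] obtain r where
    r: "\<And>z. z \<in> K \<Longrightarrow> r z > 0" "\<And>z x. z \<in> K \<Longrightarrow> x \<in> ball z (r z) \<Longrightarrow> Q x (r z)"
    by blast
  have "K \<subseteq> (\<Union>z\<in>K. ball z (r z))"
    using r(1) centre_in_ball by blast
  then obtain F where F: "F \<subseteq> K" "finite F" "K \<subseteq> (\<Union>z\<in>F. ball z (r z))"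
    using compactE_image[OF assms(3), of K "\<lambda>z. ball z (r z)"] open_ball by metis
  define e where "e = Min (insert 1 (r ` F))"
  have "e > 0" using F r(1) by (auto simp: e_def)
  moreover have "Q x e" if xK: "x \<in> K" for x
  proof -
    obtain z where z: "z \<in> F" "x \<in> ball z (r z)" using F xK by blast
    have "e \<le> r z" unfolding e_def using F z by (intro Min_le) auto
    then show ?thesis using Qmono[of x "r z" e] r(2) z F by auto
  qed
  ultimately show ?thesis unfolding Q_def by blast
qed

end

section \<open>Keeping a nearby trajectory inside\<close>

lemma measure_lebesgue_Int_diff:
  fixes N :: "real set"
  assumes N: "N \<in> sets lebesgue" and "0 \<le> a" "a \<le> t"
  shows "measure lebesgue (N \<inter> {0..t}) - measure lebesgue (N \<inter> {0..a}) = measure lebesgue (N \<inter> {a..<t})"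
proof -
  have l: "N \<inter> {r..s} \<in> lmeasurable" "N \<inter> {r<..s} \<in> lmeasurable" "N \<inter> {r..<s} \<in> lmeasurable" for r s
    by (intro bounded_set_imp_lmeasurable bounded_Int disjI2 sets.Int N; simp)+
  have "measure lebesgue (N \<inter> {0..t} - N \<inter> {0..a}) = measure lebesgue (N \<inter> {0..t}) - measure lebesgue (N \<inter> {0..a})"
    using assms(2,3) by (intro measure_Diff) (use l(1)[of 0 t] l(1)[of 0 a] in \<open>auto simp: fmeasurable_def\<close>)
  moreover have "measure lebesgue (N \<inter> {0..t} - N \<inter> {0..a}) = measure lebesgue (N \<inter> {a..<t})"
  proof (rule measure_eq_AE)
    have "AE s in lebesgue. s \<noteq> r" for r :: real
      by (intro AE_completion AE_lborel_singleton)
    from this[of a] this[of t]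
    show "AE s in lebesgue. (s \<in> N \<inter> {0..t} - N \<inter> {0..a}) = (s \<in> N \<inter> {a..<t})"
      by eventually_elim (use assms(2,3) in auto)
  qed (use l[THEN fmeasurableD] in \<open>blast intro: sets.Diff\<close>)+
  ultimately show ?thesis by simp
qed

text \<open>On {0..} the function \<open>m\<close> is nondecreasing and 1-Lipschitz. If the budget
  can be spent at all, the intermediate value theorem gives a moment at which the spent amount is
  \<kappa>, and up to a null set \<open>E\<close> is the part of \<open>N\<close> in [a, t) before
  it.\<close>

lemma
  fixes N :: "real set"
  assumes N: "N \<in> sets lebesgue" and at: "0 \<le> a" "a \<le> t" and \<kappa>: "0 \<le> \<kappa>"
  defines "m \<equiv> \<lambda>s. measure lebesgue (N \<inter> {0..s})"
  defines "E \<equiv> {s \<in> {a..<t}. s \<in> N \<and> m s - m a < \<kappa>}"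
  shows budget_mono: "mono m"
    and budget_sets: "E \<in> sets lebesgue"
    and budget_measure_le: "measure lebesgue E \<le> \<kappa>"
    and budget_measure_exhausted: "\<kappa> \<le> m t - m a \<Longrightarrow> measure lebesgue E = \<kappa>"
proof -
  have l: "N \<inter> {r..s} \<in> lmeasurable" "N \<inter> {r..<s} \<in> lmeasurable" for r s
    by (intro bounded_set_imp_lmeasurable bounded_Int disjI2 sets.Int N; simp)+
  show mono: "mono m"
    unfolding m_def using l by (intro monoI measure_mono_fmeasurable fmeasurableD l) auto
  have "m \<in> borel_measurable borel" using mono by (rule borel_measurable_mono)
  then have "{s \<in> space borel. m s - m a < \<kappa>} \<in> sets borel" by measurable
  then have *: "{s. m s - m a < \<kappa>} \<in> sets lebesgue" by auto
  have "E = {a..<t} \<inter> N \<inter> {s. m s - m a < \<kappa>}" by (auto simp: E_def)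
  then show E: "E \<in> sets lebesgue" using N * by (auto intro!: sets.Int)
  have diff: "m s - m r = measure lebesgue (N \<inter> {r..<s})" if "0 \<le> r" "r \<le> s" for r s
    unfolding m_def by (rule measure_lebesgue_Int_diff[OF N that])
  have "\<bar>m s - m r\<bar> \<le> \<bar>s - r\<bar>" if "0 \<le> r" "r \<le> s" for r s
  proof -
    have "measure lebesgue (N \<inter> {r..<s}) \<le> measure lebesgue {r..<s}"
      by (intro measure_mono_fmeasurable fmeasurableD[OF l(2)]) (auto simp: bounded_set_imp_lmeasurable)
    then show ?thesis using diff[OF that] that by simp
  qed
  note le = this
  have "\<bar>m s - m r\<bar> \<le> \<bar>s - r\<bar>" if "0 \<le> r" "0 \<le> s" for r s
    using le[of r s] le[of s r] that by (cases "r \<le> s") (simp_all add: abs_minus_commute)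
  then have "1-lipschitz_on {0..} m"
    by (intro lipschitz_onI) (auto simp: dist_real_def)
  then have cm: "continuous_on {a..t} m"
    using at by (auto intro!: lipschitz_on_continuous_on elim!: lipschitz_on_subset)
  have ivt: "\<exists>s\<ge>a. s \<le> t \<and> m s - m a = k" if "0 \<le> k" "k \<le> m t - m a" for k
    using IVT'[of m a "m a + k" t] that at cm by (auto simp: algebra_simps) 
  have fE: "E \<in> lmeasurable"
    using E by (rule bounded_set_imp_lmeasurable[rotated]) (auto intro: bounded_subset[of "{a..t}"] simp: E_def)
  show le: "measure lebesgue E \<le> \<kappa>"
  proof (cases "m t - m a < \<kappa>")
    case True
    have "measure lebesgue E \<le> measure lebesgue (N \<inter> {a..<t})"
      using E l by (intro measure_mono_fmeasurable) (auto simp: E_def)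
    then show ?thesis using diff[OF at] True by simp
  next
    case False
    then obtain s where s: "a \<le> s" "s \<le> t" "m s - m a = \<kappa>" using ivt[of \<kappa>] \<kappa> by auto
    have "E \<subseteq> N \<inter> {a..<s}"
    proof
      fix r assume r: "r \<in> E"
      then have "\<not> s \<le> r" using monoD[OF mono, of s r] s by (auto simp: E_def)
      then show "r \<in> N \<inter> {a..<s}" using r by (auto simp: E_def)
    qed
    then have "measure lebesgue E \<le> measure lebesgue (N \<inter> {a..<s})"
      using E l by (intro measure_mono_fmeasurable) auto
    then show ?thesis using diff[of a s] s at by simp
  qed
  show "measure lebesgue E = \<kappa>" if ex: "\<kappa> \<le> m t - m a"
  proof (rule antisym[OF le], rule field_le_epsilon)
    fix \<epsilon> :: real assume "\<epsilon> > 0"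
    \<comment> \<open>An amount strictly below \<kappa>, because \<open>E\<close> is given by a
      strict inequality: all bad times before \<open>m\<close> has grown by k belong to
      \<open>E\<close>.\<close>
    define k where "k = max 0 (\<kappa> - \<epsilon>)"
    show "\<kappa> \<le> measure lebesgue E + \<epsilon>"
    proof (cases "\<kappa> = 0")
      case False
      have k: "0 \<le> k" "k < \<kappa>" "k \<le> m t - m a" using \<open>\<epsilon> > 0\<close> \<kappa> False ex by (auto simp: k_def)
      then obtain s where s: "a \<le> s" "s \<le> t" "m s - m a = k" using ivt[of k] by auto
      have "N \<inter> {a..<s} \<subseteq> E"
      proof
        fix r assume r: "r \<in> N \<inter> {a..<s}"
        then have "m r \<le> m s" using monoD[OF mono] by auto
        then show "r \<in> E" using r s k by (auto simp: E_def)
      qed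
      then have "measure lebesgue (N \<inter> {a..<s}) \<le> measure lebesgue E"
        by (intro measure_mono_fmeasurable fmeasurableD l fE)
      then show ?thesis using diff[of a s] s at by (simp add: k_def)
    qed (use \<open>\<epsilon> > 0\<close> in \<open>simp add: add_nonneg_nonneg less_imp_le\<close>)
  qed
qed

section \<open>One step of the grid, and leaving through the boundary\<close>

context controlled_system
begin

lemma chart_bound:
  assumes c: "chart \<Omega> x e v \<phi> a1 a2 c" and "e > 0"
  shows "0 < c" "c \<le> M" "a1 \<in> C" "a2 \<in> C" "norm v = 1" "e \<le> c"
proof -
  show "0 < c" "a1 \<in> C" "norm v = 1" "e \<le> c" and a2: "a2 \<in> C" using assms by (auto simp: chart_def)
  have "7 / 2 * c \<le> norm v * norm (h x a2)"
    using c norm_cauchy_schwarz[of v "h x a2"] by (auto simp: chart_def)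
  also have "\<dots> \<le> M" using c h_bound[OF a2] by (simp add: chart_def)
  finally show "c \<le> M" using \<open>0 < c\<close> by simp
qed

lemma chart_linear:
  assumes c: "chart \<Omega> x e v \<phi> a1 a2 c" and "y \<in> ball x e" "y' \<in> ball x e"
  shows "\<phi> y \<le> \<phi> y' + v \<bullet> (y - y') + c / (16 * M) * norm (y - y')"
  using assms unfolding chart_def by (smt (verit, best))

text \<open>Pushing inwards at the times when \<open>u2\<close> does not do so itself, until the budget \<open>\<kappa>\<close> is
  exhausted: before that, every control in use decreases \<open>\<phi>\<close>; afterwards, \<open>\<phi>\<close> along the first
  trajectory stays below \<open>\<phi>\<close> along the second one.\<close>

lemma chart_step:
  assumes u: "u1 \<in> controls C" "u2 \<in> controls C" and ab: "0 \<le> a" "a \<le> b"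
    and ch: "chart \<Omega> (trajectory h x2 u2 a) e v \<phi> a1 a2 c" and e: "e > 0"
    and N: "N \<in> sets lebesgue"
    and bad: "\<And>s. a \<le> s \<Longrightarrow> s < b \<Longrightarrow> s \<in> N \<longleftrightarrow> - c < v \<bullet> h (trajectory h x2 u2 a) (u2 s)"
    and u1: "\<And>s. a \<le> s \<Longrightarrow> s < b \<Longrightarrow> u1 s =
      (if s \<in> N \<and> measure lebesgue (N \<inter> {0..s}) - measure lebesgue (N \<inter> {0..a}) < \<kappa> then a1 else u2 s)"
    and cl: "trajectory h x1 u1 a \<in> closure \<Omega>" "trajectory h x2 u2 b \<in> closure \<Omega>"
    and D: "norm (trajectory h x1 u1 a - trajectory h x2 u2 a) \<le> D" "D > 0"
    and \<kappa>: "\<kappa> = 4 / e * D"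
    and small: "L * (b - a) \<le> 1 / 2" "M * (b - a) \<le> e / 4" "16 * M * L * (b - a) \<le> e"
      "2 * (D + 2 * M * \<kappa>) \<le> e / 4"
  shows "trajectory h x1 u1 b \<in> closure \<Omega> \<and>
    norm (trajectory h x1 u1 b - trajectory h x2 u2 b) \<le> 2 * (D + 2 * M * \<kappa>)"
proof -
  define Z1 where "Z1 = trajectory h x1 u1"
  define Z2 where "Z2 = trajectory h x2 u2"
  define x where "x = Z2 a"
  define m where "m s = measure lebesgue (N \<inter> {0..s})" for s
  define E where "E = {s \<in> {a..<b}. s \<in> N \<and> m s - m a < \<kappa>}"
  define W where "W = 2 * (D + 2 * M * \<kappa>)"
  note ch = ch[folded Z2_def x_def]
  have k0: "\<kappa> \<ge> 0" using \<kappa> D e by simp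
  have E: "E \<in> sets lebesgue" "measure lebesgue E \<le> \<kappa>"
    using budget_sets[OF N ab k0] budget_measure_le[OF N ab k0] by (auto simp: E_def m_def)
  have Esub: "E \<subseteq> {a..b}" by (auto simp: E_def)
  have dev: "norm (Z1 s - Z2 s) \<le> W" if "a \<le> s" "s \<le> b" for s
  proof -
    have "norm (Z1 s - Z2 s) \<le> 2 * (norm (Z1 a - Z2 a) + 2 * M * measure lebesgue E)"
      unfolding Z1_def Z2_def
      by (rule trajectory_deviation[OF u ab small(1) E(1) Esub _ that]) (use u1 in \<open>auto simp: E_def m_def\<close>)
    also have "\<dots> \<le> W" unfolding W_def
      using D(1) E(2) M_pos by (intro mult_left_mono add_mono) (auto simp: Z1_def Z2_def)
    finally show ?thesis .
  qed
  \<comment> \<open>The old trajectory moves by at most e / 4 and the new one is within e / 4 of it,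
    so one chart serves both during the step.\<close>
  have ball: "Z1 s \<in> ball x e" "Z2 s \<in> ball x e" if "a \<le> s" "s \<le> b" for s
  proof -
    have "norm (Z2 s - x) \<le> M * (s - a)"
      unfolding x_def Z2_def by (rule trajectory_lip[OF u(2) ab(1) that(1)])
    also have "\<dots> \<le> M * (b - a)" using that M_pos by simp
    finally have "norm (Z2 s - x) \<le> e / 4" using small(2) by linarith
    moreover have "norm (Z1 s - x) \<le> norm (Z1 s - Z2 s) + norm (Z2 s - x)"
      using norm_triangle_ineq[of "Z1 s - Z2 s" "Z2 s - x"] by simp
    ultimately show "Z1 s \<in> ball x e" "Z2 s \<in> ball x e"
      using dev[OF that] small(4) e by (auto simp: dist_norm norm_minus_commute W_def)
  qed
  note cb = chart_bound[OF ch e]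
  have in\<Omega>: "Z1 s \<in> \<Omega>" if "\<phi> (Z1 s) < 0" "a \<le> s" "s \<le> b" for s
    using ch ball(1)[OF that(2,3)] that(1) unfolding chart_def by blast
  have \<phi>1: "\<phi> (Z1 a) \<le> 0"
    using ch ball(1)[of a] ab cl(1) unfolding chart_def Z1_def by blast
  have \<phi>2: "\<phi> (Z2 b) \<le> 0"
    using ch ball(2)[of b] ab cl(2) unfolding chart_def Z2_def by blast
  have "Z1 b \<in> closure \<Omega>"
  proof (cases "a = b")
    case True
    then show ?thesis using cl(1) by (simp add: Z1_def)
  next
    case False
    then have lt: "a < b" using ab by simp
    have pa1: "v \<bullet> h (Z1 s) a1 \<le> - (3 * c)" if "a \<le> s" "s \<le> b" for s
      using chart_speed[OF ch ball(1)[OF that] cb(3)] ch unfolding chart_def by linarith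
    have "\<phi> (Z1 b) < 0"
    proof (cases "m b - m a < \<kappa>")
      case True
      have "v \<bullet> h (Z1 s) (u1 s) \<le> - (c / 2)" if s: "a < s" "s < b" for s
      proof -
        have "m s \<le> m b" using monoD[OF budget_mono[OF N ab k0], of s b] s by (simp add: m_def)
        then have u1s: "u1 s = (if s \<in> N then a1 else u2 s)" using u1[of s] s True by (auto simp: m_def)
        show ?thesis
        proof (cases "s \<in> N")
          case True
          then show ?thesis using pa1[of s] s u1s cb(1) by simp
        next
          case False
          then have "v \<bullet> h x (u2 s) \<le> - c" using bad[of s] s by (auto simp: x_def Z2_def)
          moreover have "u2 s \<in> C" using controls_in[OF u(2)] s ab by simp
          ultimately show ?thesis
            using chart_speed[OF ch ball(1)[of s], of "u2 s"] s u1s False unfolding abs_le_iff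
            by simp
        qed
      qed
      then have "v \<bullet> integral {a..b} (\<lambda>s. h (Z1 s) (u1 s)) \<le> - (c / 2) * (b - a)"
        unfolding Z1_def
        by (intro inner_integral_le_const[OF trajectory_integrable[OF u(1) ab(1)] ab(2)]) auto
      then have 1: "v \<bullet> (Z1 b - Z1 a) \<le> - (c / 2) * (b - a)"
        using trajectory_increment[OF u(1) ab] by (simp add: Z1_def)
      have "norm (Z1 b - Z1 a) \<le> M * (b - a)"
        using trajectory_lip[OF u(1) ab] by (simp add: Z1_def)
      then have "c / (16 * M) * norm (Z1 b - Z1 a) \<le> c / (16 * M) * (M * (b - a))"
        using cb(1) M_pos by (intro mult_left_mono) auto
      also have "\<dots> = c / 16 * (b - a)" using M_pos by simp
      finally have "\<phi> (Z1 b) \<le> - (c / 2) * (b - a) + c / 16 * (b - a)"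
        using chart_linear[OF ch ball(1)[of b] ball(1)[of a]] ab 1 \<phi>1 by linarith
      also have "\<dots> = - (7 / 16 * (c * (b - a)))" by (simp add: algebra_simps)
      also have "\<dots> < 0" using cb(1) lt by simp
      finally show ?thesis .
    next
      case False
      \<comment> \<open>Now the whole budget has been spent. On \<open>E\<close> the new control has
        speed at most - 3 c and the old one at least - 3/2 c, so the gain over the second trajectory
        is 3/2 c \<kappa>.\<close>
      then have mE: "measure lebesgue E = \<kappa>"
        using budget_measure_exhausted[OF N ab k0] by (simp add: E_def m_def)
      have W0: "W \<ge> 0" using D(2) k0 M_pos by (simp add: W_def)
      have "v \<bullet> integral {a..b} (\<lambda>s. h (Z1 s) (u1 s) - h (Z2 s) (u2 s))
        \<le> (L * W) * (b - a) + (- (3 / 2 * c)) * measure lebesgue E"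
        unfolding Z1_def Z2_def
      proof (rule inner_integral_le_affine_indicator[OF trajectory_diff_integrable[OF u ab(1)] ab(2) E(1) Esub],
          fold Z1_def Z2_def)
        fix s assume s: "a < s" "s < b"
        have us: "u2 s \<in> C" using controls_in[OF u(2)] s ab by simp
        show "v \<bullet> (h (Z1 s) (u1 s) - h (Z2 s) (u2 s)) \<le> L * W + - (3 / 2 * c) * indicator E s"
        proof (cases "s \<in> E")
          case True
          then have "s \<in> N" and us1: "u1 s = a1" using u1[of s] s by (auto simp: E_def m_def)
          then have "- c < v \<bullet> h x (u2 s)" using bad[of s] s by (simp add: x_def Z2_def)
          then have "- (3 / 2 * c) \<le> v \<bullet> h (Z2 s) (u2 s)"
            using chart_speed[OF ch ball(2)[of s] us] s by linarith
          moreover have "0 \<le> L * W" using L_pos W0 by simp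
          ultimately show ?thesis using pa1[of s] s us1 True by (simp add: inner_diff_right)
        next
          case False
          then have us1: "u1 s = u2 s" using u1[of s] s by (auto simp: E_def m_def)
          have "v \<bullet> (h (Z1 s) (u1 s) - h (Z2 s) (u2 s)) \<le> norm v * norm (h (Z1 s) (u1 s) - h (Z2 s) (u2 s))"
            by (rule norm_cauchy_schwarz)
          also have "\<dots> \<le> L * norm (Z1 s - Z2 s)" using us us1 cb(5) h_lip by simp
          also have "\<dots> \<le> L * W" using dev[of s] s L_pos by simp
          finally show ?thesis using False by simp
        qed
      qed
      then have "v \<bullet> ((Z1 b - Z2 b) - (Z1 a - Z2 a)) \<le> (L * W) * (b - a) - 3 / 2 * c * \<kappa>"
        using trajectory_diff_increment[OF u ab] mE by (simp add: Z1_def Z2_def)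
      moreover have "v \<bullet> (Z1 a - Z2 a) \<le> D"
        using norm_cauchy_schwarz[of v "Z1 a - Z2 a"] cb(5) D(1) by (simp add: Z1_def Z2_def)
      ultimately have 1: "v \<bullet> (Z1 b - Z2 b) \<le> D + L * (b - a) * W - 3 / 2 * c * \<kappa>"
        by (simp add: inner_diff_right algebra_simps)
      have "L * (b - a) \<le> c / (16 * M)"
        using small(3) cb(6) M_pos by (simp add: field_simps)
      then have 2: "L * (b - a) * W \<le> c / (16 * M) * W"
        using W0 by (rule mult_right_mono)
      have 3: "c / (16 * M) * norm (Z1 b - Z2 b) \<le> c / (16 * M) * W"
        using dev[of b] ab cb(1) M_pos by (intro mult_left_mono) auto
      \<comment> \<open>Both the Lipschitz drift and the nonlinearity of \<phi> are at most this
        quantity; this is the common origin of the 16 M in \<open>chart\<close> and in the third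
        smallness condition.\<close>
      have "c / (16 * M) * W = c / M * D / 8 + c * \<kappa> / 4"
        using M_pos by (simp add: W_def field_simps)
      also have "c / M * D \<le> 1 * D"
        using cb(2) M_pos D(2) by (intro mult_right_mono) auto
      finally have 4: "c / (16 * M) * W \<le> D / 8 + c * \<kappa> / 4" by simp
      have "\<phi> (Z1 b) \<le> \<phi> (Z2 b) + v \<bullet> (Z1 b - Z2 b) + c / (16 * M) * norm (Z1 b - Z2 b)"
        by (rule chart_linear[OF ch ball(1) ball(2)]) (use ab in auto)
      also have "\<dots> \<le> 0 + (D + (D / 8 + c * \<kappa> / 4) - 3 / 2 * c * \<kappa>) + (D / 8 + c * \<kappa> / 4)"
        using 1 2 3 4 \<phi>2 by (intro add_mono) linarith+
      also have "\<dots> = 5 / 4 * D - c * \<kappa>" by simp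
      \<comment> \<open>With e <= c the gain is at least e \<kappa> = 4 D, more than 5/4 D: here the
        factor 4 / e of the budget pays off.\<close>
      also have "\<dots> \<le> 5 / 4 * D - e * \<kappa>" using cb(6) k0 by (simp add: mult_right_mono)
      also have "\<dots> < 0" using \<kappa> e D(2) by simp
      finally show ?thesis .
    qed
    then show ?thesis using in\<Omega>[of b] ab closure_subset by auto
  qed
  then show ?thesis using dev[of b] ab by (simp add: Z1_def Z2_def W_def)
qed

text \<open>Away from the boundary nothing is replaced: the margin e absorbs the motion during the
  step and the distance, which at most doubles.\<close>

lemma interior_step:
  assumes u: "u1 \<in> controls C" "u2 \<in> controls C" and ab: "0 \<le> a" "a \<le> b"
    and ball: "ball (trajectory h x2 u2 a) e \<subseteq> \<Omega>" and e: "e > 0"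
    and u1: "\<And>s. a \<le> s \<Longrightarrow> s < b \<Longrightarrow> u1 s = u2 s"
    and D: "norm (trajectory h x1 u1 a - trajectory h x2 u2 a) \<le> D"
    and small: "L * (b - a) \<le> 1 / 2" "M * (b - a) \<le> e / 4" "2 * D \<le> e / 4"
  shows "trajectory h x1 u1 b \<in> closure \<Omega> \<and> norm (trajectory h x1 u1 b - trajectory h x2 u2 b) \<le> 2 * D"
proof -
  have "norm (trajectory h x1 u1 b - trajectory h x2 u2 b) \<le>
    2 * (norm (trajectory h x1 u1 a - trajectory h x2 u2 a) + 2 * M * measure lebesgue ({} :: real set))"
    by (rule trajectory_deviation[OF u ab small(1)]) (use ab u1 in auto)
  then have 1: "norm (trajectory h x1 u1 b - trajectory h x2 u2 b) \<le> 2 * D" using D by simp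
  moreover have "norm (trajectory h x2 u2 b - trajectory h x2 u2 a) \<le> e / 4"
    using trajectory_lip[OF u(2) ab, of x2] small(2) by linarith
  ultimately have "norm (trajectory h x1 u1 b - trajectory h x2 u2 a) < e"
    using norm_triangle_ineq[of "trajectory h x1 u1 b - trajectory h x2 u2 b" "trajectory h x2 u2 b - trajectory h x2 u2 a"]
      small(3) e by simp
  then have "trajectory h x1 u1 b \<in> \<Omega>" using ball by (auto simp: dist_norm norm_minus_commute subset_iff)
  then show ?thesis using 1 closure_subset by auto
qed

text \<open>At the start \<phi> is at least - 2 D, because x lies outside \<Omega>. The outward
  speed 3 c, less c / 16 for the nonlinearity, makes \<phi> positive at time b, as 2 D <= e (b - a)
  <= c (b - a); but \<phi> is nonpositive on the closure.\<close>

lemma chart_exit: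
  assumes u: "u \<in> controls C" and ab: "0 \<le> a" "a \<le> b"
    and ch: "chart \<Omega> x e v \<phi> a1 a2 c" and e: "e > 0" and x: "x \<notin> \<Omega>"
    and ua2: "\<And>s. a < s \<Longrightarrow> s < b \<Longrightarrow> u s = a2"
    and D: "norm (trajectory h z u a - x) \<le> D" "D > 0"
    and b: "D + M * (b - a) < e" "2 * D \<le> e * (b - a)"
  shows "trajectory h z u b \<notin> closure \<Omega>"
proof
  define Z where "Z = trajectory h z u"
  note cb = chart_bound[OF ch e]
  have lip: "norm (Z s - Z a) \<le> M * (s - a)" if "a \<le> s" for s
    unfolding Z_def by (rule trajectory_lip[OF u ab(1) that])
  have ball: "Z s \<in> ball x e" if s: "a \<le> s" "s \<le> b" for s
  proof -
    have "M * (s - a) \<le> M * (b - a)" using s M_pos by simp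
    then show ?thesis
      using norm_triangle_ineq[of "Z s - Z a" "Z a - x"] lip[OF s(1)] D(1) b(1)
      by (simp add: dist_norm norm_minus_commute Z_def)
  qed
  have out: "7 / 2 * c \<le> v \<bullet> h x a2" using ch by (simp add: chart_def)
  have "(- v) \<bullet> integral {a..b} (\<lambda>s. h (Z s) (u s)) \<le> - (3 * c) * (b - a)"
    unfolding Z_def
  proof (rule inner_integral_le_const[OF trajectory_integrable[OF u ab(1)] ab(2)], fold Z_def)
    fix s assume s: "a < s" "s < b"
    have "\<bar>v \<bullet> h (Z s) a2 - v \<bullet> h x a2\<bar> \<le> c / 2"
      by (rule chart_speed[OF ch ball cb(4)]) (use s in auto)
    then have "- (v \<bullet> h (Z s) a2) \<le> - (3 * c)" using out by linarith
    then show "- v \<bullet> h (Z s) (u s) \<le> - (3 * c)" using ua2[OF s] by simp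
  qed
  then have 1: "v \<bullet> (Z a - Z b) \<le> - (3 * (c * (b - a)))"
    unfolding Z_def trajectory_increment[OF u ab, symmetric] by (simp add: inner_diff_right mult.assoc)
  have "c / (16 * M) * norm (Z a - Z b) \<le> c / (16 * M) * (M * (b - a))"
    using lip[OF ab(2)] cb(1) M_pos by (intro mult_left_mono) (auto simp: norm_minus_commute)
  then have 2: "c / (16 * M) * norm (Z a - Z b) \<le> c * (b - a) / 16"
    using M_pos by simp
  have xb: "x \<in> ball x e" using e by simp
  have \<phi>x: "\<phi> x \<ge> 0" using ch x xb unfolding chart_def by (meson not_le)
  have "c / (16 * M) \<le> 1" using cb(2) M_pos by (simp add: divide_le_eq)
  then have "c / (16 * M) * norm (x - Z a) \<le> 1 * norm (x - Z a)" by (rule mult_right_mono) simp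
  moreover have "v \<bullet> (x - Z a) \<le> norm (x - Z a)"
    using norm_cauchy_schwarz[of v "x - Z a"] cb(5) by simp
  \<comment> \<open>One D for the slope and one, generously, for the nonlinearity.\<close>
  ultimately have "- (2 * D) \<le> \<phi> (Z a)"
    using chart_linear[OF ch xb ball[of a]] ab \<phi>x D(1) by (simp add: Z_def norm_minus_commute)
  moreover have "2 * D \<le> c * (b - a)"
    using b(2) cb(6) ab mult_right_mono[of e c "b - a"] by linarith
  ultimately have "\<phi> (Z b) > 0"
    using chart_linear[OF ch ball[of a] ball[of b]] ab 1 2 D(2) by linarith
  moreover assume "trajectory h z u b \<in> closure \<Omega>"
  then have "\<phi> (Z b) \<le> 0" using ch ball[of b] ab unfolding chart_def Z_def by blast
  ultimately show False by simp
qed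

end

section \<open>Tunings that follow a trajectory up to its exit\<close>

lemma exit_time_nonneg: "0 \<le> exit_time \<Omega> Z"
  unfolding exit_time_def by (intro Inf_greatest) auto

lemma exit_time_le: "0 \<le> t \<Longrightarrow> Z t \<notin> closure \<Omega> \<Longrightarrow> exit_time \<Omega> Z \<le> ereal t"
  unfolding exit_time_def by (intro Inf_lower) auto

text \<open>The exit time itself is included: the state then is a limit of earlier states in a
  closed set.\<close>

lemma before_exit_time:
  assumes Z: "continuous_on {0..} Z" "Z 0 \<in> closure \<Omega>" and t: "0 \<le> t" "ereal t \<le> exit_time \<Omega> Z"
  shows "Z t \<in> closure \<Omega>"
proof (cases "t = 0")
  case False
  have s: "Z s \<in> closure \<Omega>" if "s \<in> {0..<t}" for s
  proof (rule ccontr)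
    assume "Z s \<notin> closure \<Omega>"
    then have "exit_time \<Omega> Z \<le> ereal s" using that by (intro exit_time_le) auto
    with t(2) have "ereal t \<le> ereal s" by (rule order_trans)
    then show False using that by simp
  qed
  have "t \<in> closure {0..<t}" using False t(1) by (simp add: closure_atLeastLessThan)
  moreover have "continuous_on (closure {0..<t}) Z"
    using False t(1) by (auto intro: continuous_on_subset[OF Z(1)])
  then have "Z ` closure {0..<t} \<subseteq> closure \<Omega>"
    by (rule image_closure_subset) (use s in auto)
  ultimately show ?thesis by blast
qed (use Z in simp)

lemma exit_time_ge:
  assumes "\<And>s. 0 \<le> s \<Longrightarrow> s < t \<Longrightarrow> Z s \<in> closure \<Omega>"
  shows "ereal t \<le> exit_time \<Omega> Z"
  unfolding exit_time_def
proof (rule Inf_greatest)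
  fix e assume "e \<in> ereal ` {t. 0 \<le> t \<and> Z t \<notin> closure \<Omega>}"
  then obtain s where "e = ereal s" "0 \<le> s" "Z s \<notin> closure \<Omega>" by auto
  then show "ereal t \<le> e" using assms[of s] by force
qed

lemma exit_time_lessE:
  assumes "exit_time \<Omega> Z < ereal t"
  obtains s where "0 \<le> s" "s < t" "Z s \<notin> closure \<Omega>"
  using assms unfolding exit_time_def Inf_less_iff by auto

text \<open>From a point of the open set the trajectory would stay in it for a while, against the
  choice of the infimum.\<close>

lemma exit_time_frontier:
  assumes Z: "continuous_on {0..} Z" "Z 0 \<in> closure \<Omega>" and "open \<Omega>"
    and t: "exit_time \<Omega> Z = ereal t"
  shows "Z t \<in> frontier \<Omega>"
proof -
  have t0: "0 \<le> t" using exit_time_nonneg[of \<Omega> Z] t by simp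
  have "Z t \<notin> \<Omega>"
  proof
    assume "Z t \<in> \<Omega>"
    then obtain r where r: "r > 0" "ball (Z t) r \<subseteq> \<Omega>" using \<open>open \<Omega>\<close> by (meson open_contains_ball)
    obtain d where d: "d > 0" "\<And>s. s \<in> {0..} \<Longrightarrow> dist s t < d \<Longrightarrow> dist (Z s) (Z t) < r"
      using Z(1) t0 r(1) unfolding continuous_on_iff by (metis atLeast_iff)
    have "exit_time \<Omega> Z < ereal (t + d)" using t d by simp
    then obtain s where s: "0 \<le> s" "s < t + d" "Z s \<notin> closure \<Omega>" by (rule exit_time_lessE)
    have "ereal t \<le> ereal s" using exit_time_le[of s Z \<Omega>] s t by simp
    then have "dist (Z s) (Z t) < r" using d(2)[of s] s by (simp add: dist_real_def)
    then have "Z s \<in> \<Omega>" using r by (auto simp: dist_commute)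
    then show False using s closure_subset by auto
  qed
  moreover have "Z t \<in> closure \<Omega>" using before_exit_time[OF Z t0] t by simp
  ultimately show ?thesis using \<open>open \<Omega>\<close> by (simp add: frontier_def interior_open)
qed

text \<open>The strict inequality matters: some instants outside the closure then lie below
  \<open>t\<close>, where both functions agree.\<close>

lemma exit_time_cong:
  assumes eq: "\<And>s. 0 \<le> s \<Longrightarrow> s < t \<Longrightarrow> Z s = Z' s" and ex: "exit_time \<Omega> Z < ereal t"
  shows "exit_time \<Omega> Z' = exit_time \<Omega> Z"
proof -
  have le: "exit_time \<Omega> W' \<le> exit_time \<Omega> W"
    if eq: "\<And>s. 0 \<le> s \<Longrightarrow> s < t \<Longrightarrow> W s = W' s" and ex: "exit_time \<Omega> W < ereal t" for W W' :: "real \<Rightarrow> 'a"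
  proof (rule dense_ge_bounded[OF ex])
    fix e assume e: "exit_time \<Omega> W < e" "e < ereal t"
    then obtain s where s: "0 \<le> s" "ereal s < e" "W s \<notin> closure \<Omega>"
      unfolding exit_time_def Inf_less_iff by auto
    then have "ereal s < ereal t" using e(2) by (meson less_trans)
    then have "W' s \<notin> closure \<Omega>" using eq[of s] s by auto
    then show "exit_time \<Omega> W' \<le> e" using exit_time_le[of s W' \<Omega>] s by auto
  qed
  show ?thesis
    using le[of Z Z'] le[of Z' Z] eq ex by (metis antisym le_less_trans)
qed

section \<open>Sampling on a time grid\<close>

definition grid :: "real \<Rightarrow> real \<Rightarrow> real" where
  "grid r t = r * of_int \<lfloor>t / r\<rfloor>"

lemma grid_bounds: "r > 0 \<Longrightarrow> 0 \<le> t \<Longrightarrow> 0 \<le> grid r t" "r > 0 \<Longrightarrow> grid r t \<le> t"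
proof -
  assume r: "r > 0"
  have "r * of_int \<lfloor>t / r\<rfloor> \<le> r * (t / r)" using r by (intro mult_left_mono) auto
  then show "grid r t \<le> t" using r by (simp add: grid_def)
  show "0 \<le> grid r t" if "0 \<le> t" using that r by (simp add: grid_def)
qed

lemma grid_eq:
  assumes "r > 0" "real i * r \<le> t" "t < real (Suc i) * r"
  shows "grid r t = real i * r" "nat \<lfloor>t / r\<rfloor> = i"
proof -
  have "\<lfloor>t / r\<rfloor> = int i"
    using assms by (intro floor_unique) (auto simp: field_simps)
  then show "grid r t = real i * r" "nat \<lfloor>t / r\<rfloor> = i" by (auto simp: grid_def)
qed

lemma borel_measurable_lebesgue_on:
  fixes f :: "real \<Rightarrow> 'z::topological_space"
  shows "f \<in> borel_measurable borel \<Longrightarrow> f \<in> borel_measurable (lebesgue_on S)"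
  by (intro measurable_restrict_space1 measurable_completion) simp

text \<open>Chart data are picked by arbitrary choice at each point and may be non-measurable
  functions of the state. Sampled on the grid they depend on time through an integer only, and any
  function of an integer is measurable.\<close>

lemma step_measurable:
  fixes f :: "int \<Rightarrow> 'z::topological_space"
  shows "(\<lambda>t::real. f \<lfloor>t / r\<rfloor>) \<in> borel_measurable (lebesgue_on S)"
proof (rule borel_measurable_lebesgue_on)
  have "(\<lambda>t::real. \<lfloor>t / r\<rfloor>) \<in> borel \<rightarrow>\<^sub>M count_space UNIV" by measurable
  then show "(\<lambda>t::real. f \<lfloor>t / r\<rfloor>) \<in> borel_measurable borel"
    by (rule measurable_compose) simp
qed

section \<open>The tuned control\<close>

context controlled_system
begin

text \<open>With the chart frozen at the last grid point, this is a condition on \<alpha> alone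
  during a step. Only the old trajectory enters, so the spending of the budget is known without the
  new one.\<close>

definition bad_times ::
    "real \<Rightarrow> ('x \<Rightarrow> bool) \<Rightarrow> ('x \<Rightarrow> 'x) \<Rightarrow> ('x \<Rightarrow> real) \<Rightarrow> (real \<Rightarrow> 'x) \<Rightarrow> (real \<Rightarrow> 'c) \<Rightarrow> real set" where
  "bad_times r near v c X \<alpha> = {s. 0 \<le> s \<and> near (X (grid r s)) \<and>
     - c (X (grid r s)) < v (X (grid r s)) \<bullet> h (X (grid r s)) (\<alpha> s)}"

text \<open>\<open>\<kappa> i\<close> is the budget of inward pushing in the \<open>i\<close>-th step of the grid; \<open>m t - m (grid r t)\<close> bounds the part
  of it already spent.\<close>

definition tuned ::
    "'x set \<Rightarrow> real \<Rightarrow> ('x \<Rightarrow> bool) \<Rightarrow> ('x \<Rightarrow> 'x) \<Rightarrow> ('x \<Rightarrow> real) \<Rightarrow> ('x \<Rightarrow> 'c) \<Rightarrow> ('x \<Rightarrow> 'c) \<Rightarrow>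
      (nat \<Rightarrow> real) \<Rightarrow> 'x \<Rightarrow> (real \<Rightarrow> 'c) \<Rightarrow> real \<Rightarrow> 'c" where
  "tuned \<Omega> r near v c a1 a2 \<kappa> z \<alpha> =
    (let X = trajectory h z \<alpha>; N = bad_times r near v c X \<alpha>; m = (\<lambda>s. measure lebesgue (N \<inter> {0..s})) in
      (\<lambda>t\<in>{0..}. if exit_time \<Omega> X < ereal t then a2 (X (real_of_ereal (exit_time \<Omega> X)))
        else if t \<in> N \<and> m t - m (grid r t) < \<kappa> (nat \<lfloor>t / r\<rfloor>) then a1 (X (grid r t)) else \<alpha> t))"

lemma bad_times_sets:
  assumes u: "\<alpha> \<in> controls C"
  shows "bad_times r near v c X \<alpha> \<in> sets lebesgue"
proof -
  let ?M = "lebesgue_on {0..} :: real measure"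
  have S: "(\<lambda>s. f (X (grid r s))) \<in> borel_measurable ?M" for f :: "'x \<Rightarrow> 'z::topological_space"
    unfolding grid_def by (rule step_measurable)
  have [measurable]: "(\<lambda>s. h (X (grid r s)) (\<alpha> s)) \<in> borel_measurable ?M"
    by (rule rhs_measurable[OF u S[of "\<lambda>x. x"]])
  have [measurable]: "(\<lambda>s. v (X (grid r s))) \<in> borel_measurable ?M"
    "(\<lambda>s. c (X (grid r s))) \<in> borel_measurable ?M"
    "(\<lambda>s. of_bool (near (X (grid r s))) :: real) \<in> borel_measurable ?M"
    using S[of v] S[of c] S[of "\<lambda>x. of_bool (near x)"] by auto
  have "{s \<in> space ?M. 0 < (of_bool (near (X (grid r s))) :: real) \<and>
      - c (X (grid r s)) < v (X (grid r s)) \<bullet> h (X (grid r s)) (\<alpha> s)} \<in> sets ?M"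
    by measurable
  moreover have "{s \<in> space ?M. 0 < (of_bool (near (X (grid r s))) :: real) \<and>
      - c (X (grid r s)) < v (X (grid r s)) \<bullet> h (X (grid r s)) (\<alpha> s)} = bad_times r near v c X \<alpha>"
    by (auto simp: bad_times_def)
  ultimately show ?thesis by (simp add: sets_restrict_space_iff)
qed

lemma tuned_controls:
  assumes u: "\<alpha> \<in> controls C" and a: "range a1 \<subseteq> C" "range a2 \<subseteq> C"
  shows "tuned \<Omega> r near v c a1 a2 \<kappa> z \<alpha> \<in> controls C"
proof -
  define X where "X = trajectory h z \<alpha>"
  define N where "N = bad_times r near v c X \<alpha>"
  define m where "m = (\<lambda>s. measure lebesgue (N \<inter> {0..s}))"
  let ?M = "lebesgue_on {0..} :: real measure"
  let ?f = "\<lambda>t. if exit_time \<Omega> X < ereal t then a2 (X (real_of_ereal (exit_time \<Omega> X)))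
        else if t \<in> N \<and> m t - m (grid r t) < \<kappa> (nat \<lfloor>t / r\<rfloor>) then a1 (X (grid r t)) else \<alpha> t"
  have eq: "tuned \<Omega> r near v c a1 a2 \<kappa> z \<alpha> = (\<lambda>t\<in>{0..}. ?f t)"
    unfolding tuned_def Let_def X_def N_def m_def by (rule refl)
  have N: "N \<in> sets lebesgue" unfolding N_def by (rule bad_times_sets[OF u])
  have "mono m" unfolding m_def by (rule budget_mono[OF N, of 0 0 0]) auto
  then have [measurable]: "m \<in> borel_measurable ?M"
    by (intro borel_measurable_lebesgue_on borel_measurable_mono)
  have [measurable]: "(\<lambda>t. m (grid r t)) \<in> borel_measurable ?M"
    "(\<lambda>t. \<kappa> (nat \<lfloor>t / r\<rfloor>)) \<in> borel_measurable ?M"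
    "(\<lambda>t. a1 (X (grid r t))) \<in> borel_measurable ?M"
    unfolding grid_def by (rule step_measurable)+
  have [measurable]: "\<alpha> \<in> borel_measurable ?M" using u by (simp add: controls_def)
  have "{t \<in> space ?M. t \<in> N \<and> m t - m (grid r t) < \<kappa> (nat \<lfloor>t / r\<rfloor>)} \<in> sets ?M"
  proof -
    have "{t \<in> space ?M. m t - m (grid r t) < \<kappa> (nat \<lfloor>t / r\<rfloor>)} \<in> sets ?M" by measurable
    moreover have "{0..} \<inter> N \<in> sets ?M" using N by (auto simp: sets_restrict_space_iff intro!: sets.Int)
    ultimately have "{0..} \<inter> N \<inter> {t \<in> space ?M. m t - m (grid r t) < \<kappa> (nat \<lfloor>t / r\<rfloor>)} \<in> sets ?M"
      by (rule sets.Int[rotated])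
    also have "{0..} \<inter> N \<inter> {t \<in> space ?M. m t - m (grid r t) < \<kappa> (nat \<lfloor>t / r\<rfloor>)} =
      {t \<in> space ?M. t \<in> N \<and> m t - m (grid r t) < \<kappa> (nat \<lfloor>t / r\<rfloor>)}" by auto
    finally show ?thesis .
  qed
  moreover have "{t \<in> space ?M. exit_time \<Omega> X < ereal t} \<in> sets ?M"
  proof -
    have "(\<lambda>t::real. ereal t) \<in> borel_measurable ?M"
      by (rule borel_measurable_lebesgue_on) simp
    then show ?thesis by measurable
  qed
  ultimately have "?f \<in> borel_measurable ?M"
    by (intro measurable_If) auto
  then have "(\<lambda>t\<in>{0..}. ?f t) \<in> borel_measurable ?M"
    by (subst measurable_cong[of _ _ ?f]) auto
  moreover have "(\<lambda>t\<in>{0..}. ?f t) \<in> {0..} \<rightarrow>\<^sub>E C"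
    using a[THEN subsetD, OF rangeI] controls_in[OF u] by auto
  ultimately show ?thesis unfolding eq by (simp add: controls_def)
qed

text \<open>Sampled states, bad times and their measures up to \<open>T\<close> depend on the
  control only through its class on {0..T}. The outward control is used strictly after the exit, so
  the past decides whether and from where it is taken.\<close>

lemma tuned_nonanticipating:
  assumes r: "r > 0" and u: "u1 \<in> controls C" "u2 \<in> controls C" and eq: "ae_eq_upto T u1 u2"
  shows "ae_eq_upto T (tuned \<Omega> r near v c a1 a2 \<kappa> z u1) (tuned \<Omega> r near v c a1 a2 \<kappa> z u2)"
proof -
  define X1 where "X1 = trajectory h z u1"
  define X2 where "X2 = trajectory h z u2"
  define N1 where "N1 = bad_times r near v c X1 u1"
  define N2 where "N2 = bad_times r near v c X2 u2"
  define m1 where "m1 = (\<lambda>s. measure lebesgue (N1 \<inter> {0..s}))"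
  define m2 where "m2 = (\<lambda>s. measure lebesgue (N2 \<inter> {0..s}))"
  have X: "X1 s = X2 s" if "0 \<le> s" "s \<le> T" for s
    unfolding X1_def X2_def by (rule trajectory_cong[OF u eq that])
  have N: "N1 \<in> sets lebesgue" "N2 \<in> sets lebesgue"
    unfolding N1_def N2_def by (rule bad_times_sets[OF u(1)], rule bad_times_sets[OF u(2)])
  have N_iff: "s \<in> N1 \<longleftrightarrow> s \<in> N2" if "0 \<le> s" "s \<le> T" "u1 s = u2 s" for s
    using X[of "grid r s"] grid_bounds[OF r, of s] that by (auto simp: N1_def N2_def bad_times_def)
  note ae = eq[unfolded ae_eq_upto_def]
  have m: "m1 s = m2 s" if "s \<le> T" for s
    unfolding m1_def m2_def
  proof (rule measure_eq_AE)
    show "AE w in lebesgue. (w \<in> N1 \<inter> {0..s}) = (w \<in> N2 \<inter> {0..s})"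
      using ae by eventually_elim (use N_iff that in auto)
  qed (use N in \<open>auto intro!: sets.Int\<close>)
  have "tuned \<Omega> r near v c a1 a2 \<kappa> z u1 s = tuned \<Omega> r near v c a1 a2 \<kappa> z u2 s"
    if s: "0 \<le> s" "s \<le> T" "u1 s = u2 s" for s
  proof -
    note g = grid_bounds[OF r, of s]
    have ex: "exit_time \<Omega> X1 = exit_time \<Omega> X2" if "exit_time \<Omega> X1 < ereal s \<or> exit_time \<Omega> X2 < ereal s"
      using that exit_time_cong[of s X1 X2 \<Omega>] exit_time_cong[of s X2 X1 \<Omega>] X s by auto
    have "X1 (real_of_ereal (exit_time \<Omega> X1)) = X2 (real_of_ereal (exit_time \<Omega> X2))"
      if lt: "exit_time \<Omega> X1 < ereal s"
    proof -
      have e: "0 \<le> exit_time \<Omega> X1" by (rule exit_time_nonneg)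
      then have "0 \<le> real_of_ereal (exit_time \<Omega> X1)" "real_of_ereal (exit_time \<Omega> X1) \<le> s"
        using lt by (cases "exit_time \<Omega> X1"; simp)+
      then show ?thesis using X[of "real_of_ereal (exit_time \<Omega> X1)"] s ex lt by simp
    qed
    then have "tuned \<Omega> r near v c a1 a2 \<kappa> z u1 s = tuned \<Omega> r near v c a1 a2 \<kappa> z u2 s" if "exit_time \<Omega> X1 < ereal s"
      using that ex by (simp add: tuned_def Let_def X1_def X2_def)
    moreover have "tuned \<Omega> r near v c a1 a2 \<kappa> z u1 s = tuned \<Omega> r near v c a1 a2 \<kappa> z u2 s"
      if "\<not> exit_time \<Omega> X1 < ereal s"
    proof -
      have "\<not> exit_time \<Omega> X2 < ereal s" using that ex by auto
      moreover have "X1 (grid r s) = X2 (grid r s)" using X[of "grid r s"] g s by simp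
      moreover have "m1 s = m2 s" "m1 (grid r s) = m2 (grid r s)" using m g s by auto
      ultimately show ?thesis
        using that N_iff[OF s] s
        by (simp add: tuned_def Let_def X1_def X2_def N1_def N2_def m1_def m2_def)
    qed
    ultimately show ?thesis by blast
  qed
  then show ?thesis
    unfolding ae_eq_upto_def using ae by (auto elim!: eventually_mono)
qed

text \<open>Index 1 is the follower, index 2 the leader. The first clause prevents the follower from
  exiting before the leader, up to \<open>T\<close>. Controls are compared only up to the leader's
  exit, since the follower is then steered outwards.\<close>

definition follows :: "'x set \<Rightarrow> real \<Rightarrow> real \<Rightarrow> 'x \<Rightarrow> (real \<Rightarrow> 'c) \<Rightarrow> 'x \<Rightarrow> (real \<Rightarrow> 'c) \<Rightarrow> bool" where
  "follows \<Omega> T \<epsilon> x1 u1 x2 u2 \<longleftrightarrow>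
    (\<forall>t. 0 \<le> t \<and> t \<le> T \<and> ereal t \<le> exit_time \<Omega> (trajectory h x2 u2) \<longrightarrow>
       trajectory h x1 u1 t \<in> closure \<Omega> \<and> norm (trajectory h x1 u1 t - trajectory h x2 u2 t) \<le> \<epsilon>) \<and>
    (exit_time \<Omega> (trajectory h x2 u2) < ereal T \<longrightarrow>
       exit_time \<Omega> (trajectory h x1 u1) \<le> exit_time \<Omega> (trajectory h x2 u2) + ereal \<epsilon>) \<and>
    (\<exists>E\<in>lmeasurable. measure lebesgue E \<le> \<epsilon> \<and>
       (\<forall>t. 0 \<le> t \<and> t < T \<and> ereal t \<le> exit_time \<Omega> (trajectory h x2 u2) \<and> t \<notin> E \<longrightarrow> u1 t = u2 t))"

text \<open>With budget \<kappa> = (4 / e) D a step turns distance D into at most 2 (D + 2 M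
  \<kappa>) = q D; hence the powers of \<open>q\<close> in the budgets. The ball of radius
  \<open>R\<close> about \<open>z0\<close> contains the leader up to \<open>T\<close>, so charts are
  demanded only there.\<close>

lemma tuned_follows:
  fixes near :: "'x \<Rightarrow> bool" and v :: "'x \<Rightarrow> 'x" and c :: "'x \<Rightarrow> real" and T e d \<epsilon> :: real and n :: nat
  defines "q \<equiv> 2 * (1 + 8 * M / e)"
  defines "\<kappa> \<equiv> \<lambda>i. 4 / e * (q ^ i * d)"
  assumes "open \<Omega>" and e: "e > 0" and d: "d > 0" and r: "r > 0" and a: "range a1 \<subseteq> C" "range a2 \<subseteq> C"
    and alt: "\<And>x. x \<in> closure \<Omega> \<Longrightarrow> dist z0 x \<le> R \<Longrightarrow>
      (\<not> near x \<and> ball x e \<subseteq> \<Omega>) \<or> (near x \<and> chart \<Omega> x e (v x) (\<phi> x) (a1 x) (a2 x) (c x))"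
    and x: "x1 \<in> closure \<Omega>" "x2 \<in> closure \<Omega>" "norm (x1 - x2) \<le> d" "dist z0 x2 + M * T \<le> R"
    and small: "L * r \<le> 1 / 2" "M * r \<le> e / 4" "16 * M * L * r \<le> e" "q ^ Suc n * d \<le> e / 4"
    and T: "T > 0" "T \<le> real n * r"
    and exit: "q ^ n * d + M * (2 * (q ^ n * d) / e) < e"
    and \<epsilon>: "q ^ n * d \<le> \<epsilon>" "2 * (q ^ n * d) / e \<le> \<epsilon>" "real n * (4 / e * (q ^ n * d)) \<le> \<epsilon>"
    and u: "u2 \<in> controls C"
  shows "follows \<Omega> T \<epsilon> x1 (tuned \<Omega> r near v c a1 a2 \<kappa> x2 u2) x2 u2"
proof -
  define u1 where "u1 = tuned \<Omega> r near v c a1 a2 \<kappa> x2 u2"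
  define X1 where "X1 = trajectory h x1 u1"
  define X2 where "X2 = trajectory h x2 u2"
  define N where "N = bad_times r near v c X2 u2"
  define m where "m = (\<lambda>s. measure lebesgue (N \<inter> {0..s}))"
  have u1: "u1 \<in> controls C" unfolding u1_def by (rule tuned_controls[OF u a])
  have N: "N \<in> sets lebesgue" unfolding N_def by (rule bad_times_sets[OF u])
  have q1: "q \<ge> 1" using M_pos e by (simp add: q_def)
  have qpow: "q ^ i \<le> q ^ j" if "i \<le> j" for i j using that q1 by (rule power_increasing)
  have Dpos: "q ^ i * d > 0" for i using q1 d by simp
  have \<kappa>0: "\<kappa> i \<ge> 0" for i unfolding \<kappa>_def using Dpos[of i] e by (simp add: less_imp_le)
  have u1_exit: "u1 t = a2 (X2 (real_of_ereal (exit_time \<Omega> X2)))" if "exit_time \<Omega> X2 < ereal t" "0 \<le> t" for t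
    using that by (simp add: u1_def tuned_def Let_def X2_def)
  have u1_eq: "u1 t = (if t \<in> N \<and> m t - m (grid r t) < \<kappa> (nat \<lfloor>t / r\<rfloor>) then a1 (X2 (grid r t)) else u2 t)"
    if "ereal t \<le> exit_time \<Omega> X2" "0 \<le> t" for t
    using that unfolding u1_def tuned_def Let_def X2_def N_def m_def
    by (simp del: if_split add: leD)
  have X2_0: "X2 0 = x2" unfolding X2_def by (rule trajectory_0[OF u])
  have X1_0: "X1 0 = x1" unfolding X1_def by (rule trajectory_0[OF u1])
  have cX2: "continuous_on {0..} X2" unfolding X2_def by (rule trajectory_cont[OF u])
  have X2_cl: "X2 t \<in> closure \<Omega>" if "0 \<le> t" "ereal t \<le> exit_time \<Omega> X2" for t
    using before_exit_time[OF cX2 _ that] X2_0 x by simp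
  have X2_R: "dist z0 (X2 t) \<le> R" if "0 \<le> t" "t \<le> T" for t
  proof -
    have "norm (X2 t - X2 0) \<le> M * (t - 0)"
      unfolding X2_def by (rule trajectory_lip[OF u]) (use that in auto)
    also have "\<dots> \<le> M * T" using that M_pos by simp
    finally have "dist x2 (X2 t) \<le> M * T" by (simp add: X2_0 dist_norm norm_minus_commute)
    then show ?thesis using x(4) dist_triangle[of z0 "X2 t" x2] by linarith
  qed
  have main: "\<forall>t. 0 \<le> t \<longrightarrow> t \<le> real i * r \<longrightarrow> t \<le> T \<longrightarrow> ereal t \<le> exit_time \<Omega> X2 \<longrightarrow>
      X1 t \<in> closure \<Omega> \<and> norm (X1 t - X2 t) \<le> q ^ i * d" if "i \<le> n" for i
    using that
  proof (induction i)
    case 0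
    have "X1 0 \<in> closure \<Omega> \<and> norm (X1 0 - X2 0) \<le> q ^ 0 * d" using X1_0 X2_0 x by simp
    then show ?case by (metis antisym mult_zero_left of_nat_0)
  next
    case (Suc i)
    show ?case
    proof (intro allI impI)
      fix t assume t: "0 \<le> t" "t \<le> real (Suc i) * r" "t \<le> T" "ereal t \<le> exit_time \<Omega> X2"
      define D where "D = q ^ i * d"
      have D0: "D > 0" using Dpos by (simp add: D_def)
      have DSuc: "2 * (D + 2 * M * \<kappa> i) = q ^ Suc i * d"
        using e by (simp add: D_def \<kappa>_def q_def field_simps)
      have small4: "q ^ Suc i * d \<le> e / 4"
        using mult_right_mono[OF qpow[of "Suc i" "Suc n"], of d] Suc.prems d small(4) by linarith
      have mD: "D \<le> q ^ Suc i * d" "2 * D \<le> q ^ Suc i * d"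
        using DSuc D0 mult_nonneg_nonneg[OF less_imp_le[OF M_pos] \<kappa>0[of i]]
        by (simp_all del: power_Suc add: mult.assoc)
      show "X1 t \<in> closure \<Omega> \<and> norm (X1 t - X2 t) \<le> q ^ Suc i * d"
      proof (cases "t \<le> real i * r")
        case True
        then have "X1 t \<in> closure \<Omega> \<and> norm (X1 t - X2 t) \<le> q ^ i * d"
          using Suc.IH Suc.prems t by simp
        then show ?thesis using mD by (simp add: D_def)
      next
        case False
        \<comment> \<open>The grid point at which the current, possibly incomplete, step
          starts.\<close>
        define b where "b = real i * r"
        have b: "0 \<le> b" "b \<le> t" "b \<le> T" "t - b \<le> r"
          using r False t by (auto simp: b_def algebra_simps)
        have bex: "ereal b \<le> exit_time \<Omega> X2" using b(2) t(4) by (meson ereal_less_eq(3) order_trans)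
        have IH: "X1 b \<in> closure \<Omega>" "norm (X1 b - X2 b) \<le> D"
          using Suc.IH Suc.prems b bex by (auto simp: b_def D_def)
        have sm: "L * (t - b) \<le> 1 / 2" "M * (t - b) \<le> e / 4" "16 * M * L * (t - b) \<le> e"
        proof -
          have "0 \<le> 16 * M * L" using L_pos M_pos by simp
          from mult_left_mono[OF b(4) this] show "16 * M * L * (t - b) \<le> e" using small(3) by linarith
          from mult_left_mono[OF b(4) less_imp_le[OF L_pos]] show "L * (t - b) \<le> 1 / 2" using small(1) by linarith
          from mult_left_mono[OF b(4) less_imp_le[OF M_pos]] show "M * (t - b) \<le> e / 4" using small(2) by linarith
        qed
        have grid: "grid r s = b" "nat \<lfloor>s / r\<rfloor> = i" if "b \<le> s" "s < t" for s
          using grid_eq[OF r, of i s] that t(2) by (auto simp: b_def)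
        have u1s: "u1 s = (if s \<in> N \<and> m s - m b < \<kappa> i then a1 (X2 b) else u2 s)" if s: "b \<le> s" "s < t" for s
        proof -
          have "ereal s \<le> exit_time \<Omega> X2" using s(2) t(4) by (meson ereal_less_eq(3) less_imp_le order_trans)
          then show ?thesis using u1_eq[of s] grid[OF s] s b(1) by simp
        qed
        have Ns: "s \<in> N \<longleftrightarrow> near (X2 b) \<and> - c (X2 b) < v (X2 b) \<bullet> h (X2 b) (u2 s)" if s: "b \<le> s" "s < t" for s
          using s b(1) grid[OF s] by (simp add: N_def bad_times_def)
        have "(\<not> near (X2 b) \<and> ball (X2 b) e \<subseteq> \<Omega>) \<or>
          (near (X2 b) \<and> chart \<Omega> (X2 b) e (v (X2 b)) (\<phi> (X2 b)) (a1 (X2 b)) (a2 (X2 b)) (c (X2 b)))"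
          by (rule alt[OF X2_cl[OF b(1) bex] X2_R[OF b(1,3)]])
        then show ?thesis
        proof (elim disjE conjE)
          assume nn: "\<not> near (X2 b)" and ball: "ball (X2 b) e \<subseteq> \<Omega>"
          have "X1 t \<in> closure \<Omega> \<and> norm (X1 t - X2 t) \<le> 2 * D"
            unfolding X1_def X2_def
            by (rule interior_step[OF u1 u b(1,2) ball[unfolded X2_def] e _ IH(2)[unfolded X1_def X2_def] sm(1,2)])
              (use u1s Ns nn mD small4 in auto)
          then show ?thesis using mD by auto
        next
          assume nn: "near (X2 b)" and ch: "chart \<Omega> (X2 b) e (v (X2 b)) (\<phi> (X2 b)) (a1 (X2 b)) (a2 (X2 b)) (c (X2 b))"
          have "X1 t \<in> closure \<Omega> \<and> norm (X1 t - X2 t) \<le> 2 * (D + 2 * M * \<kappa> i)"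
            unfolding X1_def X2_def
          proof (rule chart_step[OF u1 u b(1,2) ch[unfolded X2_def] e N _ _ IH(1)[unfolded X1_def] _
                IH(2)[unfolded X1_def X2_def] D0 _ sm])
            show "trajectory h x2 u2 t \<in> closure \<Omega>" using X2_cl[OF t(1,4)] by (simp add: X2_def)
            show "\<kappa> i = 4 / e * D" by (simp add: \<kappa>_def D_def)
            show "2 * (D + 2 * M * \<kappa> i) \<le> e / 4" using DSuc small4 by simp
          qed (use Ns nn u1s in \<open>auto simp: X2_def m_def\<close>)
          then show ?thesis using DSuc by simp
        qed
      qed
    qed
  qed
  have near_exit: "X1 t \<in> closure \<Omega> \<and> norm (X1 t - X2 t) \<le> q ^ n * d"
    if "0 \<le> t" "t \<le> T" "ereal t \<le> exit_time \<Omega> X2" for t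
    using main[of n] that T(2) by auto
  have "exit_time \<Omega> X1 \<le> exit_time \<Omega> X2 + ereal \<epsilon>" if lt: "exit_time \<Omega> X2 < ereal T"
  proof -
    obtain \<theta> where \<theta>: "exit_time \<Omega> X2 = ereal \<theta>" "0 \<le> \<theta>" "\<theta> < T"
      using lt exit_time_nonneg[of \<Omega> X2] by (cases "exit_time \<Omega> X2") auto
    define D where "D = q ^ n * d"
    \<comment> \<open>The shortest delay that \<open>chart_exit\<close> accepts at distance
      D.\<close>
    define b where "b = \<theta> + 2 * D / e"
    have D: "D > 0" using Dpos by (simp add: D_def)
    have fr: "X2 \<theta> \<in> frontier \<Omega>"
      by (rule exit_time_frontier[OF cX2 _ \<open>open \<Omega>\<close> \<theta>(1)]) (simp add: X2_0 x)
    then have n\<Omega>: "X2 \<theta> \<notin> \<Omega>" using \<open>open \<Omega>\<close> by (simp add: frontier_def interior_open)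
    \<comment> \<open>An exit point is a frontier point, so it has a chart; the outward control is
      the one of this chart, not of the last grid point.\<close>
    then have "\<not> ball (X2 \<theta>) e \<subseteq> \<Omega>" using centre_in_ball[of "X2 \<theta>" e] e by blast
    then have ch: "chart \<Omega> (X2 \<theta>) e (v (X2 \<theta>)) (\<phi> (X2 \<theta>)) (a1 (X2 \<theta>)) (a2 (X2 \<theta>)) (c (X2 \<theta>))"
      using alt[of "X2 \<theta>"] X2_cl[of \<theta>] X2_R[of \<theta>] \<theta> by auto
    have b: "b - \<theta> = 2 * D / e" "\<theta> \<le> b" using D e by (auto simp: b_def)
    have "X1 b \<notin> closure \<Omega>"
      unfolding X1_def
    proof (rule chart_exit[OF u1 \<theta>(2) b(2) ch e n\<Omega>])
      show "u1 s = a2 (X2 \<theta>)" if "\<theta> < s" "s < b" for s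
        using u1_exit[of s] that \<theta> by simp
      show "norm (trajectory h x1 u1 \<theta> - X2 \<theta>) \<le> D"
        using near_exit[of \<theta>] \<theta> by (simp add: X1_def D_def)
      show "D + M * (b - \<theta>) < e" using exit b by (simp add: D_def)
      show "2 * D \<le> e * (b - \<theta>)" using b e by simp
    qed (rule D)
    then have "exit_time \<Omega> X1 \<le> ereal b" using b \<theta> by (intro exit_time_le) auto
    also have "ereal b \<le> ereal \<theta> + ereal \<epsilon>" using \<epsilon>(2) by (simp add: b_def D_def)
    finally show ?thesis by (simp add: \<theta>)
  qed
  moreover have "\<exists>E\<in>lmeasurable. measure lebesgue E \<le> \<epsilon> \<and>
       (\<forall>t. 0 \<le> t \<and> t < T \<and> ereal t \<le> exit_time \<Omega> X2 \<and> t \<notin> E \<longrightarrow> u1 t = u2 t)"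
  proof -
    \<comment> \<open>The possible replacements during step i, of measure at most its
      budget.\<close>
    define F where "F i = {s \<in> {real i * r..<real (Suc i) * r}. s \<in> N \<and> m s - m (real i * r) < \<kappa> i}" for i
    define E where "E = (\<Union>i<n. F i)"
    have F: "F i \<in> sets lebesgue" "measure lebesgue (F i) \<le> \<kappa> i" for i
      unfolding F_def m_def
      by (rule budget_sets[OF N _ _ \<kappa>0] budget_measure_le[OF N _ _ \<kappa>0], use r in simp, use r in simp)+
    have "E \<in> sets lebesgue" using F(1) by (auto simp: E_def)
    moreover have "E \<subseteq> {0..real n * r}"
    proof
      fix s assume "s \<in> E"
      then obtain i where i: "i < n" "real i * r \<le> s" "s < real (Suc i) * r" by (auto simp: E_def F_def)
      have "0 \<le> real i * r" "real (Suc i) * r \<le> real n * r"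
        using i(1) r by (auto intro!: mult_right_mono simp del: of_nat_Suc)
      then show "s \<in> {0..real n * r}" using i by auto
    qed
    then have "bounded E" using bounded_closed_interval bounded_subset by blast
    ultimately have "E \<in> lmeasurable" by (intro bounded_set_imp_lmeasurable)
    moreover have "measure lebesgue E \<le> \<epsilon>"
    proof -
      have "measure lebesgue E \<le> (\<Sum>i<n. measure lebesgue (F i))"
        unfolding E_def by (rule measure_UNION_le) (use F in auto)
      also have "\<dots> \<le> (\<Sum>i<n. 4 / e * (q ^ n * d))"
      proof (rule sum_mono)
        fix i assume "i \<in> {..<n}"
        then have "q ^ i * d \<le> q ^ n * d" using qpow[of i n] d by simp
        then have "\<kappa> i \<le> 4 / e * (q ^ n * d)" unfolding \<kappa>_def using e by (intro mult_left_mono) auto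
        then show "measure lebesgue (F i) \<le> 4 / e * (q ^ n * d)" using F(2)[of i] by linarith
      qed
      also have "\<dots> \<le> \<epsilon>" using \<epsilon>(3) by simp
      finally show ?thesis .
    qed
    moreover have "u1 t = u2 t" if t: "0 \<le> t" "t < T" "ereal t \<le> exit_time \<Omega> X2" "t \<notin> E" for t
    proof -
      define i where "i = nat \<lfloor>t / r\<rfloor>"
      have i: "real i \<le> t / r" "t / r < real i + 1"
        using t(1) r by (auto simp: i_def floor_correct le_nat_iff)
      then have i': "real i * r \<le> t" "t < real (Suc i) * r" using r by (auto simp: field_simps)
      have "real i * r < real n * r" using i' t(2) T(2) by linarith
      then have "i < n" using r by simp
      then have "t \<notin> F i" using t(4) by (auto simp: E_def)
      then show ?thesis using u1_eq[OF t(3,1)] grid_eq[OF r i'] i' by (auto simp: F_def)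
    qed
    ultimately show ?thesis by blast
  qed
  moreover have "\<forall>t. 0 \<le> t \<and> t \<le> T \<and> ereal t \<le> exit_time \<Omega> X2 \<longrightarrow> X1 t \<in> closure \<Omega> \<and> norm (X1 t - X2 t) \<le> \<epsilon>"
    using near_exit \<epsilon>(1) by (meson order_trans)
  ultimately show ?thesis
    unfolding follows_def u1_def[symmetric] X1_def[symmetric] X2_def[symmetric] by blast
qed

text \<open>Order of the choices: the ball of radius 1 + M T, the chart radius e by compactness, the
  step r from e, the number n of steps, and only then the admissible distance d. Thus q ^ n is a
  constant when d is chosen.\<close>

lemma exit_tuning:
  assumes \<Omega>: "open \<Omega>" "C2_boundary \<Omega>"
    and ctr: "\<And>z. z \<in> frontier \<Omega> \<Longrightarrow> \<exists>a1\<in>C. \<exists>a2\<in>C. h z a1 \<bullet> outer_normal \<Omega> z < 0 \<and> h z a2 \<bullet> outer_normal \<Omega> z > 0"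
    and T: "T > 0" and \<epsilon>: "\<epsilon> > 0"
  shows "\<exists>\<delta>>0. \<forall>x1\<in>closure \<Omega> \<inter> ball z0 \<delta>. \<forall>x2\<in>closure \<Omega> \<inter> ball z0 \<delta>.
    \<exists>P\<in>tunings (controls C) (controls C). \<forall>\<alpha>\<in>controls C. follows \<Omega> T \<epsilon> x1 (P \<alpha>) x2 \<alpha>"
proof (cases "C = {}")
  case True
  \<comment> \<open>Without controls the claim on \<open>follows\<close> is vacuous, but a tuning
    must still be exhibited: the extensional function on the empty set.\<close>
  then have "controls C = {}" by (auto simp: controls_def PiE_def Pi_def)
  then have "(\<lambda>_. undefined) \<in> tunings (controls C) (controls C)" by (simp add: tunings_def)
  then show ?thesis using \<open>controls C = {}\<close> by (intro exI[of _ 1]) auto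
next
  case False
  \<comment> \<open>Fills in control values at points without a chart, because \<open>a1\<close> and
    \<open>a2\<close> must map every point into \<open>C\<close>.\<close>
  then obtain a0 where a0: "a0 \<in> C" by auto
  define R where "R = 1 + M * T"
  define K where "K = closure \<Omega> \<inter> cball z0 R"
  have "compact K" unfolding K_def by (intro closed_Int_compact) auto
  then obtain e where e: "e > 0" "\<And>x. x \<in> K \<Longrightarrow> ball x e \<subseteq> \<Omega> \<or> (\<exists>v \<phi> a1 a2 c. chart \<Omega> x e v \<phi> a1 a2 c)"
    using uniform_charts[OF \<Omega> _ _ ctr, of K] by (auto simp: K_def)
  define near where "near x \<longleftrightarrow> \<not> ball x e \<subseteq> \<Omega>" for x
  have "\<exists>v \<phi> a1 a2 c. a1 \<in> C \<and> a2 \<in> C \<and> (x \<in> K \<longrightarrow> near x \<longrightarrow> chart \<Omega> x e v \<phi> a1 a2 c)" for x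
  proof (cases "x \<in> K \<and> near x")
    case True
    then obtain v \<phi> a1 a2 c where "chart \<Omega> x e v \<phi> a1 a2 c"
      using e(2)[of x] unfolding near_def by blast
    with chart_bound(3,4)[OF this e(1)] show ?thesis by blast
  qed (use a0 in auto)
  then obtain v \<phi> a1 a2 c where ch: "\<And>x. a1 x \<in> C" "\<And>x. a2 x \<in> C"
    "\<And>x. x \<in> K \<Longrightarrow> near x \<Longrightarrow> chart \<Omega> x e (v x) (\<phi> x) (a1 x) (a2 x) (c x)"
    by metis
  define r where "r = min (1 / (2 * L)) (min (e / (4 * M)) (e / (16 * M * L)))"
  have r: "r > 0" using L_pos M_pos e by (simp add: r_def)
  have "r \<le> 1 / (2 * L)" "r \<le> e / (4 * M)" "r \<le> e / (16 * M * L)" by (auto simp: r_def)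
  then have rs: "L * r \<le> 1 / 2" "M * r \<le> e / 4" "16 * M * L * r \<le> e"
    using L_pos M_pos by (auto simp: field_simps)
  obtain n :: nat where "T / r \<le> real n" using real_arch_simple by blast
  then have n: "T \<le> real n * r" using r by (simp add: pos_divide_le_eq)
  define q where "q = 2 * (1 + 8 * M / e)"
  have q1: "q \<ge> 1" using M_pos e by (simp add: q_def)
  \<comment> \<open>The summands are the coefficients of the four errors at distance D': the
    distance, the motion during the exit delay, the delay, and the sum of the budgets. A bound on D'
    * W controls all of them.\<close>
  define W where "W = 1 + 2 * M / e + 2 / e + 4 * real n / e"
  have W: "W > 0" using M_pos e by (simp add: W_def add_pos_nonneg)
  define d where "d = min (e / 8) \<epsilon> / (q ^ Suc n * W)"
  have d: "d > 0" using e \<epsilon> q1 W by (simp add: d_def)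
  have "q ^ Suc n * d * W = min (e / 8) \<epsilon>" using W q1 by (simp add: d_def)
  moreover have "q ^ n * d \<le> q ^ Suc n * d"
    using q1 d power_increasing[of n "Suc n" q] by (intro mult_right_mono) auto
  moreover have "0 < q ^ n * d" using q1 d by simp
  moreover define D where "D = q ^ n * d"
  moreover define D' where "D' = q ^ Suc n * d"
  ultimately have D: "0 < D" "D \<le> D'" "D' * W = min (e / 8) \<epsilon>" by auto
  have "D' * W = D' + M * (2 * D' / e) + 2 * D' / e + real n * (4 / e * D')"
    by (simp add: W_def algebra_simps)
  then have sum: "D' + M * (2 * D' / e) + 2 * D' / e + real n * (4 / e * D') \<le> e / 8"
    "D' + M * (2 * D' / e) + 2 * D' / e + real n * (4 / e * D') \<le> \<epsilon>"
    using D(3) by auto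
  have nn: "0 \<le> M * (2 * D' / e)" "0 \<le> 2 * D' / e" "0 \<le> real n * (4 / e * D')" "0 < D'"
    using M_pos e D by auto
  have mono: "M * (2 * D / e) \<le> M * (2 * D' / e)" "2 * D / e \<le> 2 * D' / e"
    "real n * (4 / e * D) \<le> real n * (4 / e * D')"
    using D(2) e M_pos by (auto intro!: mult_left_mono divide_right_mono)
  have bounds: "D \<le> w" "D' \<le> w" "D + M * (2 * D / e) \<le> w" "2 * D / e \<le> w" "real n * (4 / e * D) \<le> w"
    if "D' + p1 + p2 + p3 \<le> w" "p1 = M * (2 * D' / e)" "p2 = 2 * D' / e" "p3 = real n * (4 / e * D')" for w p1 p2 p3
  proof -
    have p: "0 \<le> p1" "0 \<le> p2" "0 \<le> p3" using nn that(2-4) by auto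
    show "D \<le> w" "D' \<le> w" using p that(1) D(2) by linarith+
    have "D + M * (2 * D / e) \<le> D' + p1" unfolding that(2) using D(2) mono(1) by (rule add_mono)
    then show "D + M * (2 * D / e) \<le> w" using p that(1) by linarith
    show "2 * D / e \<le> w" using mono(2) p that(1) nn(4) unfolding that(3)[symmetric] by linarith
    show "real n * (4 / e * D) \<le> w" using mono(3) p that(1) nn(4) unfolding that(4)[symmetric] by linarith
  qed
  note b1 = bounds[OF sum(1) refl refl refl] and b2 = bounds[OF sum(2) refl refl refl]
  \<comment> \<open>Two points within d / 2 of \<open>z0\<close> have distance at most d; the bound
    1 matches the summand 1 in \<open>R\<close>.\<close>
  define \<delta> where "\<delta> = min 1 (d / 2)"
  have "\<delta> > 0" using d by (simp add: \<delta>_def)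
  moreover have "\<exists>P\<in>tunings (controls C) (controls C). \<forall>\<alpha>\<in>controls C. follows \<Omega> T \<epsilon> x1 (P \<alpha>) x2 \<alpha>"
    if x: "x1 \<in> closure \<Omega> \<inter> ball z0 \<delta>" "x2 \<in> closure \<Omega> \<inter> ball z0 \<delta>" for x1 x2
  proof
    let ?\<kappa> = "\<lambda>i. 4 / e * (q ^ i * d)"
    let ?P = "\<lambda>\<alpha>\<in>controls C. tuned \<Omega> r near v c a1 a2 ?\<kappa> x2 \<alpha>"
    have rng: "range a1 \<subseteq> C" "range a2 \<subseteq> C" using ch by auto
    show "?P \<in> tunings (controls C) (controls C)"
      unfolding tunings_def using tuned_controls[OF _ rng] tuned_nonanticipating[OF r] by auto
    show "\<forall>\<alpha>\<in>controls C. follows \<Omega> T \<epsilon> x1 (?P \<alpha>) x2 \<alpha>"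
    proof
      fix \<alpha> assume \<alpha>: "\<alpha> \<in> controls C"
      have "norm (x1 - x2) \<le> d"
        using x dist_triangle3[of x1 x2 z0] by (auto simp: \<delta>_def dist_norm)
      moreover have "dist z0 x2 + M * T \<le> R" using x by (auto simp: R_def \<delta>_def)
      ultimately have "follows \<Omega> T \<epsilon> x1 (tuned \<Omega> r near v c a1 a2 ?\<kappa> x2 \<alpha>) x2 \<alpha>"
        unfolding q_def
      proof (intro tuned_follows[where \<phi> = \<phi> and R = R and ?z0.0 = z0 and n = n, OF \<Omega>(1) e(1) d r rng],
          fold q_def D_def D'_def)
        show "\<not> near x \<and> ball x e \<subseteq> \<Omega> \<or> near x \<and> chart \<Omega> x e (v x) (\<phi> x) (a1 x) (a2 x) (c x)"
          if "x \<in> closure \<Omega>" "dist z0 x \<le> R" for x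
          using that ch(3)[of x] by (auto simp: near_def K_def)
        show "D' \<le> e / 4" "D + M * (2 * D / e) < e" "D \<le> \<epsilon>" "2 * D / e \<le> \<epsilon>" "real n * (4 / e * D) \<le> \<epsilon>"
          using b1(2,3) b2(1,4,5) e(1) by auto
      qed (use x \<alpha> T n rs in auto)
      then show "follows \<Omega> T \<epsilon> x1 (?P \<alpha>) x2 \<alpha>" using \<alpha> by simp
    qed
  qed
  ultimately show ?thesis by blast
qed

end

section \<open>Costs\<close>

lemma tunings_compose:
  assumes "\<theta> \<in> tunings \<U> \<V>" "\<theta>' \<in> tunings \<V> \<W>"
  shows "(\<lambda>u\<in>\<U>. \<theta>' (\<theta> u)) \<in> tunings \<U> \<W>"
proof -
  have "\<theta> u \<in> \<V>" if "u \<in> \<U>" for u using assms(1) that by (auto simp: tunings_def)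
  then show ?thesis using assms by (auto simp: tunings_def PiE_iff)
qed

lemma uniform_continuity_Times:
  fixes \<psi> :: "'x::euclidean_space \<Rightarrow> 'y::euclidean_space \<Rightarrow> real"
  assumes c: "continuous_on (A \<times> B) (\<lambda>(x, y). \<psi> x y)" and cl: "closed A" "closed B" and "\<eta> > 0"
  shows "\<exists>\<rho>>0. \<forall>x\<in>A \<inter> cball x0 R. \<forall>x'\<in>A \<inter> cball x0 R. \<forall>y\<in>B \<inter> cball y0 R. \<forall>y'\<in>B \<inter> cball y0 R.
    norm (x - x') \<le> \<rho> \<longrightarrow> norm (y - y') \<le> \<rho> \<longrightarrow> \<bar>\<psi> x y - \<psi> x' y'\<bar> \<le> \<eta>"
proof -
  let ?K = "(A \<inter> cball x0 R) \<times> (B \<inter> cball y0 R)"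
  have "compact ?K" using cl by (intro compact_Times closed_Int_compact) auto
  moreover have "continuous_on ?K (\<lambda>(x, y). \<psi> x y)" by (rule continuous_on_subset[OF c]) auto
  ultimately have "uniformly_continuous_on ?K (\<lambda>(x, y). \<psi> x y)" by (intro compact_uniformly_continuous)
  then obtain d where d: "d > 0" "\<And>w w'. w \<in> ?K \<Longrightarrow> w' \<in> ?K \<Longrightarrow> dist w' w < d \<Longrightarrow>
      dist (case w' of (x, y) \<Rightarrow> \<psi> x y) (case w of (x, y) \<Rightarrow> \<psi> x y) < \<eta>"
    using \<open>\<eta> > 0\<close> unfolding uniformly_continuous_on_def by metis
  show ?thesis
  proof (intro exI[of _ "d / 3"] conjI ballI impI)
    fix x x' y y'
    assume xy: "x \<in> A \<inter> cball x0 R" "x' \<in> A \<inter> cball x0 R" "y \<in> B \<inter> cball y0 R" "y' \<in> B \<inter> cball y0 R"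
      "norm (x - x') \<le> d / 3" "norm (y - y') \<le> d / 3"
    have "dist (x, y) (x', y') \<le> norm (x - x') + norm (y - y')"
      using norm_Pair_le[of "x - x'" "y - y'"] by (simp add: dist_norm)
    then have "dist (x, y) (x', y') < d" using xy(5,6) d(1) by linarith
    then show "\<bar>\<psi> x y - \<psi> x' y'\<bar> \<le> \<eta>"
      using d(2)[of "(x', y')" "(x, y)"] xy by (auto simp: dist_real_def)
  qed (use d in auto)
qed

text \<open>The answer \<beta>' may depend on \<gamma> and on \<beta>: the strategy \<gamma>'
  imitates \<gamma> played against the tuned opponent. The bounds by \<open>c\<close> make the
  real-valued suprema and infima genuine.\<close>

lemma INF_SUP_le_plus:
  fixes J1 J2 :: "'s \<Rightarrow> 'b \<Rightarrow> real"
  assumes "S \<noteq> {}" "B \<noteq> {}"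
    and bd: "\<And>\<gamma> \<beta>. \<gamma> \<in> S \<Longrightarrow> \<beta> \<in> B \<Longrightarrow> \<bar>J1 \<gamma> \<beta>\<bar> \<le> c" "\<And>\<gamma> \<beta>. \<gamma> \<in> S \<Longrightarrow> \<beta> \<in> B \<Longrightarrow> \<bar>J2 \<gamma> \<beta>\<bar> \<le> c"
    and le: "\<And>\<gamma>. \<gamma> \<in> S \<Longrightarrow> \<exists>\<gamma>'\<in>S. \<forall>\<beta>\<in>B. \<exists>\<beta>'\<in>B. J1 \<gamma>' \<beta> \<le> J2 \<gamma> \<beta>' + \<epsilon>"
  shows "(INF \<gamma>\<in>S. SUP \<beta>\<in>B. J1 \<gamma> \<beta>) \<le> (INF \<gamma>\<in>S. SUP \<beta>\<in>B. J2 \<gamma> \<beta>) + \<epsilon>"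
proof -
  have bdd: "bdd_above (J1 \<gamma> ` B)" "bdd_above (J2 \<gamma> ` B)" if "\<gamma> \<in> S" for \<gamma>
    using bd[OF that] by (auto intro!: bdd_aboveI[of _ c] simp: abs_le_iff)
  have bdd_below: "bdd_below ((\<lambda>\<gamma>. SUP \<beta>\<in>B. J1 \<gamma> \<beta>) ` S)"
  proof (rule bdd_belowI[of _ "- c"])
    fix w assume "w \<in> (\<lambda>\<gamma>. SUP \<beta>\<in>B. J1 \<gamma> \<beta>) ` S"
    then obtain \<gamma> where \<gamma>: "\<gamma> \<in> S" "w = (SUP \<beta>\<in>B. J1 \<gamma> \<beta>)" by auto
    obtain \<beta> where \<beta>: "\<beta> \<in> B" using \<open>B \<noteq> {}\<close> by auto
    have "- c \<le> J1 \<gamma> \<beta>" using bd(1)[OF \<gamma>(1) \<beta>] by (simp add: abs_le_iff)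
    also have "\<dots> \<le> w" unfolding \<gamma>(2) by (rule cSUP_upper[OF \<beta> bdd(1)[OF \<gamma>(1)]])
    finally show "- c \<le> w" .
  qed
  have "(INF \<gamma>\<in>S. SUP \<beta>\<in>B. J1 \<gamma> \<beta>) - \<epsilon> \<le> (INF \<gamma>\<in>S. SUP \<beta>\<in>B. J2 \<gamma> \<beta>)"
  proof (rule cINF_greatest[OF \<open>S \<noteq> {}\<close>])
    fix \<gamma> assume \<gamma>: "\<gamma> \<in> S"
    obtain \<gamma>' where \<gamma>': "\<gamma>' \<in> S" "\<And>\<beta>. \<beta> \<in> B \<Longrightarrow> \<exists>\<beta>'\<in>B. J1 \<gamma>' \<beta> \<le> J2 \<gamma> \<beta>' + \<epsilon>"
      using le[OF \<gamma>] by blast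
    have "(INF \<gamma>\<in>S. SUP \<beta>\<in>B. J1 \<gamma> \<beta>) \<le> (SUP \<beta>\<in>B. J1 \<gamma>' \<beta>)"
      by (rule cINF_lower[OF bdd_below \<gamma>'(1)])
    also have "\<dots> \<le> (SUP \<beta>\<in>B. J2 \<gamma> \<beta>) + \<epsilon>"
    proof (rule cSUP_least[OF \<open>B \<noteq> {}\<close>])
      fix \<beta> assume "\<beta> \<in> B"
      then obtain \<beta>' where \<beta>': "\<beta>' \<in> B" "J1 \<gamma>' \<beta> \<le> J2 \<gamma> \<beta>' + \<epsilon>" using \<gamma>'(2) by blast
      then show "J1 \<gamma>' \<beta> \<le> (SUP \<beta>\<in>B. J2 \<gamma> \<beta>) + \<epsilon>"
        using cSUP_upper[OF \<beta>'(1) bdd(2)[OF \<gamma>]] by linarith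
    qed
    finally show "(INF \<gamma>\<in>S. SUP \<beta>\<in>B. J1 \<gamma> \<beta>) - \<epsilon> \<le> (SUP \<beta>\<in>B. J2 \<gamma> \<beta>)" by linarith
  qed
  then show ?thesis by linarith
qed

lemma exp_diff_le:
  fixes l :: real
  assumes "l > 0" "0 \<le> s" "0 \<le> t"
  shows "\<bar>exp (- l * s) - exp (- l * t)\<bar> \<le> l * \<bar>s - t\<bar>"
proof -
  have *: "\<bar>exp (- l * s) - exp (- l * t)\<bar> \<le> l * (t - s)" if st: "0 \<le> s" "s \<le> t" for s t
  proof -
    have "exp (- l * t) = exp (- l * s) * exp (- l * (t - s))"
      by (simp add: exp_add[symmetric] algebra_simps)
    then have "exp (- l * s) - exp (- l * t) = exp (- l * s) * (1 - exp (- l * (t - s)))"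
      by (simp add: algebra_simps)
    also have "\<dots> \<le> 1 * (l * (t - s))"
      using exp_ge_add_one_self[of "- l * (t - s)"] st assms(1)
      by (intro mult_mono) auto
    finally show ?thesis using st assms(1) by simp
  qed
  show ?thesis using *[of s t] *[of t s] assms by (cases "s \<le> t") (auto simp: abs_minus_commute)
qed

section \<open>The game and its costs\<close>

text \<open>Costs are bounded in absolute value instead of being nonnegative, so that the
  assumptions survive exchanging the players and negating the costs.\<close>

locale bounded_game =
  X: controlled_system "ctrlX G" "dynX G" M L + Y: controlled_system "ctrlY G" "dynY G" M L
  for G :: "('x::euclidean_space, 'y::euclidean_space, 'a::euclidean_space, 'b::euclidean_space) exit_game"
    and M L :: real +
  assumes domX: "open (domX G)" "C2_boundary (domX G)"
    and domY: "open (domY G)" "C2_boundary (domY G)"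
    and ctrX: "\<And>x. x \<in> frontier (domX G) \<Longrightarrow> \<exists>a1\<in>ctrlX G. \<exists>a2\<in>ctrlX G.
        dynX G x a1 \<bullet> outer_normal (domX G) x < 0 \<and> dynX G x a2 \<bullet> outer_normal (domX G) x > 0"
    and ctrY: "\<And>y. y \<in> frontier (domY G) \<Longrightarrow> \<exists>b1\<in>ctrlY G. \<exists>b2\<in>ctrlY G.
        dynY G y b1 \<bullet> outer_normal (domY G) y < 0 \<and> dynY G y b2 \<bullet> outer_normal (domY G) y > 0"
    and discount_pos: "discount G > 0"
    and running_cont: "continuous_on (UNIV \<times> UNIV \<times> ctrlX G \<times> ctrlY G) (\<lambda>(x, y, a, b). running G x y a b)"
    and running_bound: "\<And>x y a b. a \<in> ctrlX G \<Longrightarrow> b \<in> ctrlY G \<Longrightarrow> \<bar>running G x y a b\<bar> \<le> M"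
    and running_lip: "\<And>x1 x2 y1 y2 a b. a \<in> ctrlX G \<Longrightarrow> b \<in> ctrlY G \<Longrightarrow>
        \<bar>running G x1 y1 a b - running G x2 y2 a b\<bar> \<le> L * norm ((x1, y1) - (x2, y2))"
    and psiX_cont: "continuous_on (frontier (domX G) \<times> closure (domY G)) (\<lambda>(x, y). psiX G x y)"
    and psiY_cont: "continuous_on (closure (domX G) \<times> frontier (domY G)) (\<lambda>(x, y). psiY G x y)"
    and psiXY_cont: "continuous_on (frontier (domX G) \<times> frontier (domY G)) (\<lambda>(x, y). psiXY G x y)"
    and psiX_bound: "\<And>x y. x \<in> frontier (domX G) \<Longrightarrow> y \<in> closure (domY G) \<Longrightarrow> \<bar>psiX G x y\<bar> \<le> M"
    and psiY_bound: "\<And>x y. x \<in> closure (domX G) \<Longrightarrow> y \<in> frontier (domY G) \<Longrightarrow> \<bar>psiY G x y\<bar> \<le> M"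
    and psiXY_bound: "\<And>x y. x \<in> frontier (domX G) \<Longrightarrow> y \<in> frontier (domY G) \<Longrightarrow> \<bar>psiXY G x y\<bar> \<le> M"
    and psi_order: "\<And>x y. x \<in> frontier (domX G) \<Longrightarrow> y \<in> frontier (domY G) \<Longrightarrow>
        psiY G x y \<le> psiXY G x y \<and> psiXY G x y \<le> psiX G x y"
begin

definition discounted :: "'x \<Rightarrow> 'y \<Rightarrow> (real \<Rightarrow> 'a) \<Rightarrow> (real \<Rightarrow> 'b) \<Rightarrow> real \<Rightarrow> real" where
  "discounted x y \<alpha> \<beta> t =
     exp (- discount G * t) * running G (trajX G x \<alpha> t) (trajY G y \<beta> t) (\<alpha> t) (\<beta> t)"

definition terminal :: "'x \<Rightarrow> 'y \<Rightarrow> (real \<Rightarrow> 'a) \<Rightarrow> (real \<Rightarrow> 'b) \<Rightarrow> real \<Rightarrow> real" where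
  "terminal x y \<alpha> \<beta> t =
     (if exitX G x \<alpha> < exitY G y \<beta> then psiX G
      else if exitY G y \<beta> < exitX G x \<alpha> then psiY G else psiXY G) (trajX G x \<alpha> t) (trajY G y \<beta> t)"

lemma cost_finite:
  assumes "min (exitX G x \<alpha>) (exitY G y \<beta>) = ereal t"
  shows "cost G x y \<alpha> \<beta> = running_cost G (ereal t) x y \<alpha> \<beta> + exp (- discount G * t) * terminal x y \<alpha> \<beta> t"
  using assms by (simp add: cost_def Let_def terminal_def)

lemma cost_infinite:
  assumes "min (exitX G x \<alpha>) (exitY G y \<beta>) = \<infinity>"
  shows "cost G x y \<alpha> \<beta> = running_cost G \<infinity> x y \<alpha> \<beta>"
  using assms by (simp add: cost_def Let_def)

context
  fixes x :: 'x and y :: 'y and \<alpha> :: "real \<Rightarrow> 'a" and \<beta> :: "real \<Rightarrow> 'b"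
  assumes \<alpha>: "\<alpha> \<in> controlsX G" and \<beta>: "\<beta> \<in> controlsY G"
begin

lemma discounted_bound: "0 \<le> t \<Longrightarrow> \<bar>discounted x y \<alpha> \<beta> t\<bar> \<le> M * exp (- discount G * t)"
proof -
  assume t: "0 \<le> t"
  have "\<bar>running G (trajX G x \<alpha> t) (trajY G y \<beta> t) (\<alpha> t) (\<beta> t)\<bar> \<le> M"
    using \<alpha> \<beta> t X.controls_in Y.controls_in by (intro running_bound) (auto simp: controlsX_def controlsY_def)
  then have "exp (- discount G * t) * \<bar>running G (trajX G x \<alpha> t) (trajY G y \<beta> t) (\<alpha> t) (\<beta> t)\<bar> \<le> exp (- discount G * t) * M"
    by (intro mult_left_mono) auto
  then show ?thesis by (simp add: discounted_def abs_mult mult.commute)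
qed

lemma discounted_bound_const: "0 \<le> t \<Longrightarrow> \<bar>discounted x y \<alpha> \<beta> t\<bar> \<le> M"
proof -
  assume t: "0 \<le> t"
  have "M * exp (- discount G * t) \<le> M * 1"
    using t discount_pos X.M_pos by (intro mult_left_mono) auto
  then show ?thesis using discounted_bound[OF t] by linarith
qed

lemma discounted_measurable: "discounted x y \<alpha> \<beta> \<in> borel_measurable (lebesgue_on {0..})"
proof -
  let ?M = "lebesgue_on {0..} :: real measure"
  have [measurable]: "trajX G x \<alpha> \<in> borel_measurable ?M" "trajY G y \<beta> \<in> borel_measurable ?M"
    using X.trajectory_measurable Y.trajectory_measurable \<alpha> \<beta>
    by (auto simp: trajX_def trajY_def controlsX_def controlsY_def)
  have [measurable]: "\<alpha> \<in> borel_measurable ?M" "\<beta> \<in> borel_measurable ?M"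
    using \<alpha> \<beta> by (auto simp: controlsX_def controlsY_def controls_def)
  have "(\<lambda>t. (case (trajX G x \<alpha> t, trajY G y \<beta> t, \<alpha> t, \<beta> t) of (x, y, a, b) \<Rightarrow> running G x y a b)) \<in> borel_measurable ?M"
    by (rule measurable_continuous_compose[OF running_cont])
      (use \<alpha> \<beta> X.controls_in Y.controls_in in \<open>auto simp: controlsX_def controlsY_def intro!: borel_measurable_Pair\<close>)
  then have [measurable]: "(\<lambda>t. running G (trajX G x \<alpha> t) (trajY G y \<beta> t) (\<alpha> t) (\<beta> t)) \<in> borel_measurable ?M"
    by simp
  have [measurable]: "(\<lambda>t::real. exp (- discount G * t)) \<in> borel_measurable ?M"
    by (rule borel_measurable_lebesgue_on) simp
  show ?thesis unfolding discounted_def[abs_def] by measurable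
qed

lemma discounted_integrable: "0 \<le> a \<Longrightarrow> set_integrable lebesgue {a..b} (discounted x y \<alpha> \<beta>)"
  by (rule set_integrable_bounded_interval[OF discounted_measurable, of _ _ M]) (use discounted_bound_const in auto)

lemma discounted_integrable_tail: "0 \<le> a \<Longrightarrow> set_integrable lebesgue {a..} (discounted x y \<alpha> \<beta>)"
proof (rule measurable_bounded_by_integrable_imp_absolutely_integrable[where g = "\<lambda>t. M * exp (- discount G * t)"])
  assume a: "0 \<le> a"
  show "discounted x y \<alpha> \<beta> \<in> borel_measurable (lebesgue_on {a..})"
    by (rule measurable_restrict_mono[OF discounted_measurable]) (use a in auto)
  show "(\<lambda>t. M * exp (- discount G * t)) integrable_on {a..}"
    using has_integral_exp_minus_to_infinity[OF discount_pos, of a] by (intro integrable_on_mult_right) blast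
  show "norm (discounted x y \<alpha> \<beta> t) \<le> M * exp (- discount G * t)" if "t \<in> {a..}" for t
    using discounted_bound[of t] a that by simp
qed auto

lemma discounted_integral_tail:
  assumes a: "0 \<le> a" and S: "S = {a..} \<or> (\<exists>b. S = {a..b})"
  shows "\<bar>integral S (discounted x y \<alpha> \<beta>)\<bar> \<le> M * exp (- discount G * a) / discount G"
proof -
  have hi: "((\<lambda>t. M * exp (- discount G * t)) has_integral M * (exp (- discount G * a) / discount G)) {a..}"
    by (intro has_integral_mult_right has_integral_exp_minus_to_infinity discount_pos)
  have int: "set_integrable lebesgue S (discounted x y \<alpha> \<beta>)"
    using S discounted_integrable[OF a] discounted_integrable_tail[OF a] by auto
  have sub: "S \<subseteq> {a..}" using S by auto
  have int': "(\<lambda>t. M * exp (- discount G * t)) integrable_on S"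
    using S hi by (auto intro!: integrable_continuous_interval continuous_intros)
  have "norm (integral S (discounted x y \<alpha> \<beta>)) \<le> integral S (\<lambda>t. M * exp (- discount G * t))"
    using sub a discounted_bound
    by (intro integral_norm_bound_integral int' set_lebesgue_integral_eq_integral[OF int]) auto
  also have "\<dots> \<le> integral {a..} (\<lambda>t. M * exp (- discount G * t))"
    using X.M_pos hi by (intro integral_subset_le sub int') auto
  also have "\<dots> = M * (exp (- discount G * a) / discount G)" using hi by (rule integral_unique)
  finally show ?thesis by simp
qed

text \<open>The first bound, from discounting, serves when the game goes on for long after \<tau>;
  the second when it stops within \<epsilon> after \<tau>.\<close>

lemma running_cost_diff:
  assumes \<tau>: "0 \<le> \<tau>" "ereal \<tau> \<le> \<sigma>"
  shows "\<bar>running_cost G \<sigma> x y \<alpha> \<beta> - integral {0..\<tau>} (discounted x y \<alpha> \<beta>)\<bar> \<le> M * exp (- discount G * \<tau>) / discount G"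
    and "\<sigma> \<le> ereal (\<tau> + \<epsilon>) \<Longrightarrow>
      \<bar>running_cost G \<sigma> x y \<alpha> \<beta> - integral {0..\<tau>} (discounted x y \<alpha> \<beta>)\<bar> \<le> M * \<epsilon>"
proof -
  let ?F = "discounted x y \<alpha> \<beta>"
  have rc: "running_cost G \<sigma> x y \<alpha> \<beta> = (LINT t:{t. 0 \<le> t \<and> ereal t \<le> \<sigma>}|lebesgue. ?F t)"
    by (simp add: running_cost_def discounted_def[abs_def])
  consider s where "\<sigma> = ereal s" "\<tau> \<le> s" | "\<sigma> = \<infinity>" using \<tau> by (cases \<sigma>) auto
  then have "\<bar>running_cost G \<sigma> x y \<alpha> \<beta> - integral {0..\<tau>} ?F\<bar> \<le> M * exp (- discount G * \<tau>) / discount G \<and>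
    (\<sigma> \<le> ereal (\<tau> + \<epsilon>) \<longrightarrow> \<bar>running_cost G \<sigma> x y \<alpha> \<beta> - integral {0..\<tau>} ?F\<bar> \<le> M * \<epsilon>)"
  proof cases
    case 1
    have "{t. 0 \<le> t \<and> ereal t \<le> \<sigma>} = {0..s}" using 1 by auto
    then have "running_cost G \<sigma> x y \<alpha> \<beta> = integral {0..s} ?F"
      using rc set_lebesgue_integral_eq_integral(2)[OF discounted_integrable[of 0 s]] by simp
    moreover have "integral {0..\<tau>} ?F + integral {\<tau>..s} ?F = integral {0..s} ?F"
      using \<tau> 1 set_lebesgue_integral_eq_integral(1)[OF discounted_integrable[of 0 s]]
      by (intro Henstock_Kurzweil_Integration.integral_combine) auto
    ultimately have eq: "running_cost G \<sigma> x y \<alpha> \<beta> - integral {0..\<tau>} ?F = integral {\<tau>..s} ?F" by simp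
    have "\<bar>integral {\<tau>..s} ?F\<bar> \<le> M * \<epsilon>" if "\<sigma> \<le> ereal (\<tau> + \<epsilon>)"
    proof -
      have "norm (integral {\<tau>..s} ?F) \<le> M * (s - \<tau>)"
        using 1 \<tau> discounted_bound_const by (intro norm_integral_le_const discounted_integrable) auto
      also have "\<dots> \<le> M * \<epsilon>" using that 1 X.M_pos by (intro mult_left_mono) auto
      finally show ?thesis by simp
    qed
    then show ?thesis using eq discounted_integral_tail[OF \<tau>(1), of "{\<tau>..s}"] by auto
  next
    case 2
    have "{t. 0 \<le> t \<and> ereal t \<le> \<sigma>} = {0..}" using 2 by auto
    then have "running_cost G \<sigma> x y \<alpha> \<beta> = integral {0..} ?F"
      using rc set_lebesgue_integral_eq_integral(2)[OF discounted_integrable_tail[of 0]] by simp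
    also have "{0..} = {0..\<tau>} \<union> {\<tau>..}" using \<tau> by auto
    also have "integral \<dots> ?F = integral {0..\<tau>} ?F + integral {\<tau>..} ?F"
    proof (rule integral_Un)
      have "{0..\<tau>} \<inter> {\<tau>..} = {\<tau>}" using \<tau> by auto
      then show "negligible ({0..\<tau>} \<inter> {\<tau>..})" by simp
    qed (use \<tau> discounted_integrable discounted_integrable_tail in \<open>auto intro: set_lebesgue_integral_eq_integral\<close>)
    finally show ?thesis using discounted_integral_tail[OF \<tau>(1), of "{\<tau>..}"] 2 by auto
  qed
  then show "\<bar>running_cost G \<sigma> x y \<alpha> \<beta> - integral {0..\<tau>} ?F\<bar> \<le> M * exp (- discount G * \<tau>) / discount G"
    "\<sigma> \<le> ereal (\<tau> + \<epsilon>) \<Longrightarrow> \<bar>running_cost G \<sigma> x y \<alpha> \<beta> - integral {0..\<tau>} ?F\<bar> \<le> M * \<epsilon>" by auto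
qed

lemma exit_points:
  assumes x: "x \<in> closure (domX G)" and y: "y \<in> closure (domY G)"
  shows "0 \<le> t \<Longrightarrow> ereal t \<le> exitX G x \<alpha> \<Longrightarrow> trajX G x \<alpha> t \<in> closure (domX G)"
    and "0 \<le> t \<Longrightarrow> ereal t \<le> exitY G y \<beta> \<Longrightarrow> trajY G y \<beta> t \<in> closure (domY G)"
    and "exitX G x \<alpha> = ereal t \<Longrightarrow> trajX G x \<alpha> t \<in> frontier (domX G)"
    and "exitY G y \<beta> = ereal t \<Longrightarrow> trajY G y \<beta> t \<in> frontier (domY G)"
proof -
  have X: "continuous_on {0..} (trajX G x \<alpha>)" "trajX G x \<alpha> 0 \<in> closure (domX G)"
    using X.trajectory_cont X.trajectory_0 \<alpha> x by (auto simp: trajX_def controlsX_def)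
  have Y: "continuous_on {0..} (trajY G y \<beta>)" "trajY G y \<beta> 0 \<in> closure (domY G)"
    using Y.trajectory_cont Y.trajectory_0 \<beta> y by (auto simp: trajY_def controlsY_def)
  show "0 \<le> t \<Longrightarrow> ereal t \<le> exitX G x \<alpha> \<Longrightarrow> trajX G x \<alpha> t \<in> closure (domX G)"
    unfolding exitX_def by (rule before_exit_time[OF X])
  show "0 \<le> t \<Longrightarrow> ereal t \<le> exitY G y \<beta> \<Longrightarrow> trajY G y \<beta> t \<in> closure (domY G)"
    unfolding exitY_def by (rule before_exit_time[OF Y])
  show "exitX G x \<alpha> = ereal t \<Longrightarrow> trajX G x \<alpha> t \<in> frontier (domX G)"
    unfolding exitX_def by (rule exit_time_frontier[OF X domX(1)])
  show "exitY G y \<beta> = ereal t \<Longrightarrow> trajY G y \<beta> t \<in> frontier (domY G)"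
    unfolding exitY_def by (rule exit_time_frontier[OF Y domY(1)])
qed

lemma exits_nonneg: "0 \<le> exitX G x \<alpha>" "0 \<le> exitY G y \<beta>"
  by (auto simp: exitX_def exitY_def exit_time_nonneg)

lemma terminal_cases:
  assumes xy: "x \<in> closure (domX G)" "y \<in> closure (domY G)"
    and t: "min (exitX G x \<alpha>) (exitY G y \<beta>) = ereal t"
  obtains (X) "exitX G x \<alpha> < exitY G y \<beta>" "trajX G x \<alpha> t \<in> frontier (domX G)" "trajY G y \<beta> t \<in> closure (domY G)"
      "terminal x y \<alpha> \<beta> t = psiX G (trajX G x \<alpha> t) (trajY G y \<beta> t)"
    | (Y) "exitY G y \<beta> < exitX G x \<alpha>" "trajX G x \<alpha> t \<in> closure (domX G)" "trajY G y \<beta> t \<in> frontier (domY G)"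
      "terminal x y \<alpha> \<beta> t = psiY G (trajX G x \<alpha> t) (trajY G y \<beta> t)"
    | (XY) "exitX G x \<alpha> = exitY G y \<beta>" "trajX G x \<alpha> t \<in> frontier (domX G)" "trajY G y \<beta> t \<in> frontier (domY G)"
      "terminal x y \<alpha> \<beta> t = psiXY G (trajX G x \<alpha> t) (trajY G y \<beta> t)"
proof -
  have t0: "0 \<le> t" using exits_nonneg t by (metis ereal_less_eq(5) min_def)
  note e = exit_points[OF xy, of t]
  consider "exitX G x \<alpha> < exitY G y \<beta>" | "exitY G y \<beta> < exitX G x \<alpha>" | "exitX G x \<alpha> = exitY G y \<beta>"
    using less_linear by blast
  then show thesis
  proof cases
    case 1
    then have "exitX G x \<alpha> = ereal t" using t by (simp add: min_absorb1)
    then show thesis using X e t0 1 less_imp_le[OF 1] by (simp add: terminal_def)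
  next
    case 2
    then have "exitY G y \<beta> = ereal t" using t by (simp add: min_absorb2)
    then show thesis using Y e t0 2 less_imp_le[OF 2] order_less_not_sym[OF 2] by (simp add: terminal_def)
  next
    case 3
    then have "exitX G x \<alpha> = ereal t" "exitY G y \<beta> = ereal t" using t by auto
    then show thesis using XY e t0 3 by (simp add: terminal_def)
  qed
qed

lemma terminal_bound:
  assumes xy: "x \<in> closure (domX G)" "y \<in> closure (domY G)"
    and t: "min (exitX G x \<alpha>) (exitY G y \<beta>) = ereal t"
  shows "\<bar>terminal x y \<alpha> \<beta> t\<bar> \<le> M"
  using xy t by (cases rule: terminal_cases) (auto intro: psiX_bound psiY_bound psiXY_bound)

text \<open>Whatever happens after \<open>T\<close> is discounted: 1 / \<open>discount G\<close>
  accounts for the remaining integral, the summand 1 for the terminal cost.\<close>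

lemma cost_diff:
  assumes xy: "x \<in> closure (domX G)" "y \<in> closure (domY G)"
    and T: "0 \<le> T" "ereal T \<le> exitX G x \<alpha>" "ereal T \<le> exitY G y \<beta>"
  shows "\<bar>cost G x y \<alpha> \<beta> - integral {0..T} (discounted x y \<alpha> \<beta>)\<bar> \<le> M * (1 / discount G + 1) * exp (- discount G * T)"
proof -
  define \<tau> where "\<tau> = min (exitX G x \<alpha>) (exitY G y \<beta>)"
  have T\<tau>: "ereal T \<le> \<tau>" using T by (simp add: \<tau>_def)
  have 1: "\<bar>running_cost G \<tau> x y \<alpha> \<beta> - integral {0..T} (discounted x y \<alpha> \<beta>)\<bar> \<le> M * exp (- discount G * T) / discount G"
    by (rule running_cost_diff(1)[OF T(1) T\<tau>])
  have "\<bar>cost G x y \<alpha> \<beta> - running_cost G \<tau> x y \<alpha> \<beta>\<bar> \<le> M * exp (- discount G * T)"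
  proof (cases \<tau>)
    case (real t)
    then have t: "min (exitX G x \<alpha>) (exitY G y \<beta>) = ereal t" by (simp add: \<tau>_def)
    have "T \<le> t" using T\<tau> real by simp
    then have "exp (- discount G * t) * \<bar>terminal x y \<alpha> \<beta> t\<bar> \<le> exp (- discount G * T) * M"
      using discount_pos terminal_bound[OF xy t] by (intro mult_mono) auto
    then show ?thesis using cost_finite[OF t] real by (simp add: abs_mult mult.commute)
  next
    case PInf
    then show ?thesis using cost_infinite[of x \<alpha> y \<beta>] X.M_pos by (simp add: \<tau>_def)
  qed (use T\<tau> in auto)
  then have "\<bar>cost G x y \<alpha> \<beta> - integral {0..T} (discounted x y \<alpha> \<beta>)\<bar> \<le>
      M * exp (- discount G * T) / discount G + M * exp (- discount G * T)"
    using 1 by linarith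
  then show ?thesis by (simp add: algebra_simps)
qed

lemma cost_bound:
  assumes xy: "x \<in> closure (domX G)" "y \<in> closure (domY G)"
  shows "\<bar>cost G x y \<alpha> \<beta>\<bar> \<le> M * (1 / discount G + 1)"
  using cost_diff[OF xy, of 0] exits_nonneg by (simp add: zero_ereal_def)

end

end

section \<open>Continuity of the values\<close>

definition oscillation_le ::
    "('x::euclidean_space \<Rightarrow> 'y::euclidean_space \<Rightarrow> real) \<Rightarrow> 'x set \<Rightarrow> 'y set \<Rightarrow> real \<Rightarrow> real \<Rightarrow> bool" where
  "oscillation_le \<psi> A B \<rho> \<eta> \<longleftrightarrow> (\<forall>x\<in>A. \<forall>x'\<in>A. \<forall>y\<in>B. \<forall>y'\<in>B.
    norm (x - x') \<le> \<rho> \<longrightarrow> norm (y - y') \<le> \<rho> \<longrightarrow> \<bar>\<psi> x y - \<psi> x' y'\<bar> \<le> \<eta>)"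

lemma oscillation_leD:
  assumes "oscillation_le \<psi> A B \<rho> \<eta>" "x \<in> A" "x' \<in> A" "y \<in> B" "y' \<in> B" "norm (x - x') \<le> \<rho>" "norm (y - y') \<le> \<rho>"
  shows "\<psi> x y \<le> \<psi> x' y' + \<eta>"
  using assms unfolding oscillation_le_def by (smt (verit, best))

lemma oscillation_le_mono: "oscillation_le \<psi> A B \<rho> \<eta> \<Longrightarrow> \<rho>' \<le> \<rho> \<Longrightarrow> oscillation_le \<psi> A B \<rho>' \<eta>"
  unfolding oscillation_le_def by (meson order_trans)

section \<open>Comparison of the costs of two pairs of trajectories\<close>

context bounded_game
begin

text \<open>Say that the first pair exits through \<open>Y\<close>, \<open>XY\<close> or \<open>X\<close>, according to the boundary reached.
  In the order \<open>Y < XY < X\<close>, the exit of the first pair is not later than that of the second pair, and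
  \<open>psi_order\<close> makes the terminal cost monotone in this order.\<close>

lemma terminal_le:
  assumes c: "\<alpha>1 \<in> controlsX G" "\<beta>1 \<in> controlsY G" "\<alpha>2 \<in> controlsX G" "\<beta>2 \<in> controlsY G"
    and xy1: "x1 \<in> closure (domX G)" "y1 \<in> closure (domY G)"
    and xy2: "x2 \<in> closure (domX G)" "y2 \<in> closure (domY G)"
    and t1: "min (exitX G x1 \<alpha>1) (exitY G y1 \<beta>1) = ereal t1"
    and t2: "min (exitX G x2 \<alpha>2) (exitY G y2 \<beta>2) = ereal t2"
    and order: "exitX G x2 \<alpha>2 < exitY G y1 \<beta>1 \<Longrightarrow> exitX G x2 \<alpha>2 < exitY G y2 \<beta>2"
      "exitY G y1 \<beta>1 < exitX G x2 \<alpha>2 \<Longrightarrow> exitY G y1 \<beta>1 < exitX G x1 \<alpha>1"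
      "exitX G x2 \<alpha>2 = exitY G y1 \<beta>1 \<Longrightarrow> exitY G y1 \<beta>1 \<le> exitX G x1 \<alpha>1 \<and> exitX G x2 \<alpha>2 \<le> exitY G y2 \<beta>2"
    and osc: "oscillation_le (psiX G) (frontier (domX G) \<inter> KX) (closure (domY G) \<inter> KY) \<rho> \<eta>"
      "oscillation_le (psiY G) (closure (domX G) \<inter> KX) (frontier (domY G) \<inter> KY) \<rho> \<eta>"
      "oscillation_le (psiXY G) (frontier (domX G) \<inter> KX) (frontier (domY G) \<inter> KY) \<rho> \<eta>"
    and K: "trajX G x1 \<alpha>1 t1 \<in> KX" "trajX G x2 \<alpha>2 t2 \<in> KX" "trajY G y1 \<beta>1 t1 \<in> KY" "trajY G y2 \<beta>2 t2 \<in> KY"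
    and close: "norm (trajX G x1 \<alpha>1 t1 - trajX G x2 \<alpha>2 t2) \<le> \<rho>" "norm (trajY G y1 \<beta>1 t1 - trajY G y2 \<beta>2 t2) \<le> \<rho>"
  shows "terminal x1 y1 \<alpha>1 \<beta>1 t1 \<le> terminal x2 y2 \<alpha>2 \<beta>2 t2 + 2 * \<eta>"
proof -
  define X1 X2 Y1 Y2 where "X1 = trajX G x1 \<alpha>1 t1" and "X2 = trajX G x2 \<alpha>2 t2"
    and "Y1 = trajY G y1 \<beta>1 t1" and "Y2 = trajY G y2 \<beta>2 t2"
  have \<rho>: "\<rho> \<ge> 0" using close(1) norm_ge_zero order_trans by blast
  have in_cl: "x \<in> frontier (domX G) \<Longrightarrow> x \<in> closure (domX G)" "y \<in> frontier (domY G) \<Longrightarrow> y \<in> closure (domY G)" for x y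
    by (auto simp: frontier_def)
  note K = K[folded X1_def X2_def Y1_def Y2_def] and close = close[folded X1_def X2_def Y1_def Y2_def]
  define T1 where "T1 = terminal x1 y1 \<alpha>1 \<beta>1 t1"
  define T2 where "T2 = terminal x2 y2 \<alpha>2 \<beta>2 t2"
  have d1: "(exitX G x1 \<alpha>1 < exitY G y1 \<beta>1 \<and> X1 \<in> frontier (domX G) \<and> Y1 \<in> closure (domY G) \<and> T1 = psiX G X1 Y1) \<or>
      (exitY G y1 \<beta>1 < exitX G x1 \<alpha>1 \<and> X1 \<in> closure (domX G) \<and> Y1 \<in> frontier (domY G) \<and> T1 = psiY G X1 Y1) \<or>
      (exitX G x1 \<alpha>1 = exitY G y1 \<beta>1 \<and> X1 \<in> frontier (domX G) \<and> Y1 \<in> frontier (domY G) \<and> T1 = psiXY G X1 Y1)"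
    unfolding X1_def Y1_def T1_def by (rule terminal_cases[OF c(1,2) xy1 t1]) simp_all
  have d2: "(exitX G x2 \<alpha>2 < exitY G y2 \<beta>2 \<and> X2 \<in> frontier (domX G) \<and> Y2 \<in> closure (domY G) \<and> T2 = psiX G X2 Y2) \<or>
      (exitY G y2 \<beta>2 < exitX G x2 \<alpha>2 \<and> X2 \<in> closure (domX G) \<and> Y2 \<in> frontier (domY G) \<and> T2 = psiY G X2 Y2) \<or>
      (exitX G x2 \<alpha>2 = exitY G y2 \<beta>2 \<and> X2 \<in> frontier (domX G) \<and> Y2 \<in> frontier (domY G) \<and> T2 = psiXY G X2 Y2)"
    unfolding X2_def Y2_def T2_def by (rule terminal_cases[OF c(3,4) xy2 t2]) simp_all
  have oX: "psiX G X1 Y1 \<le> psiX G X2 Y2 + \<eta>"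
    if "X1 \<in> frontier (domX G)" "X2 \<in> frontier (domX G)" "Y1 \<in> closure (domY G)" "Y2 \<in> closure (domY G)"
    by (rule oscillation_leD[OF osc(1) _ _ _ _ close]) (use that K in auto)
  have oY: "psiY G X1 Y1 \<le> psiY G X2 Y' + \<eta>"
    if "X1 \<in> closure (domX G)" "X2 \<in> closure (domX G)" "Y1 \<in> frontier (domY G)" "Y' \<in> frontier (domY G)"
      "Y' \<in> KY" "norm (Y1 - Y') \<le> \<rho>" for Y'
    by (rule oscillation_leD[OF osc(2) _ _ _ _ close(1)]) (use that K in auto)
  have oX': "psiX G X2 Y1 \<le> psiX G X2 Y2 + \<eta>"
    if "X2 \<in> frontier (domX G)" "Y1 \<in> closure (domY G)" "Y2 \<in> closure (domY G)"
    by (rule oscillation_leD[OF osc(1) _ _ _ _ _ close(2)]) (use that K \<rho> in auto)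
  have oXY: "psiXY G X1 Y1 \<le> psiXY G X2 Y2 + \<eta>"
    if "X1 \<in> frontier (domX G)" "X2 \<in> frontier (domX G)" "Y1 \<in> frontier (domY G)" "Y2 \<in> frontier (domY G)"
    by (rule oscillation_leD[OF osc(3) _ _ _ _ close]) (use that K in auto)
  have \<eta>: "\<eta> \<ge> 0" if "X2 \<in> closure (domX G)" "Y1 \<in> frontier (domY G)"
    using oscillation_leD[OF osc(2), of X2 X2 Y1 Y1] that K \<rho> by simp
  have \<eta>': "\<eta> \<ge> 0" if "X1 \<in> frontier (domX G)" "Y1 \<in> closure (domY G)"
    using oscillation_leD[OF osc(1), of X1 X1 Y1 Y1] that K \<rho> by simp
  \<comment> \<open>Together these exclude exactly the combinations in which the exit of the first
    pair comes after that of the second in the order of the exits.\<close>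
  have no: "\<not> (exitX G x1 \<alpha>1 < exitY G y1 \<beta>1 \<and> exitY G y2 \<beta>2 \<le> exitX G x2 \<alpha>2)"
    "\<not> (exitX G x1 \<alpha>1 \<le> exitY G y1 \<beta>1 \<and> exitY G y2 \<beta>2 < exitX G x2 \<alpha>2)"
    using order by (metis less_linear not_le order_less_imp_le)+
  have "T1 \<le> T2 + 2 * \<eta>"
    using d1
  proof (elim disjE conjE)
    assume 1: "exitX G x1 \<alpha>1 < exitY G y1 \<beta>1" "X1 \<in> frontier (domX G)" "Y1 \<in> closure (domY G)" "T1 = psiX G X1 Y1"
    then have "exitX G x2 \<alpha>2 < exitY G y2 \<beta>2" using no(1) by simp
    then have "X2 \<in> frontier (domX G)" "Y2 \<in> closure (domY G)" "T2 = psiX G X2 Y2"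
      using d2 by auto
    then show ?thesis using 1 oX \<eta>' by simp
  next
    assume 1: "exitX G x1 \<alpha>1 = exitY G y1 \<beta>1" "X1 \<in> frontier (domX G)" "Y1 \<in> frontier (domY G)" "T1 = psiXY G X1 Y1"
    then have "\<not> exitY G y2 \<beta>2 < exitX G x2 \<alpha>2" using no(2) by simp
    then have "X2 \<in> frontier (domX G) \<and> Y2 \<in> closure (domY G) \<and> T2 = psiX G X2 Y2 \<or>
        X2 \<in> frontier (domX G) \<and> Y2 \<in> frontier (domY G) \<and> T2 = psiXY G X2 Y2"
      using d2 by blast
    then show ?thesis
    proof (elim disjE conjE)
      assume 2: "X2 \<in> frontier (domX G)" "Y2 \<in> closure (domY G)" "T2 = psiX G X2 Y2"
      have "psiX G X1 Y1 \<le> psiX G X2 Y2 + \<eta>" using oX 1 2 in_cl by simp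
      moreover have "psiXY G X1 Y1 \<le> psiX G X1 Y1" using psi_order 1 by simp
      ultimately show ?thesis using 1 2 \<eta>' in_cl by simp
    next
      assume 2: "X2 \<in> frontier (domX G)" "Y2 \<in> frontier (domY G)" "T2 = psiXY G X2 Y2"
      have "psiXY G X1 Y1 \<le> psiXY G X2 Y2 + \<eta>" using oXY 1 2 by simp
      then show ?thesis using 1 2 \<eta>' in_cl by simp
    qed
  next
    assume 1: "exitY G y1 \<beta>1 < exitX G x1 \<alpha>1" "X1 \<in> closure (domX G)" "Y1 \<in> frontier (domY G)" "T1 = psiY G X1 Y1"
    show ?thesis
      using d2
    proof (elim disjE conjE)
      assume 2: "X2 \<in> frontier (domX G)" "Y2 \<in> closure (domY G)" "T2 = psiX G X2 Y2"
      \<comment> \<open>The case responsible for 2 \<eta>: \<open>X1\<close> and \<open>Y2\<close>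
        are only known to lie in the closures, but the mixed point (X2, Y1) is on both frontiers,
        where the three costs are ordered.\<close>
      have "psiY G X1 Y1 \<le> psiY G X2 Y1 + \<eta>" using oY[of Y1] 1 2 in_cl \<rho> K by simp
      moreover have "psiX G X2 Y1 \<le> psiX G X2 Y2 + \<eta>" using oX' 1 2 in_cl by simp
      moreover have "psiY G X2 Y1 \<le> psiXY G X2 Y1" "psiXY G X2 Y1 \<le> psiX G X2 Y1" using psi_order 1 2 by simp_all
      ultimately show ?thesis using 1 2 by simp
    next
      assume 2: "X2 \<in> frontier (domX G)" "Y2 \<in> frontier (domY G)" "T2 = psiXY G X2 Y2"
      have "psiY G X1 Y1 \<le> psiY G X2 Y2 + \<eta>" using oY[of Y2] 1 2 in_cl close K by simp
      moreover have "psiY G X2 Y2 \<le> psiXY G X2 Y2" using psi_order 2 by simp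
      ultimately show ?thesis using 1 2 \<eta> in_cl by simp
    next
      assume 2: "X2 \<in> closure (domX G)" "Y2 \<in> frontier (domY G)" "T2 = psiY G X2 Y2"
      then show ?thesis using oY[of Y2] 1 close K \<eta> by simp
    qed
  qed
  then show ?thesis by (simp add: T1_def T2_def)
qed

text \<open>Off a set of measure 2 \<epsilon> both pairs use the same controls and the Lipschitz
  bound applies, with \<epsilon> from each player; on that set each integrand is only bounded by M.
  The directions are opposite: x1 follows x2, but y2 follows y1.\<close>

lemma integral_discounted_le:
  assumes c: "\<alpha>1 \<in> controlsX G" "\<beta>1 \<in> controlsY G" "\<alpha>2 \<in> controlsX G" "\<beta>2 \<in> controlsY G"
    and fX: "X.follows (domX G) T \<epsilon> x1 \<alpha>1 x2 \<alpha>2"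
    and fY: "Y.follows (domY G) T \<epsilon> y2 \<beta>2 y1 \<beta>1"
    and \<tau>: "0 \<le> \<tau>" "\<tau> \<le> T" "ereal \<tau> \<le> exitX G x2 \<alpha>2" "ereal \<tau> \<le> exitY G y1 \<beta>1"
  shows "integral {0..\<tau>} (discounted x1 y1 \<alpha>1 \<beta>1) \<le>
    integral {0..\<tau>} (discounted x2 y2 \<alpha>2 \<beta>2) + 2 * L * \<epsilon> * T + 4 * M * \<epsilon>"
proof -
  let ?F1 = "discounted x1 y1 \<alpha>1 \<beta>1" and ?F2 = "discounted x2 y2 \<alpha>2 \<beta>2"
  have le_exit: "ereal t \<le> exitX G x2 \<alpha>2" "ereal t \<le> exitY G y1 \<beta>1" if "t \<le> \<tau>" for t
    using \<tau>(3,4) that by (meson ereal_less_eq(3) order_trans)+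
  have dX: "norm (trajX G x1 \<alpha>1 t - trajX G x2 \<alpha>2 t) \<le> \<epsilon>" if "0 \<le> t" "t \<le> \<tau>" for t
    using fX le_exit(1)[of t] that \<tau>(2) by (auto simp: X.follows_def exitX_def trajX_def)
  have dY: "norm (trajY G y2 \<beta>2 t - trajY G y1 \<beta>1 t) \<le> \<epsilon>" if "0 \<le> t" "t \<le> \<tau>" for t
    using fY le_exit(2)[of t] that \<tau>(2) by (auto simp: Y.follows_def exitY_def trajY_def)
  have \<epsilon>0: "\<epsilon> \<ge> 0" using dX[of 0] \<tau>(1) norm_ge_zero order_trans by blast
  obtain E1 where E1: "E1 \<in> lmeasurable" "measure lebesgue E1 \<le> \<epsilon>"
      "\<And>t. 0 \<le> t \<Longrightarrow> t < T \<Longrightarrow> ereal t \<le> exitX G x2 \<alpha>2 \<Longrightarrow> t \<notin> E1 \<Longrightarrow> \<alpha>1 t = \<alpha>2 t"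
    using fX by (auto simp: X.follows_def exitX_def trajX_def)
  obtain E2 where E2: "E2 \<in> lmeasurable" "measure lebesgue E2 \<le> \<epsilon>"
      "\<And>t. 0 \<le> t \<Longrightarrow> t < T \<Longrightarrow> ereal t \<le> exitY G y1 \<beta>1 \<Longrightarrow> t \<notin> E2 \<Longrightarrow> \<beta>2 t = \<beta>1 t"
    using fY by (auto simp: Y.follows_def exitY_def trajY_def)
  define E where "E = (E1 \<union> E2) \<inter> {0..\<tau>}"
  have E: "E \<in> sets lebesgue" "E \<subseteq> {0..\<tau>}"
    unfolding E_def using E1(1) E2(1) by (auto intro!: sets.Int sets.Un dest: fmeasurableD)
  have "measure lebesgue E \<le> measure lebesgue (E1 \<union> E2)"
    using E E1(1) E2(1) by (intro measure_mono_fmeasurable fmeasurable.Un) (auto simp: E_def)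
  also have "\<dots> \<le> measure lebesgue E1 + measure lebesgue E2"
    using E1(1) E2(1) by (intro measure_Un_le) (auto dest: fmeasurableD)
  finally have mE: "measure lebesgue E \<le> 2 * \<epsilon>" using E1(2) E2(2) by simp
  have int: "set_integrable lebesgue {0..\<tau>} ?F1" "set_integrable lebesgue {0..\<tau>} ?F2"
    using c by (auto intro: discounted_integrable)
  have "integral {0..\<tau>} ?F1 - integral {0..\<tau>} ?F2 = integral {0..\<tau>} (\<lambda>t. ?F1 t - ?F2 t)"
    using int by (intro Henstock_Kurzweil_Integration.integral_diff[symmetric] set_lebesgue_integral_eq_integral)
  also have "\<dots> \<le> (2 * L * \<epsilon>) * (\<tau> - 0) + (2 * M) * measure lebesgue E"
  proof (rule integral_le_affine_indicator[OF _ \<tau>(1) E])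
    show "set_integrable lebesgue {0..\<tau>} (\<lambda>t. ?F1 t - ?F2 t)" using int by (rule set_integral_diff)
    fix t assume t: "0 < t" "t < \<tau>"
    show "?F1 t - ?F2 t \<le> 2 * L * \<epsilon> + 2 * M * indicator E t"
    proof (cases "t \<in> E")
      case True
      have "0 \<le> 2 * L * \<epsilon>" using \<epsilon>0 X.L_pos by simp
      then show ?thesis
        using True discounted_bound_const[OF c(1,2), of t x1 y1] discounted_bound_const[OF c(3,4), of t x2 y2] t by simp
    next
      case False
      then have eq: "\<alpha>1 t = \<alpha>2 t" "\<beta>2 t = \<beta>1 t"
        using E1(3)[of t] E2(3)[of t] t \<tau>(2) le_exit[of t] by (auto simp: E_def)
      have in_ctrl: "\<alpha>2 t \<in> ctrlX G" "\<beta>1 t \<in> ctrlY G"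
        using c t X.controls_in Y.controls_in by (auto simp: controlsX_def controlsY_def)
      let ?l1 = "running G (trajX G x1 \<alpha>1 t) (trajY G y1 \<beta>1 t) (\<alpha>2 t) (\<beta>1 t)"
      let ?l2 = "running G (trajX G x2 \<alpha>2 t) (trajY G y2 \<beta>2 t) (\<alpha>2 t) (\<beta>1 t)"
      have "\<bar>?l1 - ?l2\<bar> \<le> L * norm ((trajX G x1 \<alpha>1 t, trajY G y1 \<beta>1 t) - (trajX G x2 \<alpha>2 t, trajY G y2 \<beta>2 t))"
        by (rule running_lip[OF in_ctrl])
      also have "\<dots> \<le> L * (\<epsilon> + \<epsilon>)"
        using norm_Pair_le[of "trajX G x1 \<alpha>1 t - trajX G x2 \<alpha>2 t" "trajY G y1 \<beta>1 t - trajY G y2 \<beta>2 t"]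
          dX[of t] dY[of t] t X.L_pos by (intro mult_left_mono) (auto simp: norm_minus_commute)
      finally have l: "\<bar>?l1 - ?l2\<bar> \<le> L * (\<epsilon> + \<epsilon>)" .
      have "?F1 t - ?F2 t = exp (- discount G * t) * (?l1 - ?l2)"
        by (simp add: discounted_def eq algebra_simps)
      also have "\<dots> \<le> exp (- discount G * t) * \<bar>?l1 - ?l2\<bar>" by (intro mult_left_mono) auto
      also have "\<dots> \<le> 1 * \<bar>?l1 - ?l2\<bar>" using discount_pos t by (intro mult_right_mono) auto
      finally show ?thesis using l False by simp
    qed
  qed
  also have "\<dots> \<le> (2 * L * \<epsilon>) * T + (2 * M) * (2 * \<epsilon>)"
    using \<tau>(2) mE \<epsilon>0 X.L_pos X.M_pos by (intro add_mono mult_left_mono) auto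
  finally show ?thesis by simp
qed

text \<open>Up to the first exit of a leader both relations hold. If that is not before
  \<open>T\<close>, neither game ends before \<open>T\<close> and discounting finishes. Otherwise
  both games end within \<epsilon> after it. The 6 M splits into 4 M from
  \<open>integral_discounted_le\<close> and 2 M from the two remaining integrals;
  \<open>discount G * M\<close> comes from the different discount factors at the two exits.\<close>

lemma cost_le:
  assumes c: "\<alpha>1 \<in> controlsX G" "\<beta>1 \<in> controlsY G" "\<alpha>2 \<in> controlsX G" "\<beta>2 \<in> controlsY G"
    and xy1: "x1 \<in> closure (domX G)" "y1 \<in> closure (domY G)"
    and xy2: "x2 \<in> closure (domX G)" "y2 \<in> closure (domY G)"
    and T: "T > 0" and \<epsilon>: "\<epsilon> > 0"
    and fX: "X.follows (domX G) T \<epsilon> x1 \<alpha>1 x2 \<alpha>2"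
    and fY: "Y.follows (domY G) T \<epsilon> y2 \<beta>2 y1 \<beta>1"
    and osc: "oscillation_le (psiX G) (frontier (domX G) \<inter> cball x0 R) (closure (domY G) \<inter> cball y0 R) \<rho> \<eta>"
      "oscillation_le (psiY G) (closure (domX G) \<inter> cball x0 R) (frontier (domY G) \<inter> cball y0 R) \<rho> \<eta>"
      "oscillation_le (psiXY G) (frontier (domX G) \<inter> cball x0 R) (frontier (domY G) \<inter> cball y0 R) \<rho> \<eta>"
    and \<rho>: "(1 + 2 * M) * \<epsilon> \<le> \<rho>" and \<eta>: "\<eta> \<ge> 0"
    and R: "dist x0 x1 + M * (T + \<epsilon>) \<le> R" "dist x0 x2 + M * (T + \<epsilon>) \<le> R"
      "dist y0 y1 + M * (T + \<epsilon>) \<le> R" "dist y0 y2 + M * (T + \<epsilon>) \<le> R"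
  shows "cost G x1 y1 \<alpha>1 \<beta>1 \<le> cost G x2 y2 \<alpha>2 \<beta>2 + 2 * M * (1 / discount G + 1) * exp (- discount G * T)
    + (2 * L * T + 6 * M + discount G * M) * \<epsilon> + 2 * \<eta>"
proof -
  define p where "p = exitX G x1 \<alpha>1"
  define r where "r = exitY G y1 \<beta>1"
  define s where "s = exitX G x2 \<alpha>2"
  define q where "q = exitY G y2 \<beta>2"
  define \<tau> where "\<tau> = min s r"
  have nn: "0 \<le> s" "0 \<le> r" using exits_nonneg c by (auto simp: s_def r_def)
  \<comment> \<open>Up to \<open>T\<close> a follower stays in the closure as long as its leader has
    not exited.\<close>
  have pge: "min s (ereal T) \<le> p" and qge: "min r (ereal T) \<le> q"
  proof -
    have "ereal t \<le> p" if "0 \<le> t" "ereal t \<le> s" "t \<le> T" for t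
      unfolding p_def exitX_def
    proof (rule exit_time_ge)
      fix t' assume t': "0 \<le> t'" "t' < t"
      then have "ereal t' \<le> s" using that(2) by (meson ereal_less_eq(3) less_imp_le order_trans)
      then show "trajX G x1 \<alpha>1 t' \<in> closure (domX G)"
        using fX t' that by (auto simp: X.follows_def s_def exitX_def trajX_def)
    qed
    then show "min s (ereal T) \<le> p"
      using nn T by (cases s) (auto simp: min_def)
    have "ereal t \<le> q" if "0 \<le> t" "ereal t \<le> r" "t \<le> T" for t
      unfolding q_def exitY_def
    proof (rule exit_time_ge)
      fix t' assume t': "0 \<le> t'" "t' < t"
      then have "ereal t' \<le> r" using that(2) by (meson ereal_less_eq(3) less_imp_le order_trans)
      then show "trajY G y2 \<beta>2 t' \<in> closure (domY G)"
        using fY t' that by (auto simp: Y.follows_def r_def exitY_def trajY_def)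
    qed
    then show "min r (ereal T) \<le> q"
      using nn T by (cases r) (auto simp: min_def)
  qed
  have ple: "p \<le> s + ereal \<epsilon>" if "s < ereal T"
    using fX that by (auto simp: X.follows_def p_def s_def exitX_def trajX_def)
  have qle: "q \<le> r + ereal \<epsilon>" if "r < ereal T"
    using fY that by (auto simp: Y.follows_def q_def r_def exitY_def trajY_def)
  have nonneg: "0 \<le> 2 * M * (1 / discount G + 1) * exp (- discount G * T)" "0 \<le> M * \<epsilon>"
    "0 \<le> discount G * M * \<epsilon>"
    using X.M_pos discount_pos \<epsilon> by (auto intro!: mult_nonneg_nonneg add_nonneg_nonneg)
  have fin: "cost G x1 y1 \<alpha>1 \<beta>1 \<le> cost G x2 y2 \<alpha>2 \<beta>2 + 2 * M * (1 / discount G + 1) * exp (- discount G * T)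
      + (2 * L * T + 6 * M + discount G * M) * \<epsilon> + 2 * \<eta>"
    if "cost G x1 y1 \<alpha>1 \<beta>1 \<le> cost G x2 y2 \<alpha>2 \<beta>2 + w + (2 * L * \<epsilon> * T + 4 * M * \<epsilon>) + w'"
      "w + w' \<le> 2 * M * (1 / discount G + 1) * exp (- discount G * T) + 2 * (M * \<epsilon>) + discount G * M * \<epsilon> + 2 * \<eta>" for w w'
    using that by (simp add: algebra_simps)
  show ?thesis
  proof (cases "ereal T \<le> \<tau>")
    case True
    then have ex: "ereal T \<le> s" "ereal T \<le> r" by (auto simp: \<tau>_def)
    then have ex': "ereal T \<le> p" "ereal T \<le> q" using pge qge by (auto simp: min_def split: if_splits)
    have "\<bar>cost G x1 y1 \<alpha>1 \<beta>1 - integral {0..T} (discounted x1 y1 \<alpha>1 \<beta>1)\<bar> \<le> M * (1 / discount G + 1) * exp (- discount G * T)"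
      by (rule cost_diff[OF c(1,2) xy1]) (use T ex ex' in \<open>auto simp: p_def r_def\<close>)
    moreover have "\<bar>cost G x2 y2 \<alpha>2 \<beta>2 - integral {0..T} (discounted x2 y2 \<alpha>2 \<beta>2)\<bar> \<le> M * (1 / discount G + 1) * exp (- discount G * T)"
      by (rule cost_diff[OF c(3,4) xy2]) (use T ex ex' in \<open>auto simp: q_def s_def\<close>)
    moreover have "integral {0..T} (discounted x1 y1 \<alpha>1 \<beta>1) \<le>
      integral {0..T} (discounted x2 y2 \<alpha>2 \<beta>2) + 2 * L * \<epsilon> * T + 4 * M * \<epsilon>"
      by (rule integral_discounted_le[OF c fX fY]) (use T ex in \<open>auto simp: r_def s_def\<close>)
    ultimately have "cost G x1 y1 \<alpha>1 \<beta>1 \<le> cost G x2 y2 \<alpha>2 \<beta>2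
       + 2 * (M * (1 / discount G + 1) * exp (- discount G * T)) + (2 * L * \<epsilon> * T + 4 * M * \<epsilon>) + 0"
      by linarith
    then show ?thesis by (rule fin) (use nonneg \<eta> in simp)
  next
    case False
    then obtain t where t: "\<tau> = ereal t" "0 \<le> t" "t < T"
      using nn by (cases \<tau>) (auto simp: \<tau>_def min_def split: if_splits)
    have ts: "ereal t \<le> s" "ereal t \<le> r" using t(1) min.cobounded1[of s r] min.cobounded2[of s r] by (auto simp: \<tau>_def)
    have tp: "ereal t \<le> p" "ereal t \<le> q"
    proof -
      have "ereal t \<le> min s (ereal T)" "ereal t \<le> min r (ereal T)" using ts t(3) by auto
      then show "ereal t \<le> p" "ereal t \<le> q" using pge qge by (meson order_trans)+
    qed
    have late: "min p r \<le> ereal (t + \<epsilon>)" "min s q \<le> ereal (t + \<epsilon>)"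
    proof -
      \<comment> \<open>One leader exits at \<open>t\<close>. This ends its own pair, and its
        follower, at most \<epsilon> later, ends the other pair unless that has ended
        already.\<close>
      have "s = ereal t \<or> r = ereal t" using t(1) by (auto simp: \<tau>_def min_def split: if_splits)
      moreover have "ereal t \<le> ereal (t + \<epsilon>)" using \<epsilon> by simp
      ultimately show "min p r \<le> ereal (t + \<epsilon>)" "min s q \<le> ereal (t + \<epsilon>)"
        using ple qle t(3) by (auto simp: min_le_iff_disj)
    qed
    have "ereal t \<le> min p r" "ereal t \<le> min s q" using ts tp by auto
    then obtain t1 t2 where t12: "min p r = ereal t1" "min s q = ereal t2" "t \<le> t1" "t \<le> t2" "t1 \<le> t + \<epsilon>" "t2 \<le> t + \<epsilon>"
      using late by (cases "min p r"; cases "min s q") auto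
    have rc1: "\<bar>running_cost G (ereal t1) x1 y1 \<alpha>1 \<beta>1 - integral {0..t} (discounted x1 y1 \<alpha>1 \<beta>1)\<bar> \<le> M * \<epsilon>"
      by (rule running_cost_diff(2)[OF c(1,2) t(2)]) (use t12 in auto)
    have rc2: "\<bar>running_cost G (ereal t2) x2 y2 \<alpha>2 \<beta>2 - integral {0..t} (discounted x2 y2 \<alpha>2 \<beta>2)\<bar> \<le> M * \<epsilon>"
      by (rule running_cost_diff(2)[OF c(3,4) t(2)]) (use t12 in auto)
    have int: "integral {0..t} (discounted x1 y1 \<alpha>1 \<beta>1) \<le>
      integral {0..t} (discounted x2 y2 \<alpha>2 \<beta>2) + 2 * L * \<epsilon> * T + 4 * M * \<epsilon>"
      by (rule integral_discounted_le[OF c fX fY]) (use t ts in \<open>auto simp: r_def s_def\<close>)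
    have m1: "min (exitX G x1 \<alpha>1) (exitY G y1 \<beta>1) = ereal t1" and m2: "min (exitX G x2 \<alpha>2) (exitY G y2 \<beta>2) = ereal t2"
      using t12 by (auto simp: p_def q_def r_def s_def)
    have lipX: "norm (trajX G x \<alpha> b - trajX G x \<alpha> a) \<le> M * \<epsilon>" if "\<alpha> \<in> controlsX G" "0 \<le> a" "a \<le> b" "b \<le> a + \<epsilon>" for x \<alpha> a b
    proof -
      have "M * (b - a) \<le> M * \<epsilon>" using that X.M_pos by (intro mult_left_mono) auto
      then show ?thesis using X.trajectory_lip[of \<alpha> a b x] that by (simp add: trajX_def controlsX_def)
    qed
    have lipY: "norm (trajY G y \<beta> b - trajY G y \<beta> a) \<le> M * \<epsilon>" if "\<beta> \<in> controlsY G" "0 \<le> a" "a \<le> b" "b \<le> a + \<epsilon>" for y \<beta> a b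
    proof -
      have "M * (b - a) \<le> M * \<epsilon>" using that X.M_pos by (intro mult_left_mono) auto
      then show ?thesis using Y.trajectory_lip[of \<beta> a b y] that by (simp add: trajY_def controlsY_def)
    qed
    have KX: "trajX G x \<alpha> b \<in> cball x0 R" if "\<alpha> \<in> controlsX G" "0 \<le> b" "b \<le> t + \<epsilon>" "dist x0 x + M * (T + \<epsilon>) \<le> R" for x \<alpha> b
    proof -
      have "M * (b - 0) \<le> M * (T + \<epsilon>)" using that t X.M_pos by (intro mult_left_mono) auto
      then have "dist x (trajX G x \<alpha> b) \<le> M * (T + \<epsilon>)"
        using X.trajectory_lip[of \<alpha> 0 b x] X.trajectory_0[of \<alpha> x] that
        by (simp add: trajX_def controlsX_def dist_norm norm_minus_commute)
      then show ?thesis using that(4) dist_triangle[of x0 "trajX G x \<alpha> b" x] by simp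
    qed
    have KY: "trajY G y \<beta> b \<in> cball y0 R" if "\<beta> \<in> controlsY G" "0 \<le> b" "b \<le> t + \<epsilon>" "dist y0 y + M * (T + \<epsilon>) \<le> R" for y \<beta> b
    proof -
      have "M * (b - 0) \<le> M * (T + \<epsilon>)" using that t X.M_pos by (intro mult_left_mono) auto
      then have "dist y (trajY G y \<beta> b) \<le> M * (T + \<epsilon>)"
        using Y.trajectory_lip[of \<beta> 0 b y] Y.trajectory_0[of \<beta> y] that
        by (simp add: trajY_def controlsY_def dist_norm norm_minus_commute)
      then show ?thesis using that(4) dist_triangle[of y0 "trajY G y \<beta> b" y] by simp
    qed
    \<comment> \<open>The distance \<epsilon> at the common time plus two motions of length at most
      M \<epsilon>: hence the factor 1 + 2 M.\<close>
    have close3: "norm (a1 - a2) \<le> \<rho>"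
      if "norm (a1 - b1) \<le> M * \<epsilon>" "norm (b1 - b2) \<le> \<epsilon>" "norm (a2 - b2) \<le> M * \<epsilon>" for a1 a2 b1 b2 :: "'w::real_normed_vector"
    proof -
      have "norm (a1 - a2) \<le> norm (a1 - b1) + (norm (b1 - b2) + norm (b2 - a2))"
        using norm_triangle_ineq[of "a1 - b1" "b1 - a2"] norm_triangle_ineq[of "b1 - b2" "b2 - a2"] by simp
      also have "\<dots> \<le> (1 + 2 * M) * \<epsilon>" using that by (simp add: algebra_simps norm_minus_commute)
      finally show ?thesis using \<rho> by simp
    qed
    have clX: "norm (trajX G x1 \<alpha>1 t1 - trajX G x2 \<alpha>2 t2) \<le> \<rho>"
    proof (rule close3)
      show "norm (trajX G x1 \<alpha>1 t - trajX G x2 \<alpha>2 t) \<le> \<epsilon>"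
        using fX t ts by (auto simp: X.follows_def s_def exitX_def trajX_def)
    qed (use lipX c t t12 in auto)
    have clY: "norm (trajY G y1 \<beta>1 t1 - trajY G y2 \<beta>2 t2) \<le> \<rho>"
    proof (rule close3)
      show "norm (trajY G y1 \<beta>1 t - trajY G y2 \<beta>2 t) \<le> \<epsilon>"
        using fY t ts by (auto simp: Y.follows_def r_def exitY_def trajY_def norm_minus_commute)
    qed (use lipY c t t12 in auto)
    \<comment> \<open>Since the smaller of s and r is below \<open>T\<close>, the truncation in
      \<open>pge\<close> and \<open>qge\<close> does not affect the order of the exits.\<close>
    have \<tau>T: "min s r < ereal T" using t by (simp add: \<tau>_def)
    have "terminal x1 y1 \<alpha>1 \<beta>1 t1 \<le> terminal x2 y2 \<alpha>2 \<beta>2 t2 + 2 * \<eta>"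
    proof (rule terminal_le[OF c xy1 xy2 m1 m2 _ _ _ osc _ _ _ _ clX clY]; (fold p_def q_def r_def s_def)?)
      show "s < r \<Longrightarrow> s < q" using qge \<tau>T by (auto simp: min_def split: if_splits)
      show "r < s \<Longrightarrow> r < p" using pge \<tau>T by (auto simp: min_def split: if_splits)
      show "s = r \<Longrightarrow> r \<le> p \<and> s \<le> q" using pge qge \<tau>T by (auto simp: min_def split: if_splits)
    qed (use KX KY c t t12 R in auto)
    then have "exp (- discount G * t1) * terminal x1 y1 \<alpha>1 \<beta>1 t1 \<le> exp (- discount G * t1) * (terminal x2 y2 \<alpha>2 \<beta>2 t2 + 2 * \<eta>)"
      by (intro mult_left_mono) auto
    also have "\<dots> = exp (- discount G * t1) * (2 * \<eta>) + exp (- discount G * t2) * terminal x2 y2 \<alpha>2 \<beta>2 t2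
        + (exp (- discount G * t1) - exp (- discount G * t2)) * terminal x2 y2 \<alpha>2 \<beta>2 t2"
      by (simp add: algebra_simps)
    also have "\<dots> \<le> 1 * (2 * \<eta>) + exp (- discount G * t2) * terminal x2 y2 \<alpha>2 \<beta>2 t2 + (discount G * \<epsilon>) * M"
    proof (intro add_mono order_refl)
      show "exp (- discount G * t1) * (2 * \<eta>) \<le> 1 * (2 * \<eta>)"
        using discount_pos t t12 \<eta> by (intro mult_right_mono) auto
      have "(exp (- discount G * t1) - exp (- discount G * t2)) * terminal x2 y2 \<alpha>2 \<beta>2 t2
        \<le> \<bar>exp (- discount G * t1) - exp (- discount G * t2)\<bar> * \<bar>terminal x2 y2 \<alpha>2 \<beta>2 t2\<bar>"
        by (metis abs_ge_self abs_mult)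
      also have "\<dots> \<le> (discount G * \<epsilon>) * M"
      proof (rule mult_mono)
        have "discount G * \<bar>t1 - t2\<bar> \<le> discount G * \<epsilon>"
          using t12 discount_pos by (intro mult_left_mono) auto
        then show "\<bar>exp (- discount G * t1) - exp (- discount G * t2)\<bar> \<le> discount G * \<epsilon>"
          using exp_diff_le[OF discount_pos, of t1 t2] t t12 by linarith
        show "\<bar>terminal x2 y2 \<alpha>2 \<beta>2 t2\<bar> \<le> M" by (rule terminal_bound[OF c(3,4) xy2 m2])
      qed (use discount_pos \<epsilon> in auto)
      finally show "(exp (- discount G * t1) - exp (- discount G * t2)) * terminal x2 y2 \<alpha>2 \<beta>2 t2 \<le> (discount G * \<epsilon>) * M" .
    qed
    finally have term_le: "exp (- discount G * t1) * terminal x1 y1 \<alpha>1 \<beta>1 t1 \<le>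
      exp (- discount G * t2) * terminal x2 y2 \<alpha>2 \<beta>2 t2 + (2 * \<eta> + discount G * M * \<epsilon>)" by (simp add: mult_ac)
    have "cost G x1 y1 \<alpha>1 \<beta>1 \<le> cost G x2 y2 \<alpha>2 \<beta>2 + 2 * (M * \<epsilon>) + (2 * L * \<epsilon> * T + 4 * M * \<epsilon>) + (2 * \<eta> + discount G * M * \<epsilon>)"
      unfolding cost_finite[OF m1] cost_finite[OF m2] using rc1 rc2 int term_le by linarith
    then show ?thesis by (rule fin) (use nonneg in simp)
  qed
qed

section \<open>Continuity of the lower value\<close>

text \<open>The choices are \<open>T\<close>, R, \<rho>, \<epsilon>, \<delta>, in this order;
  discounting, following and terminal costs get e / 4 each. All four points vary near the centre, so
  exchanging the pairs gives the reverse inequality.\<close>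

lemma lower_value_le:
  assumes xy0: "x0 \<in> closure (domX G)" "y0 \<in> closure (domY G)" and "e > 0"
  shows "\<exists>\<delta>>0. \<forall>x1\<in>closure (domX G) \<inter> ball x0 \<delta>. \<forall>y1\<in>closure (domY G) \<inter> ball y0 \<delta>.
    \<forall>x2\<in>closure (domX G) \<inter> ball x0 \<delta>. \<forall>y2\<in>closure (domY G) \<inter> ball y0 \<delta>.
      lower_value G x1 y1 \<le> lower_value G x2 y2 + e"
proof (cases "strategiesX G = {} \<or> controlsY G = {}")
  case True
  \<comment> \<open>Infima and suprema over empty index sets are fixed default reals.\<close>
  then have "lower_value G x1 y1 = lower_value G x2 y2" for x1 y1 x2 y2 by (auto simp: lower_value_def)
  then have "lower_value G x1 y1 \<le> lower_value G x2 y2 + e" for x1 y1 x2 y2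
    using \<open>e > 0\<close> by (metis add_increasing2 less_imp_le order_refl)
  then show ?thesis by (intro exI[of _ 1]) auto
next
  case False
  define A where "A = 2 * M * (1 / discount G + 1)"
  have A: "A > 0" using X.M_pos discount_pos by (simp add: A_def add_pos_pos)
  \<comment> \<open>Then \<open>discount G * T\<close> equals 4 A / e, and exp w > w makes the
    discounted tail smaller than e / 4.\<close>
  define T where "T = 4 * A / (e * discount G)"
  have T0: "T > 0" using A \<open>e > 0\<close> discount_pos by (simp add: T_def)
  have "discount G * T = 4 * A / e" using \<open>e > 0\<close> discount_pos by (simp add: T_def)
  then have "4 * A / e < exp (discount G * T)"
    using exp_ge_add_one_self[of "discount G * T"] by linarith
  then have "A * exp (- discount G * T) < e / 4"
    using \<open>e > 0\<close> by (simp add: exp_minus field_simps)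
  note T = this T0
  define R where "R = 1 + M * (T + 1)"
  obtain \<rho>1 where \<rho>1: "\<rho>1 > 0" "oscillation_le (psiX G) (frontier (domX G) \<inter> cball x0 R) (closure (domY G) \<inter> cball y0 R) \<rho>1 (e / 8)"
    using uniform_continuity_Times[OF psiX_cont, of "e / 8" x0 R y0] \<open>e > 0\<close> unfolding oscillation_le_def by auto
  obtain \<rho>2 where \<rho>2: "\<rho>2 > 0" "oscillation_le (psiY G) (closure (domX G) \<inter> cball x0 R) (frontier (domY G) \<inter> cball y0 R) \<rho>2 (e / 8)"
    using uniform_continuity_Times[OF psiY_cont, of "e / 8" x0 R y0] \<open>e > 0\<close> unfolding oscillation_le_def by auto
  obtain \<rho>3 where \<rho>3: "\<rho>3 > 0" "oscillation_le (psiXY G) (frontier (domX G) \<inter> cball x0 R) (frontier (domY G) \<inter> cball y0 R) \<rho>3 (e / 8)"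
    using uniform_continuity_Times[OF psiXY_cont, of "e / 8" x0 R y0] \<open>e > 0\<close> unfolding oscillation_le_def by auto
  define \<rho> where "\<rho> = min \<rho>1 (min \<rho>2 \<rho>3)"
  have \<rho>: "\<rho> > 0" "\<rho> \<le> \<rho>1" "\<rho> \<le> \<rho>2" "\<rho> \<le> \<rho>3" using \<rho>1 \<rho>2 \<rho>3 by (auto simp: \<rho>_def)
  note osc = oscillation_le_mono[OF \<rho>1(2) \<rho>(2)] oscillation_le_mono[OF \<rho>2(2) \<rho>(3)] oscillation_le_mono[OF \<rho>3(2) \<rho>(4)]
  define B where "B = 2 * L * T + 6 * M + discount G * M"
  have B: "B > 0" using X.L_pos X.M_pos T discount_pos by (simp add: B_def add_pos_pos)
  define \<epsilon> where "\<epsilon> = min 1 (min (\<rho> / (1 + 2 * M)) (e / (4 * B)))"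
  have "1 + 2 * M > 0" using X.M_pos by simp
  then have \<epsilon>: "\<epsilon> > 0" "\<epsilon> \<le> 1" using \<rho>(1) B \<open>e > 0\<close> by (auto simp: \<epsilon>_def)
  have "\<epsilon> \<le> \<rho> / (1 + 2 * M)" "\<epsilon> \<le> e / (4 * B)" by (auto simp: \<epsilon>_def)
  then have \<epsilon>': "(1 + 2 * M) * \<epsilon> \<le> \<rho>" "B * \<epsilon> \<le> e / 4"
    using \<open>1 + 2 * M > 0\<close> B by (auto simp: field_simps)
  obtain \<delta>X where \<delta>X: "\<delta>X > 0" "\<And>x1 x2. x1 \<in> closure (domX G) \<inter> ball x0 \<delta>X \<Longrightarrow> x2 \<in> closure (domX G) \<inter> ball x0 \<delta>X \<Longrightarrow>
      \<exists>P\<in>tunings (controlsX G) (controlsX G). \<forall>\<alpha>\<in>controlsX G. X.follows (domX G) T \<epsilon> x1 (P \<alpha>) x2 \<alpha>"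
    using X.exit_tuning[OF domX ctrX T(2) \<epsilon>(1), of x0] unfolding controlsX_def by auto
  obtain \<delta>Y where \<delta>Y: "\<delta>Y > 0" "\<And>y1 y2. y1 \<in> closure (domY G) \<inter> ball y0 \<delta>Y \<Longrightarrow> y2 \<in> closure (domY G) \<inter> ball y0 \<delta>Y \<Longrightarrow>
      \<exists>P\<in>tunings (controlsY G) (controlsY G). \<forall>\<beta>\<in>controlsY G. Y.follows (domY G) T \<epsilon> y1 (P \<beta>) y2 \<beta>"
    using Y.exit_tuning[OF domY ctrY T(2) \<epsilon>(1), of y0] unfolding controlsY_def by auto
  define \<delta> where "\<delta> = min 1 (min \<delta>X \<delta>Y)"
  have "lower_value G x1 y1 \<le> lower_value G x2 y2 + e"
    if x1: "x1 \<in> closure (domX G) \<inter> ball x0 \<delta>" and y1: "y1 \<in> closure (domY G) \<inter> ball y0 \<delta>"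
      and x2: "x2 \<in> closure (domX G) \<inter> ball x0 \<delta>" and y2: "y2 \<in> closure (domY G) \<inter> ball y0 \<delta>" for x1 y1 x2 y2
  proof -
    obtain P where P: "P \<in> tunings (controlsX G) (controlsX G)" "\<And>\<alpha>. \<alpha> \<in> controlsX G \<Longrightarrow> X.follows (domX G) T \<epsilon> x1 (P \<alpha>) x2 \<alpha>"
      using \<delta>X(2)[of x1 x2] x1 x2 by (auto simp: \<delta>_def)
    obtain Q where Q: "Q \<in> tunings (controlsY G) (controlsY G)" "\<And>\<beta>. \<beta> \<in> controlsY G \<Longrightarrow> Y.follows (domY G) T \<epsilon> y2 (Q \<beta>) y1 \<beta>"
      using \<delta>Y(2)[of y2 y1] y1 y2 by (auto simp: \<delta>_def)
    have ctrl: "\<gamma> \<beta> \<in> controlsX G" if "\<gamma> \<in> strategiesX G" "\<beta> \<in> controlsY G" for \<gamma> \<beta>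
      using that by (auto simp: strategiesX_def tunings_def)
    show ?thesis
      unfolding lower_value_def
    proof (rule INF_SUP_le_plus[where c = "M * (1 / discount G + 1)"])
      fix \<gamma> assume \<gamma>: "\<gamma> \<in> strategiesX G"
      \<comment> \<open>The nested restriction mirrors two uses of \<open>tunings_compose\<close>;
        on controls the inner one disappears.\<close>
      define \<gamma>' where "\<gamma>' = (\<lambda>\<beta>\<in>controlsY G. P ((\<lambda>\<beta>\<in>controlsY G. \<gamma> (Q \<beta>)) \<beta>))"
      have "\<gamma>' \<in> strategiesX G"
        unfolding \<gamma>'_def strategiesX_def
        by (rule tunings_compose[OF tunings_compose[OF Q(1)] P(1)]) (use \<gamma> in \<open>simp add: strategiesX_def\<close>)
      moreover have "cost G x1 y1 (\<gamma>' \<beta>) \<beta> \<le> cost G x2 y2 (\<gamma> (Q \<beta>)) (Q \<beta>) + e" and "Q \<beta> \<in> controlsY G"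
        if \<beta>: "\<beta> \<in> controlsY G" for \<beta>
      proof -
        show Q\<beta>: "Q \<beta> \<in> controlsY G" using Q(1) \<beta> by (auto simp: tunings_def)
        have \<alpha>: "\<gamma> (Q \<beta>) \<in> controlsX G" by (rule ctrl[OF \<gamma> Q\<beta>])
        have P\<alpha>: "P (\<gamma> (Q \<beta>)) \<in> controlsX G" using P(1) \<alpha> by (auto simp: tunings_def)
        have le: "dist x0 x1 \<le> 1" "dist x0 x2 \<le> 1" "dist y0 y1 \<le> 1" "dist y0 y2 \<le> 1"
          using x1 x2 y1 y2 by (auto simp: \<delta>_def)
        have MT: "M * (T + \<epsilon>) \<le> M * (T + 1)" using X.M_pos \<epsilon> by simp
        have "cost G x1 y1 (P (\<gamma> (Q \<beta>))) \<beta> \<le> cost G x2 y2 (\<gamma> (Q \<beta>)) (Q \<beta>)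
          + A * exp (- discount G * T) + B * \<epsilon> + 2 * (e / 8)"
          unfolding A_def B_def
          by (rule cost_le[OF P\<alpha> \<beta> \<alpha> Q\<beta> _ _ _ _ T(2) \<epsilon>(1) P(2)[OF \<alpha>] Q(2)[OF \<beta>] osc \<epsilon>'(1)])
            (use x1 x2 y1 y2 le MT \<open>e > 0\<close> in \<open>auto simp: R_def\<close>)
        also have "\<dots> \<le> cost G x2 y2 (\<gamma> (Q \<beta>)) (Q \<beta>) + e" using T(1) \<epsilon>'(2) \<open>e > 0\<close> by linarith
        finally show "cost G x1 y1 (\<gamma>' \<beta>) \<beta> \<le> cost G x2 y2 (\<gamma> (Q \<beta>)) (Q \<beta>) + e"
          using \<beta> by (simp add: \<gamma>'_def)
      qed
      ultimately show "\<exists>\<gamma>'\<in>strategiesX G. \<forall>\<beta>\<in>controlsY G. \<exists>\<beta>'\<in>controlsY G.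
          cost G x1 y1 (\<gamma>' \<beta>) \<beta> \<le> cost G x2 y2 (\<gamma> \<beta>') \<beta>' + e" by blast
    qed (use False cost_bound ctrl x1 x2 y1 y2 in auto)
  qed
  moreover have "\<delta> > 0" using \<delta>X \<delta>Y by (simp add: \<delta>_def)
  ultimately show ?thesis by blast
qed

lemma continuous_on_lower_value:
  "continuous_on (closure (domX G) \<times> closure (domY G)) (\<lambda>(x, y). lower_value G x y)"
  unfolding continuous_on_iff
proof (intro ballI allI impI)
  fix w :: "'x \<times> 'y" and e :: real
  assume w: "w \<in> closure (domX G) \<times> closure (domY G)" and e: "0 < e"
  obtain x0 y0 where xy: "w = (x0, y0)" "x0 \<in> closure (domX G)" "y0 \<in> closure (domY G)" using w by auto
  obtain \<delta> where \<delta>: "\<delta> > 0" "\<And>x1 y1 x2 y2. x1 \<in> closure (domX G) \<inter> ball x0 \<delta> \<Longrightarrow> y1 \<in> closure (domY G) \<inter> ball y0 \<delta> \<Longrightarrow>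
     x2 \<in> closure (domX G) \<inter> ball x0 \<delta> \<Longrightarrow> y2 \<in> closure (domY G) \<inter> ball y0 \<delta> \<Longrightarrow>
      lower_value G x1 y1 \<le> lower_value G x2 y2 + e / 2"
    using lower_value_le[OF xy(2,3), of "e / 2"] e by auto
  show "\<exists>d>0. \<forall>w'\<in>closure (domX G) \<times> closure (domY G). dist w' w < d \<longrightarrow>
      dist (case w' of (x, y) \<Rightarrow> lower_value G x y) (case w of (x, y) \<Rightarrow> lower_value G x y) < e"
  proof (intro exI[of _ \<delta>] conjI ballI impI)
    fix w' assume w': "w' \<in> closure (domX G) \<times> closure (domY G)" "dist w' w < \<delta>"
    obtain x y where w'_eq: "w' = (x, y)" by (cases w')
    have d: "dist x x0 < \<delta>" "dist y y0 < \<delta>"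
      using w'(2) dist_fst_le[of w' w] dist_snd_le[of w' w] by (auto simp: w'_eq xy)
    have in1: "x \<in> closure (domX G) \<inter> ball x0 \<delta>" "y \<in> closure (domY G) \<inter> ball y0 \<delta>"
      using d w' by (auto simp: w'_eq dist_commute)
    have in0: "x0 \<in> closure (domX G) \<inter> ball x0 \<delta>" "y0 \<in> closure (domY G) \<inter> ball y0 \<delta>"
      using xy \<delta>(1) by auto
    show "dist (case w' of (x, y) \<Rightarrow> lower_value G x y) (case w of (x, y) \<Rightarrow> lower_value G x y) < e"
      using \<delta>(2)[OF in1 in0] \<delta>(2)[OF in0 in1] e by (simp add: w'_eq xy dist_real_def abs_less_iff)
  qed (rule \<delta>(1))
qed

end

section \<open>Exchange of the players\<close>

text \<open>Negation reverses the order of the terminal costs, and exchanging \<open>psiX\<close>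
  with \<open>psiY\<close> reverses it back, so \<open>psi_order\<close> is preserved.\<close>

definition swap_game ::
    "('x::euclidean_space, 'y::euclidean_space, 'a::euclidean_space, 'b::euclidean_space) exit_game \<Rightarrow> ('y, 'x, 'b, 'a) exit_game" where
  "swap_game G = \<lparr>domX = domY G, domY = domX G, ctrlX = ctrlY G, ctrlY = ctrlX G, discount = discount G,
     dynX = dynY G, dynY = dynX G, running = (\<lambda>y x b a. - running G x y a b),
     psiX = (\<lambda>y x. - psiY G x y), psiY = (\<lambda>y x. - psiX G x y), psiXY = (\<lambda>y x. - psiXY G x y)\<rparr>"

lemma swap_game_simps [simp]:
  "domX (swap_game G) = domY G" "domY (swap_game G) = domX G"
  "ctrlX (swap_game G) = ctrlY G" "ctrlY (swap_game G) = ctrlX G"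
  "discount (swap_game G) = discount G" "dynX (swap_game G) = dynY G" "dynY (swap_game G) = dynX G"
  "running (swap_game G) y x b a = - running G x y a b"
  "psiX (swap_game G) y x = - psiY G x y" "psiY (swap_game G) y x = - psiX G x y"
  "psiXY (swap_game G) y x = - psiXY G x y"
  "controlsX (swap_game G) = controlsY G" "controlsY (swap_game G) = controlsX G"
  "strategiesX (swap_game G) = strategiesY G"
  "trajX (swap_game G) = trajY G" "trajY (swap_game G) = trajX G"
  "exitX (swap_game G) = exitY G" "exitY (swap_game G) = exitX G"
  by (auto simp: swap_game_def controlsX_def controlsY_def strategiesX_def strategiesY_def
      trajX_def trajY_def exitX_def exitY_def fun_eq_iff)

lemma cost_swap_game: "cost (swap_game G) y x \<beta> \<alpha> = - cost G x y \<alpha> \<beta>"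
proof -
  have rc: "running_cost (swap_game G) \<sigma> y x \<beta> \<alpha> = - running_cost G \<sigma> x y \<alpha> \<beta>" for \<sigma>
    by (simp add: running_cost_def set_lebesgue_integral_def)
  show ?thesis
    by (auto simp: cost_def Let_def rc min.commute[of "exitY G y \<beta>"])
qed

text \<open>For reals Inf is defined as the negative of the Sup of the negated set, so the identity
  is formal and covers empty or unbounded sets as well.\<close>

lemma upper_value_swap_game: "upper_value G x y = - lower_value (swap_game G) y x"
proof -
  have "(SUP \<alpha>\<in>controlsX G. - cost G x y \<alpha> (\<xi> \<alpha>)) = - (INF \<alpha>\<in>controlsX G. cost G x y \<alpha> (\<xi> \<alpha>))" for \<xi>
    by (simp add: Inf_real_def image_image)
  then show ?thesis
    by (simp add: upper_value_def lower_value_def cost_swap_game Inf_real_def image_image)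
qed

lemma bounded_game_swap:
  assumes "bounded_game G M L"
  shows "bounded_game (swap_game G) M L"
proof -
  interpret bounded_game G M L by (rule assms)
  show ?thesis
  proof unfold_locales
    have "continuous_on (UNIV \<times> UNIV \<times> ctrlY G \<times> ctrlX G)
        (\<lambda>w. - (case (fst (snd w), fst w, snd (snd (snd w)), fst (snd (snd w))) of (x, y, a, b) \<Rightarrow> running G x y a b))"
      by (intro continuous_on_minus continuous_on_compose2[OF running_cont] continuous_intros) auto
    then show "continuous_on (UNIV \<times> UNIV \<times> ctrlX (swap_game G) \<times> ctrlY (swap_game G))
        (\<lambda>(x, y, a, b). running (swap_game G) x y a b)"
      by (simp add: case_prod_unfold)
    have *: "continuous_on (B \<times> A) (\<lambda>w. - (case (snd w, fst w) of (x, y) \<Rightarrow> \<psi> x y))"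
      if "continuous_on (A \<times> B) (\<lambda>(x, y). \<psi> x y)" for A B and \<psi> :: "'a \<Rightarrow> 'b \<Rightarrow> real"
      by (intro continuous_on_minus continuous_on_compose2[OF that] continuous_intros) auto
    show "continuous_on (frontier (domX (swap_game G)) \<times> closure (domY (swap_game G))) (\<lambda>(x, y). psiX (swap_game G) x y)"
      "continuous_on (closure (domX (swap_game G)) \<times> frontier (domY (swap_game G))) (\<lambda>(x, y). psiY (swap_game G) x y)"
      "continuous_on (frontier (domX (swap_game G)) \<times> frontier (domY (swap_game G))) (\<lambda>(x, y). psiXY (swap_game G) x y)"
      using *[OF psiX_cont] *[OF psiY_cont] *[OF psiXY_cont] by (simp_all add: case_prod_unfold)
    show "\<bar>running (swap_game G) x1 y1 a b - running (swap_game G) x2 y2 a b\<bar> \<le> L * norm ((x1, y1) - (x2, y2))"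
      if "a \<in> ctrlX (swap_game G)" "b \<in> ctrlY (swap_game G)" for x1 x2 y1 y2 a b
      using running_lip[of b a y1 x1 y2 x2] that by (simp add: norm_Pair abs_minus_commute add.commute)
  qed (use domX domY ctrX ctrY discount_pos running_bound psiX_bound psiY_bound psiXY_bound psi_order
        X.cont Y.cont X.M_pos X.L_pos X.h_bound Y.h_bound X.h_lip Y.h_lip in \<open>auto\<close>)
qed

section \<open>From the hypotheses to the continuity of both values\<close>

lemma bounded_game_intro:
  assumes reg: "regular_game G" and "boundary_controllable G"
    and ord: "\<And>x y. x \<in> frontier (domX G) \<Longrightarrow> y \<in> frontier (domY G) \<Longrightarrow>
           psiY G x y \<le> psiXY G x y \<and> psiXY G x y \<le> psiX G x y"
  obtains M L where "bounded_game G M L"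
proof -
  obtain M0 where M0: "\<forall>x. \<forall>a \<in> ctrlX G. norm (dynX G x a) \<le> M0"
        "\<forall>y. \<forall>b \<in> ctrlY G. norm (dynY G y b) \<le> M0"
        "\<forall>x y. \<forall>a \<in> ctrlX G. \<forall>b \<in> ctrlY G. running G x y a b \<le> M0"
        "\<forall>x \<in> frontier (domX G). \<forall>y \<in> closure (domY G). psiX G x y \<le> M0"
        "\<forall>x \<in> closure (domX G). \<forall>y \<in> frontier (domY G). psiY G x y \<le> M0"
        "\<forall>x \<in> frontier (domX G). \<forall>y \<in> frontier (domY G). psiXY G x y \<le> M0"
    using reg unfolding regular_game_def by (elim conjE exE)
  obtain L where L: "L > 0" "\<forall>x1 x2. \<forall>a \<in> ctrlX G. norm (dynX G x1 a - dynX G x2 a) \<le> L * norm (x1 - x2)"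
        "\<forall>y1 y2. \<forall>b \<in> ctrlY G. norm (dynY G y1 b - dynY G y2 b) \<le> L * norm (y1 - y2)"
        "\<forall>x1 x2 y1 y2. \<forall>a \<in> ctrlX G. \<forall>b \<in> ctrlY G.
           \<bar>running G x1 y1 a b - running G x2 y2 a b\<bar> \<le> L * norm ((x1, y1) - (x2, y2))"
    using reg unfolding regular_game_def by (elim conjE exE)
  have pos: "\<forall>x y. \<forall>a \<in> ctrlX G. \<forall>b \<in> ctrlY G. 0 \<le> running G x y a b"
     "\<forall>x \<in> frontier (domX G). \<forall>y \<in> closure (domY G). 0 \<le> psiX G x y"
     "\<forall>x \<in> closure (domX G). \<forall>y \<in> frontier (domY G). 0 \<le> psiY G x y"
     "\<forall>x \<in> frontier (domX G). \<forall>y \<in> frontier (domY G). 0 \<le> psiXY G x y"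
    and dom: "open (domX G)" "C2_boundary (domX G)" "open (domY G)" "C2_boundary (domY G)" "discount G > 0"
    and cont: "continuous_on (UNIV \<times> ctrlX G) (\<lambda>(x, a). dynX G x a)"
     "continuous_on (UNIV \<times> ctrlY G) (\<lambda>(y, b). dynY G y b)"
     "continuous_on (UNIV \<times> UNIV \<times> ctrlX G \<times> ctrlY G) (\<lambda>(x, y, a, b). running G x y a b)"
     "continuous_on (frontier (domX G) \<times> closure (domY G)) (\<lambda>(x, y). psiX G x y)"
     "continuous_on (closure (domX G) \<times> frontier (domY G)) (\<lambda>(x, y). psiY G x y)"
     "continuous_on (frontier (domX G) \<times> frontier (domY G)) (\<lambda>(x, y). psiXY G x y)"
    using reg unfolding regular_game_def by - (elim conjE exE, assumption)+
  \<comment> \<open>The given bound may be zero or negative; the maximum with 1 makes it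
    positive.\<close>
  define M where "M = max 1 M0"
  have M: "w \<le> M" if "w \<le> M0" for w using that by (simp add: M_def)
  have absM: "\<bar>w\<bar> \<le> M" if "0 \<le> w" "w \<le> M0" for w using that by (simp add: M_def)
  have "bounded_game G M L"
  proof unfold_locales
    show "M > 0" by (simp add: M_def)
    show "x \<in> frontier (domX G) \<Longrightarrow> \<exists>a1\<in>ctrlX G. \<exists>a2\<in>ctrlX G.
        dynX G x a1 \<bullet> outer_normal (domX G) x < 0 \<and> dynX G x a2 \<bullet> outer_normal (domX G) x > 0" for x
      using assms(2) unfolding boundary_controllable_def by blast
    show "y \<in> frontier (domY G) \<Longrightarrow> \<exists>b1\<in>ctrlY G. \<exists>b2\<in>ctrlY G.
        dynY G y b1 \<bullet> outer_normal (domY G) y < 0 \<and> dynY G y b2 \<bullet> outer_normal (domY G) y > 0" for y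
      using assms(2) unfolding boundary_controllable_def by blast
  qed (use M0 pos L dom cont ord in \<open>auto intro!: M absM\<close>)
  then show thesis by (rule that)
qed

theorem proposition3:
  fixes G :: "(real ^ 'n, real ^ 'm, real ^ 'k, real ^ 'l) exit_game"
  assumes "regular_game G"
    and "boundary_controllable G"
    and "constrained_tunings G"
    and "\<And>x y. x \<in> frontier (domX G) \<Longrightarrow> y \<in> frontier (domY G) \<Longrightarrow>
           psiY G x y \<le> psiXY G x y \<and> psiXY G x y \<le> psiX G x y"
  shows "continuous_on (closure (domX G) \<times> closure (domY G)) (\<lambda>(x, y). lower_value G x y)
       \<and> continuous_on (closure (domX G) \<times> closure (domY G)) (\<lambda>(x, y). upper_value G x y)"
proof -
  obtain M L where bg: "bounded_game G M L"
    using bounded_game_intro[OF assms(1,2,4)] by blast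
  \<comment> \<open>The exchanged game takes its arguments in reverse order, which the composition
    below undoes.\<close>
  have low: "continuous_on (closure (domY G) \<times> closure (domX G)) (\<lambda>(y, x). lower_value (swap_game G) y x)"
    using bounded_game.continuous_on_lower_value[OF bounded_game_swap[OF bg]] by simp
  have "continuous_on (closure (domX G) \<times> closure (domY G))
      (\<lambda>w. - (case (snd w, fst w) of (y, x) \<Rightarrow> lower_value (swap_game G) y x))"
    by (intro continuous_on_minus continuous_on_compose2[OF low] continuous_intros) auto
  then have "continuous_on (closure (domX G) \<times> closure (domY G)) (\<lambda>(x, y). upper_value G x y)"
    by (simp add: upper_value_swap_game case_prod_unfold)
  then show ?thesis using bounded_game.continuous_on_lower_value[OF bg] by blast
qed

end
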